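(* For every dimension $d\ge 1$ there is a constant $K_d'>0$ depending only on $d$ such that the following holds. Let $p$ be a zero-mean log-concave density on $\mathbb{R}^d$, with covariance matrix $\mathbf{\Sigma}$, satisfying the orthogonal independent components property. Let $\hat p$ be the proposed estimator computed from samples $X^{(1)},\dots,X^{(N)},Y^{(1)},\dots,Y^{(M)}\overset{\mathrm{iid}}{\sim}p$. Then for any $\epsilon>0$ and $0<\gamma<1$, $$h_d^2(\hat p,p)\le \epsilon$$ with probability at least $1-\gamma$ whenever $$N\ \ge\ \sup_{s\in\mathbb{S}^{d-1}}N^*\left(\epsilon/4d,\ \gamma/2d;\ p_s\right)\qquad\text{and}\qquad M\ \ge\ M^*\left((K_d'\,\mathrm{cond}(\mathbf{\Sigma}))^{-1/2}\,\epsilon^2,\ \gamma/2;\ p\right),$$ where $N^*$ and $M^*$ are respectively the sample complexities of the univariate density estimator and of the unmixing matrix estimator invoked by $\hat p$.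
   Context: A density $p$ on $\mathbb{R}^d$ is log-concave if $p=e^{-\varphi}$ with $\varphi:\mathbb{R}^d\to(-\infty,+\infty]$ closed, proper and convex. A zero-mean density $p$ satisfies the orthogonal independent components property if there is an orthogonal $\mathbf{W}\in\mathbb{R}^{d\times d}$ (an unmixing matrix) such that for $X\sim p$ the components of $\mathbf{W}X$ are independent; the rows $w_1,\dots,w_d$ of such a $\mathbf{W}$ are called independent directions of $p$ (they are not unique: e.g. they may be permuted and their signs flipped). For $s\in\mathbb{S}^{d-1}$, $p_s$ is the density on $\mathbb{R}$ of $s\cdot X$, $X\sim p$. The squared Hellinger distance is $h_d^2(p,q)=\frac12\int_{\mathbb{R}^d}(\sqrt{q}-\sqrt{p})^2\,dx$. $\mathrm{cond}(\mathbf{\Sigma})=\lambda_{\max}(\mathbf{\Sigma})/\lambda_{\min}(\mathbf{\Sigma})$. Proposed estimator: fix an unmixing matrix estimator (a procedure producing from samples an orthogonal matrix $\hat{\mathbf{W}}$) and a univariate density estimator (a procedure producing from real samples a probability density on $\mathbb{R}$). Compute $\hat{\mathbf{W}}$, with rows $\hat w_1,\dots,\hat w_d$, from $Y^{(1)},\dots,Y^{(M)}$. For each $i$, apply the univariate density estimator to the projected samples $\hat w_i\cdot X^{(1)},\dots,\hat w_i\cdot X^{(N)}$ to get $\hat p_{\hat w_i}$. Set $\hat p(x)=\prod_{i=1}^d\hat p_{\hat w_i}(\hat w_i\cdot x)$. Sample complexity of the univariate density estimator: for a univariate density $f$, $\epsilon>0$, $0<\gamma<1$, $N^*(\epsilon,\gamma;f)$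 is the minimal positive integer such that any number $N\ge N^*$ of iid samples from $f$ suffices for the resulting estimate $\hat f$ to satisfy $\mathbb{P}(h_1^2(\hat f,f)\le\epsilon)\ge1-\gamma$. Sample complexity of the unmixing matrix estimator: for $\epsilon>0$, $0<\gamma<1$, $M^*(\epsilon,\gamma;p)$ is the minimal positive integer such that any number $M\ge M^*$ of iid samples from $p$ suffices for the rows $\hat w_i$ of the resulting $\hat{\mathbf{W}}$ to satisfy, with probability at least $1-\gamma$, $\left(d^{-1}\sum_{i=1}^d\|\hat w_i-w_i\|_2^2\right)^{1/2}\le\epsilon$ for some independent directions $w_1,\dots,w_d$ of $p$ (labelled and signed so as to match $\hat w_1,\dots,\hat w_d$). Sample complexities are $+\infty$ if no such integer exists. *)

theory Defs
  imports "HOL-Probability.Probability"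
begin

section \<open>Densities\<close>

definition is_density :: "('a::euclidean_space \<Rightarrow> real) \<Rightarrow> bool" where
  "is_density p \<longleftrightarrow>
     p \<in> borel_measurable borel \<and> (\<forall>x. 0 \<le> p x) \<and> (\<integral>\<^sup>+ x. ennreal (p x) \<partial>lborel) = 1"

definition law :: "('a::euclidean_space \<Rightarrow> real) \<Rightarrow> 'a measure" where
  "law p = density lborel (\<lambda>x. ennreal (p x))"

definition epigraph :: "('a \<Rightarrow> ereal) \<Rightarrow> ('a \<times> real) set" where
  "epigraph \<phi> = {(x, t). \<phi> x \<le> ereal t}"

definition closed_proper_convex :: "('a::euclidean_space \<Rightarrow> ereal) \<Rightarrow> bool" where
  "closed_proper_convex \<phi> \<longleftrightarrow>
     closed (epigraph \<phi>) \<and> convex (epigraph \<phi>) \<and>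
     (\<forall>x. \<phi> x \<noteq> -\<infinity>) \<and> (\<exists>x. \<phi> x \<noteq> \<infinity>)"

(* exp (- \<phi> x) has to be spelled out at \<phi> x = \<infinity>, because real_of_ereal \<infinity> = 0. *)
definition log_concave :: "('a::euclidean_space \<Rightarrow> real) \<Rightarrow> bool" where
  "log_concave p \<longleftrightarrow>
     (\<exists>\<phi>. closed_proper_convex \<phi> \<and>
          (\<forall>x. p x = (if \<phi> x = \<infinity> then 0 else exp (- real_of_ereal (\<phi> x)))))"

definition mean :: "('a::euclidean_space \<Rightarrow> real) \<Rightarrow> 'a" where
  "mean p = (LINT x|law p. x)"

(* Integrability is required explicitly since the Bochner integral of a
   non-integrable function is 0 by convention. *)
definition zero_mean :: "('a::euclidean_space \<Rightarrow> real) \<Rightarrow> bool" where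
  "zero_mean p \<longleftrightarrow> integrable (law p) (\<lambda>x. x) \<and> mean p = 0"

definition covariance :: "(real ^ 'd \<Rightarrow> real) \<Rightarrow> real ^ 'd ^ 'd" where
  "covariance p =
     (\<chi> i j. LINT x|law p. (x $ i - mean p $ i) * (x $ j - mean p $ j))"

definition eigenvalues :: "real ^ 'd ^ 'd \<Rightarrow> real set" where
  "eigenvalues A = {l. \<exists>v. v \<noteq> 0 \<and> A *v v = l *\<^sub>R v}"

definition cond :: "real ^ 'd ^ 'd \<Rightarrow> real" where
  "cond A = Max (eigenvalues A) / Min (eigenvalues A)"

definition hellinger_sq :: "('a::euclidean_space \<Rightarrow> real) \<Rightarrow> ('a \<Rightarrow> real) \<Rightarrow> real" where
  "hellinger_sq p q = 1 / 2 * (LINT x|lborel. (sqrt (q x) - sqrt (p x))\<^sup>2)"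

(* Only determined up to null sets; for a unit vector s and a density p the law of
   the projection is absolutely continuous, so the Radon-Nikodym derivative is its density. *)
definition marginal_density :: "('a::euclidean_space \<Rightarrow> real) \<Rightarrow> 'a \<Rightarrow> real \<Rightarrow> real" where
  "marginal_density p s t =
     enn2real (RN_deriv lborel (distr (law p) borel (\<lambda>x. s \<bullet> x)) t)"

section \<open>Orthogonal independent components\<close>

definition unmixing :: "(real ^ 'd \<Rightarrow> real) \<Rightarrow> real ^ 'd ^ 'd \<Rightarrow> bool" where
  "unmixing p W \<longleftrightarrow>
     orthogonal_matrix W \<and>
     prob_space.indep_vars (law p) (\<lambda>_. borel) (\<lambda>i x. (W *v x) $ i) UNIV"

definition orthogonal_independent_components :: "(real ^ 'd \<Rightarrow> real) \<Rightarrow> bool" where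
  "orthogonal_independent_components p \<longleftrightarrow> (\<exists>W. unmixing p W)"

section \<open>Estimators\<close>

(* Samples of size n are functions on {..<n}, undefined elsewhere, as in the product
   measure PiM {..<n}. Joint measurability of (samples, t) \<mapsto> estimate at t is what makes
   events such as "the Hellinger error is at most \<epsilon>" measurable. *)
definition univariate_density_estimator ::
    "(nat \<Rightarrow> (nat \<Rightarrow> real) \<Rightarrow> real \<Rightarrow> real) \<Rightarrow> bool" where
  "univariate_density_estimator E \<longleftrightarrow>
     (\<forall>n>0. (\<lambda>(z, t). E n z t)
              \<in> borel_measurable ((\<Pi>\<^sub>M k\<in>{..<n}. (borel :: real measure)) \<Otimes>\<^sub>M borel) \<and>
            (\<forall>z \<in> space (\<Pi>\<^sub>M k\<in>{..<n}. (borel :: real measure)). is_density (E n z)))"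

definition unmixing_matrix_estimator ::
    "(nat \<Rightarrow> (nat \<Rightarrow> real ^ 'd) \<Rightarrow> real ^ 'd ^ 'd) \<Rightarrow> bool" where
  "unmixing_matrix_estimator U \<longleftrightarrow>
     (\<forall>m>0. U m \<in> borel_measurable (\<Pi>\<^sub>M k\<in>{..<m}. (borel :: (real ^ 'd) measure)) \<and>
            (\<forall>y \<in> space (\<Pi>\<^sub>M k\<in>{..<m}. (borel :: (real ^ 'd) measure)).
               orthogonal_matrix (U m y)))"

definition proposed_estimator ::
    "(nat \<Rightarrow> (nat \<Rightarrow> real ^ 'd) \<Rightarrow> real ^ 'd ^ 'd) \<Rightarrow> (nat \<Rightarrow> (nat \<Rightarrow> real) \<Rightarrow> real \<Rightarrow> real) \<Rightarrow>
     nat \<Rightarrow> nat \<Rightarrow> (nat \<Rightarrow> real ^ 'd) \<Rightarrow> (nat \<Rightarrow> real ^ 'd) \<Rightarrow> real ^ 'd \<Rightarrow> real" where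
  "proposed_estimator U E N M X Y x =
     (let W = U M Y
      in \<Prod>i\<in>UNIV. E N (\<lambda>n\<in>{..<N}. row i W \<bullet> X n) (row i W \<bullet> x))"

section \<open>Sample complexities\<close>

(* In both definitions the infimum is taken in enat, so it is the least element of the
   set, and \<infinity> if the set is empty. *)
definition N_star ::
    "(nat \<Rightarrow> (nat \<Rightarrow> real) \<Rightarrow> real \<Rightarrow> real) \<Rightarrow> real \<Rightarrow> real \<Rightarrow> (real \<Rightarrow> real) \<Rightarrow> enat" where
  "N_star E \<epsilon> \<gamma> f =
     Inf (enat ` {n. 0 < n \<and>
       (\<forall>N\<ge>n. \<P>(z in \<Pi>\<^sub>M k\<in>{..<N}. law f. hellinger_sq (E N z) f \<le> \<epsilon>) \<ge> 1 - \<gamma>)})"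

(* The existential quantifier over W also takes care of labelling and signs: permuting
   or negating rows of an unmixing matrix gives an unmixing matrix. *)
definition M_star ::
    "(nat \<Rightarrow> (nat \<Rightarrow> real ^ 'd) \<Rightarrow> real ^ 'd ^ 'd) \<Rightarrow> real \<Rightarrow> real \<Rightarrow> (real ^ 'd \<Rightarrow> real) \<Rightarrow> enat" where
  "M_star U \<epsilon> \<gamma> p =
     Inf (enat ` {m. 0 < m \<and>
       (\<forall>M\<ge>m. \<P>(y in \<Pi>\<^sub>M k\<in>{..<M}. law p.
          \<exists>W. unmixing p W \<and>
            sqrt (1 / real CARD('d) * (\<Sum>i\<in>UNIV. (norm (row i (U M y) - row i W))\<^sup>2)) \<le> \<epsilon>)
          \<ge> 1 - \<gamma>)})"

end

theory Submission
  imports Defs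
begin

text \<open>
  Let \<open>V\<close> be the estimated and \<open>W\<close> a true unmixing matrix. The Hellinger error of the estimator is
  at most twice its error relative to the product of the marginals of \<open>p\<close> along the rows of \<open>V\<close>, which
  is at most the sum of the univariate errors, plus twice the error of that product relative to \<open>p\<close>.
  In the coordinates of \<open>W\<close>, \<open>p\<close> is a product of univariate log-concave densities, each being up to
  a factor a restriction of \<open>p\<close> to a line, so the second error reduces to the \<open>L\<^sup>1\<close> distance between
  such a product and its composition with a matrix close to the identity. Replacing the rows of the identity one
  at a time leaves univariate integrals \<open>\<integral>|f (c t + s) - f t| dt\<close>, which for unimodal \<open>f\<close> are
  controlled by \<open>|c - 1|\<close> and \<open>|s| max f\<close>. Log-concavity bounds the maximum of \<open>f\<close> by a multiple of
  the inverse standard deviation, and \<open>|s|\<close> is of the order of the standard deviations of the other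
  components, whence the square root of the condition number.
\<close>

section \<open>Changes of variables for Lebesgue measure\<close>

text \<open>A log-concave density may jump at the boundary of its support, so a perturbation cannot
  be handled through its gradient; in L1, monotonicity on either side of the mode suffices, and the
  resulting bound is linear in the matrix error. The marginals of \<open>p\<close> along the rows of
  \<open>V\<close> are in general not components of \<open>p\<close>; their distance to the true
  components comes from the same L1 bound, because projecting to a line contracts L1. Error budget:
  each of the two Hellinger errors is at most \<open>\<epsilon> / 4\<close>, and the triangle
  inequality doubles both. The square in the matrix accuracy enters through
  \<open>\<epsilon>^2 \<le> \<epsilon>\<close> for \<open>\<epsilon> \<le> 1\<close>; larger
  \<open>\<epsilon>\<close> are trivial, the squared Hellinger distance being at most 1. The
  directions onto which \<open>X\<close> is projected depend on \<open>Y\<close>, whereas the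
  univariate sample complexity speaks of a fixed direction: the proof therefore works on the
  sections with \<open>Y\<close> fixed and integrates over \<open>Y\<close>.\<close>

lemma nn_integral_lborel_translate:
  fixes a :: "'a::euclidean_space"
  assumes [measurable]: "f \<in> borel_measurable borel"
  shows "(\<integral>\<^sup>+x. f (a + x) \<partial>lborel) = (\<integral>\<^sup>+x. f x \<partial>lborel)"
proof -
  have "(\<integral>\<^sup>+x. f x \<partial>lborel) = (\<integral>\<^sup>+x. f x \<partial>distr lborel borel ((+) a))"
    by (simp add: lborel_distr_plus)
  then show ?thesis by (simp add: nn_integral_distr)
qed

lemma nn_integral_lborel_reflect:
  fixes a :: "'a::euclidean_space"
  assumes [measurable]: "f \<in> borel_measurable borel"
  shows "(\<integral>\<^sup>+x. f (a - x) \<partial>lborel) = (\<integral>\<^sup>+x. f x \<partial>lborel)"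
proof -
  have "(\<integral>\<^sup>+x. f x \<partial>lborel) = (\<integral>\<^sup>+x. f x \<partial>density (distr lborel borel (\<lambda>x. a + (-1) *\<^sub>R x)) (\<lambda>_. 1))"
    by (subst lborel_affine[of "-1" a]) simp_all
  then show ?thesis by (simp add: nn_integral_distr density_1)
qed

text \<open>Redrawing the coordinate of a point along a unit vector from an arbitrary probability density stands
  in for Fubini's theorem in an orthonormal basis containing that vector.\<close>

lemma nn_integral_lborel_resample:
  fixes s :: "'a::euclidean_space" and \<phi> :: "real \<Rightarrow> ennreal"
  assumes [measurable]: "G \<in> borel_measurable borel" "\<phi> \<in> borel_measurable borel"
    and s: "norm s = 1" and \<phi>: "(\<integral>\<^sup>+t. \<phi> t \<partial>lborel) = 1"
  shows "(\<integral>\<^sup>+x. G x \<partial>lborel)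
    = (\<integral>\<^sup>+x. \<phi> (s \<bullet> x) * (\<integral>\<^sup>+t. G (x + (t - s \<bullet> x) *\<^sub>R s) \<partial>lborel) \<partial>lborel)"
proof -
  have ss: "s \<bullet> s = 1" using s by (simp add: dot_square_norm)
  have "(\<integral>\<^sup>+x. \<phi> (s \<bullet> x) * (\<integral>\<^sup>+t. G (x + (t - s \<bullet> x) *\<^sub>R s) \<partial>lborel) \<partial>lborel)
      = (\<integral>\<^sup>+x. \<phi> (s \<bullet> x) * (\<integral>\<^sup>+t. G (x + t *\<^sub>R s) \<partial>lborel) \<partial>lborel)"
  proof (rule nn_integral_cong)
    fix x
    have "(\<integral>\<^sup>+t. G (x + (t - s \<bullet> x) *\<^sub>R s) \<partial>lborel) = (\<integral>\<^sup>+t. G (x + t *\<^sub>R s) \<partial>lborel)"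
      using nn_integral_lborel_translate[of "\<lambda>t. G (x + t *\<^sub>R s)" "- (s \<bullet> x)"] by simp
    then show "\<phi> (s \<bullet> x) * (\<integral>\<^sup>+t. G (x + (t - s \<bullet> x) *\<^sub>R s) \<partial>lborel)
      = \<phi> (s \<bullet> x) * (\<integral>\<^sup>+t. G (x + t *\<^sub>R s) \<partial>lborel)" by simp
  qed
  also have "\<dots> = (\<integral>\<^sup>+x. (\<integral>\<^sup>+t. \<phi> (s \<bullet> x) * G (x + t *\<^sub>R s) \<partial>lborel) \<partial>lborel)"
    by (simp add: nn_integral_cmult)
  also have "\<dots> = (\<integral>\<^sup>+t. (\<integral>\<^sup>+x. \<phi> (s \<bullet> x) * G (x + t *\<^sub>R s) \<partial>lborel) \<partial>lborel)"
    by (rule lborel_pair.Fubini'[symmetric]) measurable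
  \<comment> \<open>Translating \<open>x\<close> along \<open>s\<close> frees \<open>G\<close> of
    \<open>t\<close>; the remaining integral of \<open>\<phi>\<close> over \<open>t\<close> is
    1.\<close>
  also have "\<dots> = (\<integral>\<^sup>+t. (\<integral>\<^sup>+x. \<phi> (s \<bullet> x - t) * G x \<partial>lborel) \<partial>lborel)"
  proof (rule nn_integral_cong)
    fix t :: real
    show "(\<integral>\<^sup>+x. \<phi> (s \<bullet> x) * G (x + t *\<^sub>R s) \<partial>lborel) = (\<integral>\<^sup>+x. \<phi> (s \<bullet> x - t) * G x \<partial>lborel)"
      using nn_integral_lborel_translate[of "\<lambda>x. \<phi> (s \<bullet> x) * G (x + t *\<^sub>R s)" "- (t *\<^sub>R s)"]
      by (simp add: inner_diff_right ss)
  qed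
  also have "\<dots> = (\<integral>\<^sup>+x. (\<integral>\<^sup>+t. \<phi> (s \<bullet> x - t) * G x \<partial>lborel) \<partial>lborel)"
    by (rule lborel_pair.Fubini') measurable
  also have "\<dots> = (\<integral>\<^sup>+x. G x \<partial>lborel)"
    by (simp add: nn_integral_multc nn_integral_lborel_reflect \<phi>)
  finally show ?thesis by simp
qed

text \<open>The double integral of \<^term>\<open>\<lambda>x y. f (y + B x) * g y\<close> is evaluated by translating \<^term>\<open>y\<close>
  by \<^term>\<open>B x\<close>, and then \<^term>\<open>x\<close> by the preimage of \<^term>\<open>y\<close>. This replaces a determinant.\<close>

lemma nn_integral_lborel_linear_exchange:
  fixes B :: "'a::euclidean_space \<Rightarrow> 'a"
  assumes lin: "linear B" and surj: "surj B"
    and [measurable]: "f \<in> borel_measurable borel" "g \<in> borel_measurable borel"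
  shows "(\<integral>\<^sup>+x. f (B x) \<partial>lborel) * (\<integral>\<^sup>+y. g y \<partial>lborel)
    = (\<integral>\<^sup>+y. f y \<partial>lborel) * (\<integral>\<^sup>+x. g (- B x) \<partial>lborel)"
proof -
  interpret linear B by (rule lin)
  have B[measurable]: "B \<in> borel_measurable borel"
    by (intro borel_measurable_continuous_onI linear_continuous_on linear_conv_bounded_linear[THEN iffD1] lin)
  have "(\<integral>\<^sup>+x. (\<integral>\<^sup>+y. f (y + B x) * g y \<partial>lborel) \<partial>lborel)
    = (\<integral>\<^sup>+y. (\<integral>\<^sup>+x. f (y + B x) * g y \<partial>lborel) \<partial>lborel)"
    by (rule lborel_pair.Fubini'[symmetric]) measurable
  also have "\<dots> = (\<integral>\<^sup>+y. (\<integral>\<^sup>+x. f (B x) \<partial>lborel) * g y \<partial>lborel)"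
  proof (rule nn_integral_cong)
    fix y
    obtain x0 where x0: "y = B x0" using surj by (metis surjD)
    have "(\<integral>\<^sup>+x. f (y + B x) \<partial>lborel) = (\<integral>\<^sup>+x. f (B x) \<partial>lborel)"
      using nn_integral_lborel_translate[of "\<lambda>x. f (B x)" x0] by (simp add: x0 add)
    then show "(\<integral>\<^sup>+x. f (y + B x) * g y \<partial>lborel) = (\<integral>\<^sup>+x. f (B x) \<partial>lborel) * g y"
      by (simp add: nn_integral_multc)
  qed
  also have "\<dots> = (\<integral>\<^sup>+x. f (B x) \<partial>lborel) * (\<integral>\<^sup>+y. g y \<partial>lborel)"
    by (simp add: nn_integral_cmult)
  finally have 1: "(\<integral>\<^sup>+x. (\<integral>\<^sup>+y. f (y + B x) * g y \<partial>lborel) \<partial>lborel)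
    = (\<integral>\<^sup>+x. f (B x) \<partial>lborel) * (\<integral>\<^sup>+y. g y \<partial>lborel)" .
  have "(\<integral>\<^sup>+x. (\<integral>\<^sup>+y. f (y + B x) * g y \<partial>lborel) \<partial>lborel)
    = (\<integral>\<^sup>+x. (\<integral>\<^sup>+y. f y * g (y - B x) \<partial>lborel) \<partial>lborel)"
  proof (rule nn_integral_cong)
    fix x
    show "(\<integral>\<^sup>+y. f (y + B x) * g y \<partial>lborel) = (\<integral>\<^sup>+y. f y * g (y - B x) \<partial>lborel)"
      using nn_integral_lborel_translate[of "\<lambda>y. f (y + B x) * g y" "- B x"] by simp
  qed
  also have "\<dots> = (\<integral>\<^sup>+y. (\<integral>\<^sup>+x. f y * g (y - B x) \<partial>lborel) \<partial>lborel)"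
    by (rule lborel_pair.Fubini'[symmetric]) measurable
  also have "\<dots> = (\<integral>\<^sup>+y. f y * (\<integral>\<^sup>+x. g (- B x) \<partial>lborel) \<partial>lborel)"
  proof (rule nn_integral_cong)
    fix y
    obtain x0 where x0: "y = B x0" using surj by (metis surjD)
    have "(\<integral>\<^sup>+x. g (y - B x) \<partial>lborel) = (\<integral>\<^sup>+x. g (- B x) \<partial>lborel)"
      using nn_integral_lborel_translate[of "\<lambda>x. g (y - B x)" x0] by (simp add: x0 add)
    then show "(\<integral>\<^sup>+x. f y * g (y - B x) \<partial>lborel) = f y * (\<integral>\<^sup>+x. g (- B x) \<partial>lborel)"
      by (simp add: nn_integral_cmult)
  qed
  also have "\<dots> = (\<integral>\<^sup>+y. f y \<partial>lborel) * (\<integral>\<^sup>+x. g (- B x) \<partial>lborel)"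
    by (simp add: nn_integral_multc)
  finally show ?thesis using 1 by simp
qed

text \<open>The exchange identity is tested with \<open>g\<close> the indicator of the unit ball.
  The bound on \<open>B\<close> puts the preimage of that ball inside the ball of radius
  \<open>c\<close>, and the ratio of the two volumes is the Jacobian factor.\<close>

lemma nn_integral_lborel_linear_le:
  fixes B :: "'a::euclidean_space \<Rightarrow> 'a"
  assumes lin: "linear B" and B: "\<And>x. norm x \<le> c * norm (B x)" and c: "0 < c"
    and [measurable]: "f \<in> borel_measurable borel"
  shows "(\<integral>\<^sup>+x. f (B x) \<partial>lborel) \<le> ennreal (c ^ DIM('a)) * (\<integral>\<^sup>+y. f y \<partial>lborel)"
proof -
  interpret linear B by (rule lin)
  have "inj B"
  proof (rule injI)
    fix x y assume "B x = B y"
    then show "x = y" using B[of "x - y"] by (simp add: diff)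
  qed
  then have surj: "surj B" using lin by (simp add: linear_injective_imp_surjective)
  have Bm[measurable]: "B \<in> borel_measurable borel"
    by (intro borel_measurable_continuous_onI linear_continuous_on linear_conv_bounded_linear[THEN iffD1] lin)
  define v where "v = emeasure lborel (cball (0::'a) 1)"
  have v: "v = ennreal (unit_ball_vol DIM('a))" by (simp add: v_def emeasure_cball)
  have v0: "v \<noteq> 0" "v \<noteq> \<top>" using unit_ball_vol_pos[of "DIM('a)"] by (auto simp: v simp del: unit_ball_vol_pos)
  have "(\<integral>\<^sup>+x. f (B x) \<partial>lborel) * v = (\<integral>\<^sup>+x. f (B x) \<partial>lborel) * (\<integral>\<^sup>+y. indicator (cball (0::'a) 1) y \<partial>lborel)"
    by (simp add: v_def)
  also have "\<dots> = (\<integral>\<^sup>+y. f y \<partial>lborel) * (\<integral>\<^sup>+x. indicator (cball 0 1) (- B x) \<partial>lborel)"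
    by (rule nn_integral_lborel_linear_exchange[OF lin surj]) (auto intro!: borel_measurable_indicator)
  also have "\<dots> \<le> (\<integral>\<^sup>+y. f y \<partial>lborel) * (\<integral>\<^sup>+x. indicator (cball 0 c) (x::'a) \<partial>lborel)"
  proof (intro mult_left_mono nn_integral_mono)
    fix x
    have "norm x \<le> c" if "norm (B x) \<le> 1"
      using B[of x] mult_left_mono[OF that, of c] c by linarith
    then show "indicator (cball 0 1) (- B x) \<le> (indicator (cball 0 c) x :: ennreal)"
      by (auto simp: indicator_def)
  qed simp
  also have "\<dots> = (ennreal (c ^ DIM('a)) * (\<integral>\<^sup>+y. f y \<partial>lborel)) * v"
    using c by (simp add: emeasure_cball v ennreal_mult mult_ac)
  finally show ?thesis
    using v0 by (metis ennreal_mult_le_mult_iff mult.commute)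
qed

text \<open>The same test function, now with equality: an isometry preserves the unit ball, whose
  finite nonzero volume cancels.\<close>

lemma nn_integral_lborel_isometry:
  fixes B :: "'a::euclidean_space \<Rightarrow> 'a"
  assumes "orthogonal_transformation B" and [measurable]: "f \<in> borel_measurable borel"
  shows "(\<integral>\<^sup>+x. f (B x) \<partial>lborel) = (\<integral>\<^sup>+y. f y \<partial>lborel)"
proof -
  have lin: "linear B" and n: "\<And>x. norm (B x) = norm x"
    using assms(1) by (auto simp: orthogonal_transformation)
  have surj: "surj B" using assms(1) by (rule orthogonal_transformation_surj)
  define v where "v = emeasure lborel (cball (0::'a) 1)"
  have v: "v = ennreal (unit_ball_vol DIM('a))" by (simp add: v_def emeasure_cball)
  have v0: "v \<noteq> 0" "v \<noteq> \<top>" using unit_ball_vol_pos[of "DIM('a)"] by (auto simp: v simp del: unit_ball_vol_pos)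
  have "(\<integral>\<^sup>+x. f (B x) \<partial>lborel) * v = (\<integral>\<^sup>+x. f (B x) \<partial>lborel) * (\<integral>\<^sup>+y. indicator (cball (0::'a) 1) y \<partial>lborel)"
    by (simp add: v_def)
  also have "\<dots> = (\<integral>\<^sup>+y. f y \<partial>lborel) * (\<integral>\<^sup>+x. indicator (cball 0 1) (- B x) \<partial>lborel)"
    by (rule nn_integral_lborel_linear_exchange[OF lin surj]) (auto intro!: borel_measurable_indicator)
  also have "(\<lambda>x. indicator (cball 0 1) (- B x) :: ennreal) = indicator (cball 0 1)"
    by (auto simp: indicator_def n fun_eq_iff)
  finally have "(\<integral>\<^sup>+x. f (B x) \<partial>lborel) * v = (\<integral>\<^sup>+y. f y \<partial>lborel) * v" by (simp add: v_def)
  then show ?thesis using v0 by (metis ennreal_mult_cancel_left mult.commute)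
qed

section \<open>Univariate log-concave densities\<close>

text \<open>A form of log-concavity that passes to restrictions to affine subspaces and positive multiples.
  The convention \<^term>\<open>0 powr u = 0\<close> makes the inequality trivial where \<^term>\<open>f\<close> vanishes.\<close>

definition log_concave_usc :: "('a::euclidean_space \<Rightarrow> real) \<Rightarrow> bool" where
  "log_concave_usc f \<longleftrightarrow> (\<forall>x. 0 \<le> f x) \<and>
    (\<forall>x y u. 0 \<le> u \<longrightarrow> u \<le> 1 \<longrightarrow> f x powr u * f y powr (1 - u) \<le> f (u *\<^sub>R x + (1 - u) *\<^sub>R y)) \<and>
    (\<forall>l>0. closed {x. l \<le> f x})"

text \<open>Convexity of the epigraph bounds \<open>\<phi>\<close> at a convex combination, and
  exponentiating gives the weighted geometric mean. A superlevel set at \<open>l\<close> is the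
  section of the epigraph at height \<open>- ln l\<close>, so it inherits closedness.\<close>

lemma log_concave_imp_log_concave_usc:
  assumes "log_concave p" shows "log_concave_usc p"
proof -
  obtain \<phi> where \<phi>: "closed_proper_convex \<phi>"
    and p: "\<And>x. p x = (if \<phi> x = \<infinity> then 0 else exp (- real_of_ereal (\<phi> x)))"
    using assms by (auto simp: log_concave_def)
  have fin: "\<exists>r. \<phi> x = ereal r \<and> p x = exp (- r)" if "\<phi> x \<noteq> \<infinity>" for x
    using that \<phi> p[of x] by (cases "\<phi> x") (auto simp: closed_proper_convex_def)
  have conv: "convex (epigraph \<phi>)" and cl: "closed (epigraph \<phi>)"
    using \<phi> by (auto simp: closed_proper_convex_def)
  have nn: "0 \<le> p x" for x by (simp add: p)
  have "p x powr u * p y powr (1 - u) \<le> p (u *\<^sub>R x + (1 - u) *\<^sub>R y)" if u: "0 \<le> u" "u \<le> 1" for x y u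
  proof (cases "\<phi> x = \<infinity> \<or> \<phi> y = \<infinity>")
    case True
    then show ?thesis using nn by (auto simp: p)
  next
    case False
    then obtain a b where ab: "\<phi> x = ereal a" "p x = exp (- a)" "\<phi> y = ereal b" "p y = exp (- b)"
      using fin by meson
    have "(x, a) \<in> epigraph \<phi>" "(y, b) \<in> epigraph \<phi>" using ab by (auto simp: epigraph_def)
    from convexD[OF conv this, of u "1 - u"] u
    have le: "\<phi> (u *\<^sub>R x + (1 - u) *\<^sub>R y) \<le> ereal (u * a + (1 - u) * b)"
      by (auto simp: epigraph_def)
    then obtain c where c: "\<phi> (u *\<^sub>R x + (1 - u) *\<^sub>R y) = ereal c"
        "p (u *\<^sub>R x + (1 - u) *\<^sub>R y) = exp (- c)"
      using fin[of "u *\<^sub>R x + (1 - u) *\<^sub>R y"] by fastforce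
    have "p x powr u * p y powr (1 - u) = exp (- (u * a + (1 - u) * b))"
      by (simp add: ab powr_def exp_add[symmetric])
    also have "\<dots> \<le> exp (- c)" using le c by simp
    finally show ?thesis using c by simp
  qed
  moreover have "closed {x. l \<le> p x}" if l: "0 < l" for l
  proof -
    have "{x. l \<le> p x} = (\<lambda>x. (x, - ln l)) -` epigraph \<phi>"
    proof (rule set_eqI)
      fix x
      show "x \<in> {x. l \<le> p x} \<longleftrightarrow> x \<in> (\<lambda>x. (x, - ln l)) -` epigraph \<phi>"
      proof (cases "\<phi> x = \<infinity>")
        case True then show ?thesis using l by (simp add: p epigraph_def)
      next
        case False
        then obtain r where r: "\<phi> x = ereal r" "p x = exp (- r)" using fin by blast
        have "l \<le> exp (- r) \<longleftrightarrow> ln l \<le> - r" using l by (metis exp_gt_zero ln_exp ln_le_cancel_iff)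
        then show ?thesis by (auto simp: r epigraph_def)
      qed
    qed
    then show ?thesis using cl by (auto intro!: closed_vimage continuous_intros)
  qed
  ultimately show ?thesis using nn by (auto simp: log_concave_usc_def)
qed

text \<open>Serves to recover a component of \<open>p\<close>: the line runs in the direction of a
  row of an unmixing matrix, and \<open>c\<close> renormalizes the restriction to mass 1.\<close>

lemma log_concave_usc_line:
  fixes p :: "'a::euclidean_space \<Rightarrow> real"
  assumes p: "log_concave_usc p" and c: "0 < c"
  shows "log_concave_usc (\<lambda>t::real. c * p (x + t *\<^sub>R v))"
proof -
  have nn: "0 \<le> p x" for x using p by (auto simp: log_concave_usc_def)
  have 1: "(c * p (x + s *\<^sub>R v)) powr u * (c * p (x + t *\<^sub>R v)) powr (1 - u)
      \<le> c * p (x + (u *\<^sub>R s + (1 - u) *\<^sub>R t) *\<^sub>R v)" if u: "0 \<le> u" "u \<le> 1" for s t u :: real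
  proof -
    have "c powr u * c powr (1 - u) = c" using c by (simp add: powr_add[symmetric])
    then have "(c * p (x + s *\<^sub>R v)) powr u * (c * p (x + t *\<^sub>R v)) powr (1 - u)
      = c * (p (x + s *\<^sub>R v) powr u * p (x + t *\<^sub>R v) powr (1 - u))"
      using c nn by (simp add: powr_mult mult_ac)
    also have "\<dots> \<le> c * p (u *\<^sub>R (x + s *\<^sub>R v) + (1 - u) *\<^sub>R (x + t *\<^sub>R v))"
      using p u c by (intro mult_left_mono) (auto simp: log_concave_usc_def)
    also have "u *\<^sub>R (x + s *\<^sub>R v) + (1 - u) *\<^sub>R (x + t *\<^sub>R v) = x + (u *\<^sub>R s + (1 - u) *\<^sub>R t) *\<^sub>R v"
      by (simp add: algebra_simps)
    finally show ?thesis .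
  qed
  have 2: "closed {t. l \<le> c * p (x + t *\<^sub>R v)}" if l: "0 < l" for l
  proof -
    have "{t. l \<le> c * p (x + t *\<^sub>R v)} = (\<lambda>t. x + t *\<^sub>R v) -` {y. l / c \<le> p y}"
      using c by (auto simp: field_simps)
    moreover have "closed ((\<lambda>t. x + t *\<^sub>R v) -` {y. l / c \<le> p y})"
      using p l c by (intro closed_vimage continuous_intros) (auto simp: log_concave_usc_def)
    ultimately show ?thesis by (simp only:)
  qed
  show ?thesis using 1 2 nn c unfolding log_concave_usc_def by auto
qed

text \<open>The level \<open>l\<close> is its own weighted geometric mean, so positive superlevel
  sets are convex, that is, intervals.\<close>

lemma log_concave_usc_convexD:
  fixes f :: "real \<Rightarrow> real"
  assumes f: "log_concave_usc f" and "l \<le> f x" "l \<le> f y" "0 < l" "x \<le> t" "t \<le> y"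
  shows "l \<le> f t"
proof (cases "x = y")
  case True then show ?thesis using assms by auto
next
  case False
  then have xy: "x < y" using assms by auto
  define u where "u = (y - t) / (y - x)"
  have u: "0 \<le> u" "u \<le> 1" using assms xy by (auto simp: u_def field_simps)
  have "u * (y - x) = y - t" using xy by (simp add: u_def)
  then have t: "u *\<^sub>R x + (1 - u) *\<^sub>R y = t" by (simp add: algebra_simps)
  have "l = l powr u * l powr (1 - u)" using assms by (simp add: powr_add[symmetric])
  also have "\<dots> \<le> f x powr u * f y powr (1 - u)" using assms u by (intro mult_mono powr_mono2) auto
  also have "\<dots> \<le> f (u *\<^sub>R x + (1 - u) *\<^sub>R y)" using f u unfolding log_concave_usc_def by blast
  finally show ?thesis by (simp only: t)
qed

section \<open>Mode, unimodality and exponential tails of a log-concave density\<close>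

lemma is_density_superlevel_length:
  fixes f :: "real \<Rightarrow> real"
  assumes "is_density f" and "x \<le> y" and "0 \<le> l" and l: "\<And>t. x \<le> t \<Longrightarrow> t \<le> y \<Longrightarrow> l \<le> f t"
  shows "l * (y - x) \<le> 1"
proof -
  have "ennreal (l * (y - x)) = (\<integral>\<^sup>+t. ennreal l * indicator {x..y} t \<partial>lborel)"
    using assms by (simp add: nn_integral_cmult_indicator ennreal_mult)
  also have "\<dots> \<le> (\<integral>\<^sup>+t. ennreal (f t) \<partial>lborel)"
    using l by (intro nn_integral_mono) (auto simp: indicator_def intro!: ennreal_leI)
  also have "\<dots> = 1" using assms by (simp add: is_density_def)
  finally show ?thesis by simp
qed

text \<open>Positive superlevel sets are compact: closed by upper semicontinuity, and of diameter at
  most \<open>1 / l\<close> because a rectangle of height \<open>l\<close> below the graph has area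
  at most 1. The mode is a common point of the sets at all attained positive levels.\<close>

lemma log_concave_usc_mode:
  fixes f :: "real \<Rightarrow> real"
  assumes f: "log_concave_usc f" and d: "is_density f"
  obtains m where "0 < f m" "\<And>t. f t \<le> f m"
proof -
  have "\<exists>t. 0 < f t"
  proof (rule ccontr)
    assume "\<not> ?thesis"
    then have "f = (\<lambda>_. 0)" using d by (force simp: is_density_def fun_eq_iff not_less intro: antisym)
    then show False using d by (simp add: is_density_def)
  qed
  then obtain t0 where t0: "0 < f t0" by blast
  define S where "S l = {t. l \<le> f t}" for l
  have cpt: "compact (S l)" if "0 < l" for l
  proof -
    have "closed (S l)" using f that by (auto simp: log_concave_usc_def S_def)
    moreover have "dist x y \<le> 1 / l" if "x \<in> S l" "y \<in> S l" for x y
    proof -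
      have *: "\<bar>x - y\<bar> \<le> 1 / l" if "x \<in> S l" "y \<in> S l" "x \<le> y" for x y
      proof -
        have "l * (y - x) \<le> 1"
          using \<open>0 < l\<close> that log_concave_usc_convexD[OF f, of l x y]
          by (intro is_density_superlevel_length[OF d]) (auto simp: S_def)
        then show ?thesis using \<open>0 < l\<close> that by (simp add: field_simps)
      qed
      show ?thesis using *[of x y] *[of y x] that by (cases "x \<le> y") (auto simp: dist_real_def)
    qed
    then have "bounded (S l)" by (metis bounded_two_points)
    ultimately show ?thesis by (simp add: compact_eq_bounded_closed)
  qed
  \<comment> \<open>Finitely many of these sets are nested and share the point of highest level;
    compactness extends this to all of them.\<close>
  have "S (f t0) \<inter> (\<Inter>x\<in>{x. 0 < f x}. S (f x)) \<noteq> {}"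
  proof (rule compact_imp_fip_image[OF cpt[OF t0]])
    show "closed (S (f i))" if "i \<in> {x. 0 < f x}" for i using f that by (auto simp: log_concave_usc_def S_def)
    fix I assume I: "finite I" "I \<subseteq> {x. 0 < f x}"
    define J where "J = insert t0 I"
    have "Max (f ` J) \<in> f ` J" using I by (intro Max_in) (auto simp: J_def)
    then obtain j where "j \<in> J" "f j = Max (f ` J)" by force
    then have "f i \<le> f j" if "i \<in> J" for i
      using that I by (metis J_def Max_ge finite_imageI finite_insert imageI)
    then have "j \<in> S (f t0) \<inter> (\<Inter>x\<in>I. S (f x))" by (auto simp: S_def J_def)
    then show "S (f t0) \<inter> (\<Inter>x\<in>I. S (f x)) \<noteq> {}" by blast
  qed
  then obtain m where m: "f t0 \<le> f m" "\<And>x. 0 < f x \<Longrightarrow> f x \<le> f m" by (auto simp: S_def)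
  have "f t \<le> f m" for t using m(2)[of t] m(2)[OF t0] t0 by linarith
  then show ?thesis using m(1) t0 by (intro that[of m]) linarith+
qed

text \<open>The superlevel interval at the value of the point farther from \<open>m\<close> contains
  \<open>m\<close>, hence everything in between. Value 0 is split off because
  \<open>log_concave_usc_convexD\<close> asks for a positive level.\<close>

lemma log_concave_usc_unimodal:
  fixes f :: "real \<Rightarrow> real"
  assumes f: "log_concave_usc f" and m: "\<And>t. f t \<le> f m"
  shows "x \<le> y \<Longrightarrow> y \<le> m \<Longrightarrow> f x \<le> f y" and "m \<le> x \<Longrightarrow> x \<le> y \<Longrightarrow> f y \<le> f x"
proof -
  have nn: "0 \<le> f x" for x using f by (auto simp: log_concave_usc_def)
  show "f x \<le> f y" if "x \<le> y" "y \<le> m"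
    using log_concave_usc_convexD[OF f, of "f x" x m y] m that nn[of x] nn[of y] by (cases "f x = 0") auto
  show "f y \<le> f x" if "m \<le> x" "x \<le> y"
    using log_concave_usc_convexD[OF f, of "f y" m y x] m that nn[of x] nn[of y] by (cases "f y = 0") auto
qed

lemma is_density_nn_integral: "is_density f \<Longrightarrow> (\<integral>\<^sup>+x. ennreal (f x) \<partial>lborel) = 1"
  and is_density_measurable: "is_density f \<Longrightarrow> f \<in> borel_measurable borel"
  and is_density_nonneg: "is_density f \<Longrightarrow> 0 \<le> f x"
  by (auto simp: is_density_def)

text \<open>At distance \<open>4 / f m\<close> from the mode the density has dropped to at most
  \<open>f m * exp (- 1)\<close>; otherwise the rectangle of that width and height would have area
  \<open>4 * exp (- 1)\<close>, which exceeds 1. Log-concavity continues the decay at the rate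
  \<open>f m / 4\<close>. Nearer to the mode the factor 3, an upper bound of \<open>exp 1\<close>,
  makes the claim trivial.\<close>

lemma log_concave_usc_decay:
  fixes f :: "real \<Rightarrow> real"
  assumes f: "log_concave_usc f" and d: "is_density f" and m: "\<And>t. f t \<le> f m" "0 < f m"
    and \<sigma>: "\<sigma> = 1 \<or> \<sigma> = - 1" and u: "0 \<le> u"
  shows "f (m + \<sigma> * u) \<le> 3 * f m * exp (- (f m / 4) * u)"
proof (cases "u \<le> 4 / f m")
  case True
  then have "- 1 \<le> - (f m / 4) * u" using m(2) by (simp add: field_simps)
  then have "exp (- 1) \<le> exp (- (f m / 4) * u)" by simp
  moreover have "1 \<le> 3 * exp (- 1 :: real)" using exp_le by (simp add: exp_minus field_simps)
  ultimately have "1 \<le> 3 * exp (- (f m / 4) * u)" by linarith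
  then have "f m * 1 \<le> f m * (3 * exp (- (f m / 4) * u))" using m(2) by (intro mult_left_mono) auto
  then show ?thesis using m(1)[of "m + \<sigma> * u"] by (simp add: mult_ac)
next
  case False
  define a where "a = 4 / f m"
  have a: "0 < a" "a < u" using m(2) False by (auto simp: a_def)
  define x where "x = m + \<sigma> * a"
  have fx: "f x \<le> f m * exp (- 1)"
  proof (rule ccontr)
    assume n: "\<not> ?thesis"
    have "f m * exp (- 1) * (max m x - min m x) \<le> 1"
    proof (rule is_density_superlevel_length[OF d])
      fix t assume t: "min m x \<le> t" "t \<le> max m x"
      have "f x \<le> f t"
        using t log_concave_usc_unimodal[OF f m(1)] by (cases "x \<le> m") auto
      then show "f m * exp (- 1) \<le> f t" using n by simp
    qed (use m in auto)
    moreover have "max m x - min m x = a" using a \<sigma> by (auto simp: x_def)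
    ultimately have "4 * exp (- 1) \<le> (1::real)" using m(2) by (simp add: a_def)
    then show False using exp_le by (simp add: exp_minus field_simps)
  qed
  \<comment> \<open>With weight \<open>v\<close> on the far point, the convex combination with the
    mode is \<open>x\<close>, where the drop by \<open>exp (- 1)\<close> is known.\<close>
  define v where "v = a / u"
  have v: "0 < v" "v \<le> 1" "v * u = a" using a by (auto simp: v_def)
  have nn: "0 \<le> f t" for t using d by (simp add: is_density_def)
  have "f (m + \<sigma> * u) powr v * f m powr (1 - v) \<le> f (v *\<^sub>R (m + \<sigma> * u) + (1 - v) *\<^sub>R m)"
    using f v unfolding log_concave_usc_def by (meson less_imp_le)
  also have "v *\<^sub>R (m + \<sigma> * u) + (1 - v) *\<^sub>R m = x"
    using v(3) by (simp add: x_def algebra_simps)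
  also have "f x \<le> f m * exp (- 1)" by (rule fx)
  finally have le: "f (m + \<sigma> * u) powr v * f m powr (1 - v) \<le> f m * exp (- 1)" .
  show ?thesis
  proof (cases "f (m + \<sigma> * u) = 0")
    case True then show ?thesis using m by simp
  next
    case False
    define y where "y = f (m + \<sigma> * u)"
    have y: "0 < y" using False nn[of "m + \<sigma> * u"] by (simp add: y_def)
    have "ln (y powr v * f m powr (1 - v)) \<le> ln (f m * exp (- 1))"
      using le y m(2) by (subst ln_le_cancel_iff) (auto simp: y_def)
    then have "v * ln y + (1 - v) * ln (f m) \<le> ln (f m) - 1"
      using y m(2) by (simp add: ln_mult ln_powr)
    then have "v * (ln y - ln (f m)) \<le> - 1" by (simp add: algebra_simps)
    then have "ln y - ln (f m) \<le> - 1 / v" using v by (simp add: field_simps)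
    also have "- 1 / v = - (f m / 4) * u" using a m(2) by (simp add: v_def a_def)
    finally have "ln y \<le> ln (f m) + - (f m / 4) * u" by simp
    then have "exp (ln y) \<le> exp (ln (f m) + - (f m / 4) * u)" by (subst exp_le_cancel_iff)
    then have "y \<le> f m * exp (- (f m / 4) * u)"
      unfolding exp_add using y m(2) by simp
    also have "\<dots> \<le> 3 * f m * exp (- (f m / 4) * u)" using m(2) by simp
    finally show ?thesis by (simp add: y_def)
  qed
qed

text \<open>With \<open>l = f m / 4\<close> the envelope \<open>3 * f m * exp (- l * u)\<close> is
  12 times the exponential density of rate \<open>l\<close>, whose second moment is
  \<open>2 / l^2\<close>. The two sides of the mode together give \<open>48 / l^2\<close>, which is
  \<open>768 / (f m)^2\<close>.\<close>

lemma log_concave_usc_mode_moment: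
  fixes f :: "real \<Rightarrow> real"
  assumes f: "log_concave_usc f" and d: "is_density f" and m: "\<And>t. f t \<le> f m" "0 < f m"
  shows "(\<integral>\<^sup>+t. ennreal ((t - m)\<^sup>2 * f t) \<partial>lborel) \<le> ennreal (784 / (f m)\<^sup>2)"
proof -
  have [measurable]: "f \<in> borel_measurable borel" using d by (simp add: is_density_def)
  define l where "l = f m / 4"
  have l: "0 < l" "f m = 4 * l" using m by (auto simp: l_def)
  define g where "g u = ennreal (erlang_density 0 l u * u ^ 2)" for u :: real
  have [measurable]: "g \<in> borel_measurable borel" unfolding g_def by measurable
  have gi: "(\<integral>\<^sup>+u. g u \<partial>lborel) = ennreal (2 / l\<^sup>2)"
    unfolding g_def using nn_integral_erlang_ith_moment[OF l(1), of 0 2] by (simp add: fact_numeral)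
  have gi': "(\<integral>\<^sup>+u. g (- u) \<partial>lborel) = ennreal (2 / l\<^sup>2)"
    using nn_integral_lborel_reflect[of g 0] gi by simp
  have "(\<integral>\<^sup>+t. ennreal ((t - m)\<^sup>2 * f t) \<partial>lborel) = (\<integral>\<^sup>+u. ennreal (u\<^sup>2 * f (m + u)) \<partial>lborel)"
    using nn_integral_lborel_translate[of "\<lambda>t. ennreal ((t - m)\<^sup>2 * f t)" m] by simp
  also have "\<dots> \<le> (\<integral>\<^sup>+u. ennreal 12 * (g u + g (- u)) \<partial>lborel)"
  proof (rule nn_integral_mono)
    fix u
    have e: "12 * (l * exp (- l * w) * w\<^sup>2) = w\<^sup>2 * (3 * f m * exp (- l * w))" for w
      by (simp add: l(2))
    show "ennreal (u\<^sup>2 * f (m + u)) \<le> ennreal 12 * (g u + g (- u))"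
    proof (cases "0 \<le> u")
      case True
      have "u\<^sup>2 * f (m + u) \<le> 12 * (l * exp (- l * u) * u\<^sup>2)"
        unfolding e using log_concave_usc_decay[OF f d m, of 1 u] True
        by (intro mult_left_mono) (auto simp: l_def)
      then have "ennreal (u\<^sup>2 * f (m + u)) \<le> ennreal 12 * g u"
        using True l by (simp add: g_def erlang_density_def ennreal_mult[symmetric] ennreal_leI del: ennreal_numeral)
      then show ?thesis by (rule order_trans) (auto intro!: mult_left_mono)
    next
      case False
      have "u\<^sup>2 * f (m + u) \<le> 12 * (l * exp (- l * - u) * (- u)\<^sup>2)"
        unfolding e using log_concave_usc_decay[OF f d m, of "-1" "- u"] False
        by (auto intro!: mult_left_mono simp: l_def)
      then have "ennreal (u\<^sup>2 * f (m + u)) \<le> ennreal 12 * g (- u)"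
        using False l by (simp add: g_def erlang_density_def ennreal_mult[symmetric] ennreal_leI del: ennreal_numeral)
      then show ?thesis by (rule order_trans) (auto intro!: mult_left_mono)
    qed
  qed
  also have "\<dots> = ennreal 12 * (ennreal (2 / l\<^sup>2) + ennreal (2 / l\<^sup>2))"
    by (subst nn_integral_cmult) (auto simp: nn_integral_add gi gi' simp del: ennreal_numeral)
  also have "\<dots> = ennreal (12 * (4 / l\<^sup>2))"
    by (simp add: ennreal_plus[symmetric] ennreal_mult[symmetric] del: ennreal_numeral ennreal_plus)
  also have "12 * (4 / l\<^sup>2) = 768 / (f m)\<^sup>2" by (simp add: l power_mult_distrib)
  \<comment> \<open>784 is the square of 28, which makes the root mean square distance to the mode
    at most \<open>28 / f m\<close>.\<close>
  also have "ennreal (768 / (f m)\<^sup>2) \<le> ennreal (784 / (f m)\<^sup>2)"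
    by (intro ennreal_leI divide_right_mono) auto
  finally show ?thesis .
qed

section \<open>L1 distance between a unimodal density and its affine images\<close>

lemma unimodal_shift_bound:
  fixes f :: "real \<Rightarrow> real"
  assumes d: "is_density f" and m: "\<And>t. f t \<le> f m"
    and mono: "\<And>x y. x \<le> y \<Longrightarrow> y \<le> m \<Longrightarrow> f x \<le> f y" "\<And>x y. m \<le> x \<Longrightarrow> x \<le> y \<Longrightarrow> f y \<le> f x"
  shows "(\<integral>\<^sup>+t. ennreal \<bar>f (t + s) - f t\<bar> \<partial>lborel) \<le> ennreal (2 * f m * \<bar>s\<bar>)"
proof -
  have [measurable]: "f \<in> borel_measurable borel" using d by (simp add: is_density_def)
  have nn: "0 \<le> f x" for x using d by (simp add: is_density_def)
  have *: "(\<integral>\<^sup>+t. ennreal \<bar>f (t + s) - f t\<bar> \<partial>lborel) \<le> ennreal (2 * f m * s)" if s: "0 \<le> s" for s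
  proof -
    let ?D = "\<integral>\<^sup>+t. ennreal \<bar>f (t + s) - f t\<bar> \<partial>lborel"
    have i1: "(\<integral>\<^sup>+t. ennreal (f (t + s)) \<partial>lborel) = 1"
      using nn_integral_lborel_translate[of "\<lambda>t. ennreal (f t)" s] d by (simp add: is_density_def add.commute)
    have i2: "(\<integral>\<^sup>+t. ennreal (f t) \<partial>lborel) = 1" using d by (simp add: is_density_def)
    \<comment> \<open>\<open>|a - b| + a + b = 2 * max a b\<close> reduces the claim to an upper
      bound on the integral of the maximum, without subtraction in \<open>ennreal\<close>.\<close>
    have "?D + 2 = (\<integral>\<^sup>+t. ennreal \<bar>f (t + s) - f t\<bar> + (ennreal (f (t + s)) + ennreal (f t)) \<partial>lborel)"
      by (simp add: nn_integral_add i1 i2)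
    also have "\<dots> = (\<integral>\<^sup>+t. 2 * ennreal (max (f (t + s)) (f t)) \<partial>lborel)"
      using nn by (intro nn_integral_cong) (auto simp: ennreal_plus[symmetric] ennreal_mult[symmetric]
          ennreal_numeral[symmetric] max_def abs_if simp del: ennreal_plus ennreal_numeral intro!: arg_cong[where f=ennreal])
    also have "\<dots> = 2 * (\<integral>\<^sup>+t. ennreal (max (f (t + s)) (f t)) \<partial>lborel)"
      by (simp add: nn_integral_cmult)
    finally have eq: "?D + 2 = 2 * (\<integral>\<^sup>+t. ennreal (max (f (t + s)) (f t)) \<partial>lborel)" .
    \<comment> \<open>For \<open>0 \<le> s\<close> the maximum is the shifted copy to the left of
      its mode \<open>m - s\<close>, the original to the right of \<open>m\<close>, and at most
      \<open>f m\<close> on the window of length \<open>s\<close> between the modes. The two outer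
      pieces together have mass at most 1.\<close>
    have "(\<integral>\<^sup>+t. ennreal (max (f (t + s)) (f t)) \<partial>lborel)
      \<le> (\<integral>\<^sup>+t. ennreal (f (t + s)) * indicator {..<m} (t + s) + ennreal (f m) * indicator {m - s..m} t
            + ennreal (f t) * indicator {m<..} t \<partial>lborel)"
    proof (rule nn_integral_mono)
      fix t
      have "max (f (t + s)) (f t) = f (t + s)" if "t + s < m" using mono(1)[of t "t + s"] that s by auto
      moreover have "max (f (t + s)) (f t) = f t" if "m < t" using mono(2)[of t "t + s"] that s by auto
      moreover have "max (f (t + s)) (f t) \<le> f m" using m by auto
      ultimately show "ennreal (max (f (t + s)) (f t)) \<le> ennreal (f (t + s)) * indicator {..<m} (t + s)
          + ennreal (f m) * indicator {m - s..m} t + ennreal (f t) * indicator {m<..} t"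
        using s by (cases "t + s < m"; cases "m < t") (auto simp: indicator_def intro!: ennreal_leI)
    qed
    also have "\<dots> = (\<integral>\<^sup>+t. ennreal (f (t + s)) * indicator {..<m} (t + s) \<partial>lborel)
       + (\<integral>\<^sup>+t. ennreal (f m) * indicator {m - s..m} t \<partial>lborel) + (\<integral>\<^sup>+t. ennreal (f t) * indicator {m<..} t \<partial>lborel)"
      by (simp add: nn_integral_add)
    also have "(\<integral>\<^sup>+t. ennreal (f (t + s)) * indicator {..<m} (t + s) \<partial>lborel)
       = (\<integral>\<^sup>+t. ennreal (f t) * indicator {..<m} t \<partial>lborel)"
      using nn_integral_lborel_translate[of "\<lambda>t. ennreal (f t) * indicator {..<m} t" s] by (simp add: add.commute)
    also have "(\<integral>\<^sup>+t. ennreal (f m) * indicator {m - s..m} t \<partial>lborel) = ennreal (f m * s)"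
      using s nn by (simp add: nn_integral_cmult_indicator ennreal_mult)
    also have "(\<integral>\<^sup>+t. ennreal (f t) * indicator {..<m} t \<partial>lborel) + ennreal (f m * s)
        + (\<integral>\<^sup>+t. ennreal (f t) * indicator {m<..} t \<partial>lborel)
      = (\<integral>\<^sup>+t. ennreal (f t) * indicator {..<m} t + ennreal (f t) * indicator {m<..} t \<partial>lborel) + ennreal (f m * s)"
      by (simp add: nn_integral_add add_ac)
    also have "\<dots> \<le> (\<integral>\<^sup>+t. ennreal (f t) \<partial>lborel) + ennreal (f m * s)"
      by (intro add_right_mono nn_integral_mono) (auto simp: indicator_def)
    also have "\<dots> = 1 + ennreal (f m * s)" by (simp add: i2)
    finally have "?D + 2 \<le> 2 * (1 + ennreal (f m * s))" unfolding eq by (rule mult_left_mono) simp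
    also have "\<dots> = ennreal (2 * f m * s) + 2"
      using s nn by (simp add: distrib_left mult.assoc ennreal_mult add.commute)
    finally show ?thesis by (simp add: ennreal_add_left_cancel_le add.commute)
  qed
  show ?thesis
  proof (cases "0 \<le> s")
    case True then show ?thesis using *[of s] by simp
  next
    case False
    have "(\<integral>\<^sup>+t. ennreal \<bar>f (t + s) - f t\<bar> \<partial>lborel) = (\<integral>\<^sup>+t. ennreal \<bar>f (t + - s) - f t\<bar> \<partial>lborel)"
      using nn_integral_lborel_translate[of "\<lambda>t. ennreal \<bar>f (t + s) - f t\<bar>" "- s"]
      by (simp add: abs_minus_commute)
    then show ?thesis using *[of "- s"] False by simp
  qed
qed

text \<open>Scaling about the mode moves all points away from it or all points towards it. The two
  functions are therefore comparable everywhere, and their L1 distance is the difference of the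
  masses \<open>1 / c\<close> and 1.\<close>

lemma unimodal_scale_bound:
  fixes f :: "real \<Rightarrow> real"
  assumes d: "is_density f"
    and mono: "\<And>x y. x \<le> y \<Longrightarrow> y \<le> m \<Longrightarrow> f x \<le> f y" "\<And>x y. m \<le> x \<Longrightarrow> x \<le> y \<Longrightarrow> f y \<le> f x"
    and c: "0 < c"
  shows "(\<integral>\<^sup>+t. ennreal \<bar>f (m + c * (t - m)) - f t\<bar> \<partial>lborel) \<le> ennreal \<bar>1 / c - 1\<bar>"
proof -
  have [measurable]: "f \<in> borel_measurable borel" using d by (simp add: is_density_def)
  have nn: "0 \<le> f x" for x using d by (simp add: is_density_def)
  let ?D = "\<integral>\<^sup>+t. ennreal \<bar>f (m + c * (t - m)) - f t\<bar> \<partial>lborel"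
  have i1: "(\<integral>\<^sup>+t. ennreal (f t) \<partial>lborel) = 1" using d by (simp add: is_density_def)
  have "(\<integral>\<^sup>+t. ennreal (f t) \<partial>lborel) = ennreal c * (\<integral>\<^sup>+t. ennreal (f (m + c * (t - m))) \<partial>lborel)"
    using nn_integral_real_affine[of "\<lambda>t. ennreal (f t)" c "m - c * m"] c by (simp add: algebra_simps)
  then have "ennreal (1 / c) * 1 = ennreal (1 / c) * ennreal c * (\<integral>\<^sup>+t. ennreal (f (m + c * (t - m))) \<partial>lborel)"
    using i1 by (simp add: mult.assoc)
  then have i2: "(\<integral>\<^sup>+t. ennreal (f (m + c * (t - m))) \<partial>lborel) = ennreal (1 / c)"
    using c by (simp add: ennreal_mult[symmetric])
  have cmp1: "f (m + c * (t - m)) \<le> f t" if "1 \<le> c" for t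
  proof (cases "m \<le> t")
    case True
    have "t \<le> m + c * (t - m)" using mult_right_mono[OF that, of "t - m"] True by simp
    then show ?thesis using True by (intro mono(2)) auto
  next
    case False
    have "c * (t - m) \<le> 1 * (t - m)" using that False by (intro mult_right_mono_neg) auto
    then have "m + c * (t - m) \<le> t" by simp
    then show ?thesis using False by (intro mono(1)) auto
  qed
  have cmp2: "f t \<le> f (m + c * (t - m))" if "c \<le> 1" for t
  proof (cases "m \<le> t")
    case True
    have "m + c * (t - m) \<le> t" using mult_right_mono[OF that, of "t - m"] True by simp
    then show ?thesis using True c by (intro mono(2)) auto
  next
    case False
    have "1 * (t - m) \<le> c * (t - m)" using that False by (intro mult_right_mono_neg) auto
    then have "t \<le> m + c * (t - m)" by simp
    then show ?thesis using False c by (intro mono(1)) (auto simp: mult_nonneg_nonpos)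
  qed
  show ?thesis
  proof (cases "1 \<le> c")
    case True
    have "?D + ennreal (1 / c) = (\<integral>\<^sup>+t. ennreal \<bar>f (m + c * (t - m)) - f t\<bar> + ennreal (f (m + c * (t - m))) \<partial>lborel)"
      by (simp add: nn_integral_add i2)
    also have "\<dots> = (\<integral>\<^sup>+t. ennreal (f t) \<partial>lborel)"
      using nn cmp1[OF True] by (intro nn_integral_cong) (simp add: ennreal_plus[symmetric] abs_of_nonpos del: ennreal_plus)
    also have "\<dots> = ennreal (1 - 1 / c) + ennreal (1 / c)"
      using True by (subst ennreal_plus[symmetric]) (auto simp: i1)
    finally have "?D = ennreal (1 - 1 / c)" by simp
    then show ?thesis using True by (simp add: ennreal_leI)
  next
    case False
    then have "c \<le> 1" by simp
    have "?D + 1 = (\<integral>\<^sup>+t. ennreal \<bar>f (m + c * (t - m)) - f t\<bar> + ennreal (f t) \<partial>lborel)"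
      by (simp add: nn_integral_add i1)
    also have "\<dots> = (\<integral>\<^sup>+t. ennreal (f (m + c * (t - m))) \<partial>lborel)"
      using nn cmp2[OF \<open>c \<le> 1\<close>] by (intro nn_integral_cong) (simp add: ennreal_plus[symmetric] abs_of_nonneg del: ennreal_plus)
    also have "\<dots> = ennreal (1 / c - 1) + 1"
      using \<open>c \<le> 1\<close> c by (subst ennreal_1[symmetric], subst ennreal_plus[symmetric]) (auto simp: i2)
    finally have "?D = ennreal (1 / c - 1)" by simp
    then show ?thesis by (simp add: ennreal_leI)
  qed
qed

text \<open>The affine map is a scaling about the mode followed by a shift by
  \<open>r = s + (c - 1) * m\<close>, the price of recentering. The bound on \<open>c\<close> keeps
  \<open>1 / c\<close> at most 2, whence the constants 2 and 4.\<close>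

lemma unimodal_affine_bound:
  fixes f :: "real \<Rightarrow> real"
  assumes d: "is_density f" and m: "\<And>t. f t \<le> f m"
    and mono: "\<And>x y. x \<le> y \<Longrightarrow> y \<le> m \<Longrightarrow> f x \<le> f y" "\<And>x y. m \<le> x \<Longrightarrow> x \<le> y \<Longrightarrow> f y \<le> f x"
    and c: "\<bar>c - 1\<bar> \<le> 1 / 2"
  shows "(\<integral>\<^sup>+t. ennreal \<bar>f (c * t + s) - f t\<bar> \<partial>lborel)
    \<le> ennreal (2 * \<bar>c - 1\<bar> + 4 * f m * (\<bar>s\<bar> + \<bar>c - 1\<bar> * \<bar>m\<bar>))"
proof -
  have [measurable]: "f \<in> borel_measurable borel" using d by (simp add: is_density_def)
  have nn: "0 \<le> f x" for x using d by (simp add: is_density_def)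
  have c': "1 / 2 \<le> c" using c by (simp add: abs_if split: if_splits)
  define r where "r = s + (c - 1) * m"
  have r: "\<bar>r\<bar> \<le> \<bar>s\<bar> + \<bar>c - 1\<bar> * \<bar>m\<bar>"
    unfolding r_def by (metis abs_mult abs_triangle_ineq)
  have eq: "c * t + s = m + c * (t - m) + r" for t by (simp add: r_def algebra_simps)
  have "(\<integral>\<^sup>+t. ennreal \<bar>f (c * t + s) - f t\<bar> \<partial>lborel)
    \<le> (\<integral>\<^sup>+t. ennreal \<bar>f (m + c * (t - m) + r) - f (m + c * (t - m))\<bar> + ennreal \<bar>f (m + c * (t - m)) - f t\<bar> \<partial>lborel)"
    unfolding eq by (intro nn_integral_mono) (auto simp: ennreal_plus[symmetric] simp del: ennreal_plus intro!: ennreal_leI)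
  also have "\<dots> = (\<integral>\<^sup>+t. ennreal \<bar>f (m + c * (t - m) + r) - f (m + c * (t - m))\<bar> \<partial>lborel)
      + (\<integral>\<^sup>+t. ennreal \<bar>f (m + c * (t - m)) - f t\<bar> \<partial>lborel)"
    by (simp add: nn_integral_add)
  also have "\<dots> \<le> ennreal (4 * f m * \<bar>r\<bar>) + ennreal (2 * \<bar>c - 1\<bar>)"
  proof (rule add_mono)
    let ?I = "\<integral>\<^sup>+t. ennreal \<bar>f (m + c * (t - m) + r) - f (m + c * (t - m))\<bar> \<partial>lborel"
    have "ennreal c * ?I = (\<integral>\<^sup>+t. ennreal \<bar>f (t + r) - f t\<bar> \<partial>lborel)"
      using nn_integral_real_affine[of "\<lambda>t. ennreal \<bar>f (t + r) - f t\<bar>" c "m - c * m"] c' by (simp add: algebra_simps)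
    also have "\<dots> \<le> ennreal (2 * f m * \<bar>r\<bar>)" by (rule unimodal_shift_bound[OF d m mono])
    finally have "ennreal c * ?I \<le> ennreal (2 * f m * \<bar>r\<bar>)" .
    moreover have "ennreal (1 / 2) * ?I \<le> ennreal c * ?I" using c' by (intro mult_right_mono ennreal_leI) auto
    ultimately have "ennreal 2 * (ennreal (1 / 2) * ?I) \<le> ennreal 2 * ennreal (2 * f m * \<bar>r\<bar>)"
      by (intro mult_left_mono) auto
    moreover have "ennreal 2 * ennreal (1 / 2) = ennreal (2 * (1 / 2))" by (rule ennreal_mult[symmetric]) auto
    moreover have "ennreal 2 * ennreal (2 * f m * \<bar>r\<bar>) = ennreal (2 * (2 * f m * \<bar>r\<bar>))"
      using nn by (intro ennreal_mult[symmetric]) auto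
    ultimately show "?I \<le> ennreal (4 * f m * \<bar>r\<bar>)" by (simp add: mult.assoc[symmetric])
    have "\<bar>1 / c - 1\<bar> = \<bar>c - 1\<bar> / c" using c' by (simp add: field_simps abs_if)
    also have "\<dots> \<le> \<bar>c - 1\<bar> / (1 / 2)" using c' by (intro divide_left_mono) auto
    finally have "\<bar>1 / c - 1\<bar> \<le> 2 * \<bar>c - 1\<bar>" by simp
    moreover have "0 < c" using c' by simp
    ultimately show "(\<integral>\<^sup>+t. ennreal \<bar>f (m + c * (t - m)) - f t\<bar> \<partial>lborel) \<le> ennreal (2 * \<bar>c - 1\<bar>)"
      by (intro order_trans[OF unimodal_scale_bound[OF d mono]] ennreal_leI)
  qed
  also have "\<dots> = ennreal (2 * \<bar>c - 1\<bar> + 4 * f m * \<bar>r\<bar>)"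
    using nn by (subst ennreal_plus[symmetric]) (auto simp: add.commute)
  also have "\<dots> \<le> ennreal (2 * \<bar>c - 1\<bar> + 4 * f m * (\<bar>s\<bar> + \<bar>c - 1\<bar> * \<bar>m\<bar>))"
    using r nn by (intro ennreal_leI add_left_mono mult_left_mono) auto
  finally show ?thesis .
qed

text \<open>The mean is 0, so \<open>|m|\<close> is at most the mean distance to the mode, hence at
  most the root mean square distance \<open>28 / f m\<close>. The second moment about 0 follows from
  \<open>t^2 \<le> 2 * (t - m)^2 + 2 * m^2\<close>, with
  \<open>3136 = 4 * 784 = 56^2\<close>.\<close>

lemma log_concave_usc_centered:
  fixes f :: "real \<Rightarrow> real"
  assumes f: "log_concave_usc f" and d: "is_density f" and mean: "(LINT t|lborel. t * f t) = 0"
  obtains m where "0 < f m" "\<And>t. f t \<le> f m" "f m * \<bar>m\<bar> \<le> 28"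
    "(\<integral>\<^sup>+t. ennreal (t\<^sup>2 * f t) \<partial>lborel) \<le> ennreal (3136 / (f m)\<^sup>2)"
proof -
  have [measurable]: "f \<in> borel_measurable borel" using d by (simp add: is_density_def)
  have nn: "0 \<le> f x" for x using d by (simp add: is_density_def)
  have i1: "(\<integral>\<^sup>+t. ennreal (f t) \<partial>lborel) = 1" using d by (simp add: is_density_def)
  have if1: "integrable lborel f" using nn i1 by (intro integrableI_nonneg) auto
  obtain m where m: "0 < f m" "\<And>t. f t \<le> f m" using log_concave_usc_mode[OF f d] by blast
  define b where "b = f m"
  have b: "0 < b" using m by (simp add: b_def)
  have mom: "(\<integral>\<^sup>+t. ennreal ((t - m)\<^sup>2 * f t) \<partial>lborel) \<le> ennreal (784 / b\<^sup>2)"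
    unfolding b_def by (rule log_concave_usc_mode_moment[OF f d m(2,1)])
  have i2: "integrable lborel (\<lambda>t. (t - m)\<^sup>2 * f t)"
    using nn mom by (intro integrableI_nonneg) (auto intro: le_less_trans)
  have l1: "(LINT t|lborel. f t) = 1" using nn i1 by (simp add: integral_eq_nn_integral)
  have l2: "(LINT t|lborel. (t - m)\<^sup>2 * f t) \<le> 784 / b\<^sup>2"
    using nn mom b by (simp add: integral_eq_nn_integral enn2real_leI)
  \<comment> \<open>Arithmetic-geometric mean inequality, balanced so that it integrates to
    \<open>784 / 56 + 14 = 28\<close>.\<close>
  have le: "b * \<bar>t - m\<bar> \<le> b\<^sup>2 * (t - m)\<^sup>2 / 56 + 14" for t
  proof -
    have "0 \<le> (b * \<bar>t - m\<bar> - 28)\<^sup>2" by simp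
    then show ?thesis by (simp add: power2_diff power_mult_distrib)
  qed
  have i3: "integrable lborel (\<lambda>t. (t - m) * f t)"
  proof (rule Bochner_Integration.integrable_bound)
    show "integrable lborel (\<lambda>t. (b / 56) * ((t - m)\<^sup>2 * f t) + (14 / b) * f t)"
      using i2 if1 by auto
    show "AE t in lborel. norm ((t - m) * f t) \<le> norm ((b / 56) * ((t - m)\<^sup>2 * f t) + (14 / b) * f t)"
    proof (rule AE_I2)
      fix t
      have "\<bar>t - m\<bar> \<le> (b / 56) * (t - m)\<^sup>2 + 14 / b" using le[of t] b by (simp add: field_simps power2_eq_square)
      then have "\<bar>t - m\<bar> * f t \<le> ((b / 56) * (t - m)\<^sup>2 + 14 / b) * f t" using nn by (rule mult_right_mono)
      also have "\<dots> = (b / 56) * ((t - m)\<^sup>2 * f t) + (14 / b) * f t" by (simp add: algebra_simps)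
      finally show "norm ((t - m) * f t) \<le> norm ((b / 56) * ((t - m)\<^sup>2 * f t) + (14 / b) * f t)"
        using nn[of t] by (simp add: abs_mult)
    qed
  qed measurable
  \<comment> \<open>The Bochner integral of a non-integrable function is 0 by default;
    integrability, obtained from the second moment, is what makes \<open>mean\<close>
    informative.\<close>
  have i4: "integrable lborel (\<lambda>t. t * f t)"
  proof -
    have "integrable lborel (\<lambda>t. (t - m) * f t + m * f t)" using i3 if1 by auto
    then show ?thesis by (simp add: algebra_simps)
  qed
  have "(LINT t|lborel. (t - m) * f t) = (LINT t|lborel. t * f t - m * f t)" by (simp add: algebra_simps)
  also have "\<dots> = - m" using i4 if1 by (simp add: mean l1)
  finally have lm: "(LINT t|lborel. (t - m) * f t) = - m" .
  have "b * \<bar>m\<bar> = b * \<bar>LINT t|lborel. (t - m) * f t\<bar>" by (simp add: lm)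
  also have "\<dots> \<le> b * (LINT t|lborel. \<bar>(t - m) * f t\<bar>)"
    using b by (intro mult_left_mono integral_abs_bound) auto
  also have "\<dots> = (LINT t|lborel. b * \<bar>t - m\<bar> * f t)"
    using nn by (simp add: abs_mult mult.assoc)
  also have "\<dots> \<le> (LINT t|lborel. (b\<^sup>2 / 56) * ((t - m)\<^sup>2 * f t) + 14 * f t)"
  proof (rule integral_mono)
    show "integrable lborel (\<lambda>t. b * \<bar>t - m\<bar> * f t)"
    proof -
      have "integrable lborel (\<lambda>t. b * \<bar>(t - m) * f t\<bar>)" using i3 by auto
      then show ?thesis using nn by (simp add: abs_mult mult.assoc)
    qed
    fix t
    show "b * \<bar>t - m\<bar> * f t \<le> (b\<^sup>2 / 56) * ((t - m)\<^sup>2 * f t) + 14 * f t"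
      using mult_right_mono[OF le[of t] nn[of t]] by (simp add: algebra_simps)
  qed (use i2 if1 in auto)
  also have "\<dots> = (b\<^sup>2 / 56) * (LINT t|lborel. (t - m)\<^sup>2 * f t) + 14"
    using i2 if1 by (simp add: l1)
  also have "\<dots> \<le> (b\<^sup>2 / 56) * (784 / b\<^sup>2) + 14" using l2 by (intro add_right_mono mult_left_mono) auto
  also have "\<dots> = 28" using b by simp
  finally have bm: "b * \<bar>m\<bar> \<le> 28" .
  have "(\<integral>\<^sup>+t. ennreal (t\<^sup>2 * f t) \<partial>lborel) \<le> (\<integral>\<^sup>+t. ennreal 2 * ennreal ((t - m)\<^sup>2 * f t) + ennreal (2 * m\<^sup>2) * ennreal (f t) \<partial>lborel)"
  proof (rule nn_integral_mono)
    fix t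
    have "0 \<le> (t - 2 * m)\<^sup>2" by simp
    then have "t\<^sup>2 \<le> 2 * (t - m)\<^sup>2 + 2 * m\<^sup>2" by (simp add: power2_eq_square algebra_simps)
    from mult_right_mono[OF this nn[of t]]
    show "ennreal (t\<^sup>2 * f t) \<le> ennreal 2 * ennreal ((t - m)\<^sup>2 * f t) + ennreal (2 * m\<^sup>2) * ennreal (f t)"
      using nn[of t] by (simp add: ennreal_mult[symmetric] ennreal_plus[symmetric] algebra_simps
          del: ennreal_plus ennreal_numeral)
  qed
  also have "\<dots> = ennreal 2 * (\<integral>\<^sup>+t. ennreal ((t - m)\<^sup>2 * f t) \<partial>lborel) + ennreal (2 * m\<^sup>2)"
    by (subst nn_integral_add) (auto simp: nn_integral_cmult i1 simp del: ennreal_numeral)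
  also have "\<dots> \<le> ennreal 2 * ennreal (784 / b\<^sup>2) + ennreal (2 * (784 / b\<^sup>2))"
  proof (intro add_mono mult_left_mono[OF mom] ennreal_leI)
    have "\<bar>m\<bar> \<le> 28 / b" using bm b by (simp add: field_simps)
    then have "m\<^sup>2 \<le> (28 / b)\<^sup>2" by (metis abs_ge_zero power2_abs power_mono)
    then show "2 * m\<^sup>2 \<le> 2 * (784 / b\<^sup>2)" by (simp add: power_divide)
  qed auto
  also have "\<dots> = ennreal (3136 / b\<^sup>2)"
    by (subst ennreal_mult[symmetric], simp, simp, subst ennreal_plus[symmetric]) auto
  finally show ?thesis using that[of m] m bm by (simp add: b_def)
qed

text \<open>Pointwise \<open>|t| \<le> t^2 / (2 * a) + a / 2\<close> with \<open>a = sqrt v\<close>,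
  the choice for which both terms integrate to \<open>a / 2\<close>.\<close>

lemma density_abs_moment_le:
  fixes f :: "real \<Rightarrow> real"
  assumes d: "is_density f" and v: "(\<integral>\<^sup>+t. ennreal (t\<^sup>2 * f t) \<partial>lborel) = ennreal v" "0 < v"
  shows "(\<integral>\<^sup>+t. ennreal (\<bar>t\<bar> * f t) \<partial>lborel) \<le> ennreal (sqrt v)"
proof -
  have [measurable]: "f \<in> borel_measurable borel" using d by (simp add: is_density_def)
  have nn: "0 \<le> f x" for x using d by (simp add: is_density_def)
  have i1: "(\<integral>\<^sup>+t. ennreal (f t) \<partial>lborel) = 1" using d by (simp add: is_density_def)
  define a where "a = sqrt v"
  have a: "0 < a" "v = a\<^sup>2" using v by (auto simp: a_def)
  have "(\<integral>\<^sup>+t. ennreal (\<bar>t\<bar> * f t) \<partial>lborel)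
    \<le> (\<integral>\<^sup>+t. ennreal (1 / (2 * a)) * ennreal (t\<^sup>2 * f t) + ennreal (a / 2) * ennreal (f t) \<partial>lborel)"
  proof (rule nn_integral_mono)
    fix t
    have "0 \<le> (\<bar>t\<bar> - a)\<^sup>2" by simp
    then have "2 * a * \<bar>t\<bar> \<le> t\<^sup>2 + a\<^sup>2" by (simp add: power2_diff algebra_simps)
    then have "\<bar>t\<bar> \<le> 1 / (2 * a) * t\<^sup>2 + a / 2" using a by (simp add: field_simps power2_eq_square)
    from mult_right_mono[OF this nn[of t]]
    have "\<bar>t\<bar> * f t \<le> 1 / (2 * a) * (t\<^sup>2 * f t) + a / 2 * f t" by (simp add: algebra_simps)
    then show "ennreal (\<bar>t\<bar> * f t) \<le> ennreal (1 / (2 * a)) * ennreal (t\<^sup>2 * f t) + ennreal (a / 2) * ennreal (f t)"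
      using nn[of t] a by (subst ennreal_mult[symmetric], simp, simp, subst ennreal_mult[symmetric], simp, simp,
          subst ennreal_plus[symmetric]) (auto intro!: ennreal_leI simp del: ennreal_plus)
  qed
  also have "\<dots> = ennreal (1 / (2 * a)) * ennreal v + ennreal (a / 2)"
    by (subst nn_integral_add) (auto simp: nn_integral_cmult i1 v)
  also have "\<dots> = ennreal a"
    using a by (subst ennreal_mult[symmetric], simp, simp, subst ennreal_plus[symmetric]) (auto simp: power2_eq_square field_simps)
  finally show ?thesis by (simp add: a_def)
qed

section \<open>Linear perturbations of product densities\<close>

lemma nn_integral_lborel_vec_prod:
  fixes f :: "'d::finite \<Rightarrow> real \<Rightarrow> ennreal"
  assumes [measurable]: "\<And>i. f i \<in> borel_measurable borel"
  shows "(\<integral>\<^sup>+x. (\<Prod>i\<in>UNIV. f i (x $ i)) \<partial>(lborel :: (real ^ 'd) measure)) = (\<Prod>i\<in>UNIV. \<integral>\<^sup>+t. f i t \<partial>lborel)"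
proof -
  let ?e = "\<lambda>i::'d. axis i (1::real)"
  have inj: "inj ?e" by (auto simp: inj_def axis_eq_axis)
  have basis: "(Basis :: (real ^ 'd) set) = range ?e" by (auto simp: Basis_vec_def)
  define g where "g b = f (inv ?e b)" for b
  have g: "g (?e i) = f i" for i by (simp add: g_def inv_f_f[OF inj])
  have [measurable]: "g b \<in> borel_measurable borel" for b by (simp add: g_def)
  have "(\<integral>\<^sup>+x. (\<Prod>b\<in>Basis. g b (x \<bullet> b)) \<partial>(lborel :: (real ^ 'd) measure)) = (\<Prod>b\<in>Basis. \<integral>\<^sup>+t. g b t \<partial>lborel)"
    by (rule nn_integral_lborel_prod) auto
  then show ?thesis unfolding basis by (simp add: prod.reindex[OF inj] g inner_axis o_def)
qed

text \<open>The displaced point is \<open>x\<close> with its k-th coordinate set to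
  \<open>t\<close>, in the form that \<open>nn_integral_lborel_resample\<close> produces along
  \<open>axis k 1\<close>.\<close>

lemma prod_update_coordinate:
  fixes f :: "'d::finite \<Rightarrow> real \<Rightarrow> 'b::comm_monoid_mult" and x :: "real ^ 'd"
  shows "(\<Prod>i\<in>UNIV. f i ((x + (t - axis k 1 \<bullet> x) *\<^sub>R axis k 1) $ i)) = f k t * (\<Prod>i\<in>UNIV - {k}. f i (x $ i))"
proof -
  have "(\<Prod>i\<in>UNIV. f i ((x + (t - axis k 1 \<bullet> x) *\<^sub>R axis k 1) $ i))
    = f k ((x + (t - axis k 1 \<bullet> x) *\<^sub>R axis k 1) $ k) * (\<Prod>i\<in>UNIV - {k}. f i ((x + (t - axis k 1 \<bullet> x) *\<^sub>R axis k 1) $ i))"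
    by (rule prod.remove) auto
  also have "(\<Prod>i\<in>UNIV - {k}. f i ((x + (t - axis k 1 \<bullet> x) *\<^sub>R axis k 1) $ i)) = (\<Prod>i\<in>UNIV - {k}. f i (x $ i))"
    by (intro prod.cong) (auto simp: axis_def)
  also have "(x + (t - axis k 1 \<bullet> x) *\<^sub>R axis k 1) $ k = t"
    unfolding inner_axis' by (simp add: axis_def)
  finally show ?thesis .
qed

lemma product_density_coordinate_nn_integral:
  fixes f :: "'d::finite \<Rightarrow> real \<Rightarrow> real" and h :: "real \<Rightarrow> ennreal"
  assumes d: "\<And>i. is_density (f i)" and [measurable]: "h \<in> borel_measurable borel"
  shows "(\<integral>\<^sup>+x. h (x $ j) * ennreal (\<Prod>i\<in>UNIV. f i (x $ i)) \<partial>(lborel :: (real ^ 'd) measure))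
    = (\<integral>\<^sup>+t. h t * ennreal (f j t) \<partial>lborel)"
proof -
  have [measurable]: "f i \<in> borel_measurable borel" for i using d by (simp add: is_density_def)
  have nn: "0 \<le> f i x" for i x using d by (simp add: is_density_def)
  have i1: "(\<integral>\<^sup>+t. ennreal (f i t) \<partial>lborel) = 1" for i using d by (simp add: is_density_def)
  have "(\<integral>\<^sup>+x. h (x $ j) * ennreal (\<Prod>i\<in>UNIV. f i (x $ i)) \<partial>(lborel :: (real ^ 'd) measure))
    = (\<integral>\<^sup>+x. (\<Prod>i\<in>UNIV. (\<lambda>t. (if i = j then h t else 1) * ennreal (f i t)) (x $ i)) \<partial>(lborel :: (real ^ 'd) measure))"
    using nn by (intro nn_integral_cong) (simp add: prod.distrib prod.delta prod_ennreal[symmetric])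
  also have "\<dots> = (\<Prod>i\<in>UNIV. \<integral>\<^sup>+t. (if i = j then h t else 1) * ennreal (f i t) \<partial>lborel)"
    by (rule nn_integral_lborel_vec_prod) auto
  also have "\<dots> = (\<Prod>i\<in>UNIV. if i = j then (\<integral>\<^sup>+t. h t * ennreal (f j t) \<partial>lborel) else 1)"
    by (intro prod.cong) (auto simp: i1)
  also have "\<dots> = (\<integral>\<^sup>+t. h t * ennreal (f j t) \<partial>lborel)" by (simp add: prod.delta)
  finally show ?thesis .
qed

lemma is_density_product:
  fixes f :: "'d::finite \<Rightarrow> real \<Rightarrow> real"
  assumes d: "\<And>i. is_density (f i)"
  shows "is_density (\<lambda>x::real ^ 'd. \<Prod>i\<in>UNIV. f i (x $ i))"
proof -
  have [measurable]: "f i \<in> borel_measurable borel" for i using d by (simp add: is_density_def)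
  have "(\<integral>\<^sup>+x. ennreal (\<Prod>i\<in>UNIV. f i (x $ i)) \<partial>(lborel :: (real ^ 'd) measure)) = 1"
    using product_density_coordinate_nn_integral[of f "\<lambda>_. 1" undefined] d
    by (simp add: is_density_def)
  then show ?thesis using d by (auto simp: is_density_def prod_nonneg)
qed

text \<open>The perturbation replaces the k-th coordinate by a linear functional close to it. With
  the other coordinates frozen it is the univariate map \<open>t \<mapsto> c k * t + s x\<close>,
  whose shift is at most \<open>\<theta>\<close> times the sum of the \<open>|x $ j|\<close>.
  Averaging over \<open>F\<close> turns these into standard deviations \<open>sqrt (v j)\<close>,
  which are at most \<open>56 * sqrt \<kappa> / f k m\<close>.\<close>

lemma product_density_row_perturbation:
  fixes f :: "'d::finite \<Rightarrow> real \<Rightarrow> real"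
  defines "F \<equiv> \<lambda>x::real ^ 'd. \<Prod>i\<in>UNIV. f i (x $ i)"
  assumes d: "\<And>i. is_density (f i)" and lc: "\<And>i. log_concave_usc (f i)"
    and mean: "\<And>i. (LINT t|lborel. t * f i t) = 0"
    and v: "\<And>i. (\<integral>\<^sup>+t. ennreal (t\<^sup>2 * f i t) \<partial>lborel) = ennreal (v i)" "\<And>i. 0 < v i"
    and \<kappa>: "\<And>i j. v j \<le> \<kappa> * v i"
    and c: "\<And>j. \<bar>c j - (if j = k then 1 else 0)\<bar> \<le> \<theta>" and \<theta>: "\<theta> \<le> 1 / 2"
  shows "(\<integral>\<^sup>+x. ennreal \<bar>F (x + ((\<Sum>j\<in>UNIV. c j * x $ j) - axis k 1 \<bullet> x) *\<^sub>R axis k 1) - F x\<bar> \<partial>lborel)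
    \<le> ennreal (338 * real CARD('d) * sqrt \<kappa> * \<theta>)"
proof -
  have [measurable]: "f i \<in> borel_measurable borel" for i using d by (simp add: is_density_def)
  have nn: "0 \<le> f i x" for i x using d by (simp add: is_density_def)
  have dF: "is_density F" unfolding F_def by (rule is_density_product[OF d])
  then have [measurable]: "F \<in> borel_measurable borel" by (simp add: is_density_def)
  have Fn: "0 \<le> F x" for x using dF by (simp add: is_density_def)
  have F1: "(\<integral>\<^sup>+x. ennreal (F x) \<partial>lborel) = 1" using dF by (simp add: is_density_def)
  have \<theta>0: "0 \<le> \<theta>" using c[of k] by (meson abs_ge_zero order_trans)
  have \<kappa>1: "1 \<le> \<kappa>" using \<kappa>[of k k] v(2)[of k] by simp
  obtain m where m: "0 < f k m" "\<And>t. f k t \<le> f k m" "f k m * \<bar>m\<bar> \<le> 28"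
      "(\<integral>\<^sup>+t. ennreal (t\<^sup>2 * f k t) \<partial>lborel) \<le> ennreal (3136 / (f k m)\<^sup>2)"
    using log_concave_usc_centered[OF lc d mean] by blast
  define b where "b = f k m"
  have b: "0 < b" using m by (simp add: b_def)
  \<comment> \<open>The moment bound for component \<open>k\<close> reads
    \<open>b * sqrt (v k) \<le> 56\<close>; passing from \<open>v k\<close> to \<open>v j\<close>
    costs \<open>sqrt \<kappa>\<close>.\<close>
  have bv: "b * sqrt (v j) \<le> 56 * sqrt \<kappa>" for j
  proof -
    have "v k \<le> 3136 / b\<^sup>2" using m(4) v[of k] b by (simp add: b_def)
    then have "b\<^sup>2 * v k \<le> 3136" using b by (simp add: field_simps)
    moreover have "b\<^sup>2 * v j \<le> b\<^sup>2 * (\<kappa> * v k)" using \<kappa> by (intro mult_left_mono) auto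
    moreover have "\<kappa> * (b\<^sup>2 * v k) \<le> \<kappa> * 3136" using calculation(1) \<kappa>1 by (intro mult_left_mono) auto
    ultimately have "b\<^sup>2 * v j \<le> \<kappa> * 3136" by (simp add: mult_ac)
    then have "sqrt (b\<^sup>2 * v j) \<le> sqrt (\<kappa> * 3136)" by simp
    also have "sqrt (\<kappa> * 3136) = sqrt \<kappa> * sqrt (56\<^sup>2)" by (simp add: real_sqrt_mult)
    finally show ?thesis using b by (simp add: real_sqrt_mult)
  qed
  define P where "P x = (\<Prod>i\<in>UNIV - {k}. f i (x $ i))" for x :: "real ^ 'd"
  define s where "s x = (\<Sum>j\<in>UNIV - {k}. c j * x $ j)" for x :: "real ^ 'd"
  have [measurable]: "P \<in> borel_measurable borel" "s \<in> borel_measurable borel" unfolding P_def s_def by measurable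
  have Pn: "0 \<le> P x" for x unfolding P_def by (intro prod_nonneg) (auto simp: nn)
  have FP: "F (x + (t - axis k 1 \<bullet> x) *\<^sub>R axis k 1) = f k t * P x" for x t
    unfolding F_def P_def by (rule prod_update_coordinate)
  have FP': "F x = f k (x $ k) * P x" for x
    unfolding F_def P_def by (rule prod.remove) auto
  have sl: "(\<Sum>j\<in>UNIV. c j * (x + (t - axis k 1 \<bullet> x) *\<^sub>R axis k 1) $ j) = c k * t + s x" for x t
  proof -
    have "(\<Sum>j\<in>UNIV. c j * (x + (t - axis k 1 \<bullet> x) *\<^sub>R axis k 1) $ j)
      = c k * (x + (t - axis k 1 \<bullet> x) *\<^sub>R axis k 1) $ k + (\<Sum>j\<in>UNIV - {k}. c j * (x + (t - axis k 1 \<bullet> x) *\<^sub>R axis k 1) $ j)"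
      by (rule sum.remove) auto
    also have "(\<Sum>j\<in>UNIV - {k}. c j * (x + (t - axis k 1 \<bullet> x) *\<^sub>R axis k 1) $ j) = s x"
      unfolding s_def by (intro sum.cong) (auto simp: axis_def)
    also have "(x + (t - axis k 1 \<bullet> x) *\<^sub>R axis k 1) $ k = t"
      unfolding inner_axis' by (simp add: axis_def)
    finally show ?thesis .
  qed
  let ?G = "\<lambda>x. ennreal \<bar>F (x + ((\<Sum>j\<in>UNIV. c j * x $ j) - axis k 1 \<bullet> x) *\<^sub>R axis k 1) - F x\<bar>"
  have G: "?G (x + (t - axis k 1 \<bullet> x) *\<^sub>R axis k 1) = ennreal (P x) * ennreal \<bar>f k (c k * t + s x) - f k t\<bar>" for x t
  proof -
    define y where "y = x + (t - axis k 1 \<bullet> x) *\<^sub>R axis k 1"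
    have yk: "axis k 1 \<bullet> y = t" unfolding y_def inner_axis' by (simp add: axis_def)
    have "y + ((c k * t + s x) - axis k 1 \<bullet> y) *\<^sub>R axis k 1 = x + ((c k * t + s x) - axis k 1 \<bullet> x) *\<^sub>R axis k 1"
      unfolding yk by (simp add: y_def algebra_simps)
    moreover have "(\<Sum>j\<in>UNIV. c j * y $ j) = c k * t + s x" unfolding y_def by (rule sl)
    ultimately have "F (y + ((\<Sum>j\<in>UNIV. c j * y $ j) - axis k 1 \<bullet> y) *\<^sub>R axis k 1) - F y
        = (f k (c k * t + s x) - f k t) * P x"
      using FP[of x "c k * t + s x"] FP[of x t, folded y_def] by (simp only: left_diff_distrib)
    then show ?thesis using Pn[of x]
      by (simp add: y_def[symmetric] abs_mult ennreal_mult[symmetric] mult.commute)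
  qed
  \<comment> \<open>Resampling with \<open>f k\<close> itself as the auxiliary density restores the
    missing factor: \<open>f k\<close> at the old coordinate times \<open>P x\<close> is
    \<open>F x\<close>, so the outer integral becomes an expectation under \<open>F\<close>.\<close>
  have "(\<integral>\<^sup>+x. ?G x \<partial>lborel) = (\<integral>\<^sup>+x. ennreal (f k (axis k 1 \<bullet> x)) * (\<integral>\<^sup>+t. ?G (x + (t - axis k 1 \<bullet> x) *\<^sub>R axis k 1) \<partial>lborel) \<partial>lborel)"
    using d[of k] by (intro nn_integral_lborel_resample) (auto simp: is_density_def norm_axis_1)
  also have "\<dots> = (\<integral>\<^sup>+x. ennreal (F x) * (\<integral>\<^sup>+t. ennreal \<bar>f k (c k * t + s x) - f k t\<bar> \<partial>lborel) \<partial>lborel)"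
    unfolding G by (intro nn_integral_cong)
      (simp add: nn_integral_cmult FP' inner_axis' ennreal_mult nn Pn mult.assoc)
  \<comment> \<open>\<open>114 = 2 + 4 * 28\<close>, where 28 bounds \<open>b * |m|\<close>.\<close>
  also have "\<dots> \<le> (\<integral>\<^sup>+x. ennreal (F x) * (ennreal (114 * \<theta>) + ennreal (4 * b * \<theta>) * (\<Sum>j\<in>UNIV. ennreal \<bar>x $ j\<bar>)) \<partial>lborel)"
  proof (intro nn_integral_mono mult_left_mono)
    fix x
    have ck: "\<bar>c k - 1\<bar> \<le> \<theta>" using c[of k] by simp
    have "\<bar>s x\<bar> \<le> (\<Sum>j\<in>UNIV - {k}. \<theta> * \<bar>x $ j\<bar>)"
      unfolding s_def
    proof (rule sum_abs[THEN order_trans], intro sum_mono)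
      fix j assume "j \<in> UNIV - {k}"
      then have "\<bar>c j\<bar> \<le> \<theta>" using c[of j] by simp
      then show "\<bar>c j * x $ j\<bar> \<le> \<theta> * \<bar>x $ j\<bar>" unfolding abs_mult by (rule mult_right_mono) auto
    qed
    also have "\<dots> \<le> (\<Sum>j\<in>UNIV. \<theta> * \<bar>x $ j\<bar>)" using \<theta>0 by (intro sum_mono2) auto
    finally have sx: "\<bar>s x\<bar> \<le> \<theta> * (\<Sum>j\<in>UNIV. \<bar>x $ j\<bar>)" by (simp add: sum_distrib_left)
    have "(\<integral>\<^sup>+t. ennreal \<bar>f k (c k * t + s x) - f k t\<bar> \<partial>lborel)
      \<le> ennreal (2 * \<bar>c k - 1\<bar> + 4 * f k m * (\<bar>s x\<bar> + \<bar>c k - 1\<bar> * \<bar>m\<bar>))"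
      using ck \<theta> m(2) log_concave_usc_unimodal[OF lc m(2)] by (intro unimodal_affine_bound[OF d]) auto
    also have "\<dots> \<le> ennreal (114 * \<theta> + 4 * b * \<theta> * (\<Sum>j\<in>UNIV. \<bar>x $ j\<bar>))"
    proof (rule ennreal_leI)
      have "\<bar>c k - 1\<bar> * (b * \<bar>m\<bar>) \<le> \<theta> * 28" using ck m(3) b unfolding b_def by (intro mult_mono) auto
      moreover have "b * \<bar>s x\<bar> \<le> b * (\<theta> * (\<Sum>j\<in>UNIV. \<bar>x $ j\<bar>))" using sx b by (intro mult_left_mono) auto
      ultimately show "2 * \<bar>c k - 1\<bar> + 4 * f k m * (\<bar>s x\<bar> + \<bar>c k - 1\<bar> * \<bar>m\<bar>) \<le> 114 * \<theta> + 4 * b * \<theta> * (\<Sum>j\<in>UNIV. \<bar>x $ j\<bar>)"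
        using ck unfolding b_def by (simp add: algebra_simps)
    qed
    also have "\<dots> = ennreal (114 * \<theta>) + ennreal (4 * b * \<theta>) * (\<Sum>j\<in>UNIV. ennreal \<bar>x $ j\<bar>)"
      using \<theta>0 b by (simp add: ennreal_mult[symmetric] sum_nonneg ennreal_plus)
    finally show "(\<integral>\<^sup>+t. ennreal \<bar>f k (c k * t + s x) - f k t\<bar> \<partial>lborel)
      \<le> ennreal (114 * \<theta>) + ennreal (4 * b * \<theta>) * (\<Sum>j\<in>UNIV. ennreal \<bar>x $ j\<bar>)" .
  qed auto
  also have "\<dots> = (\<integral>\<^sup>+x. ennreal (114 * \<theta>) * ennreal (F x) + (\<Sum>j\<in>UNIV. ennreal (4 * b * \<theta>) * (ennreal \<bar>x $ j\<bar> * ennreal (F x))) \<partial>lborel)"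
    by (intro nn_integral_cong) (simp add: distrib_left sum_distrib_left sum_distrib_right mult_ac del: sum_ennreal)
  also have "\<dots> = ennreal (114 * \<theta>) + (\<Sum>j\<in>UNIV. ennreal (4 * b * \<theta>) * (\<integral>\<^sup>+x. ennreal \<bar>x $ j\<bar> * ennreal (F x) \<partial>lborel))"
    by (subst nn_integral_add) (auto simp: nn_integral_cmult F1 nn_integral_sum)
  also have "\<dots> \<le> ennreal (114 * \<theta>) + (\<Sum>j\<in>(UNIV::'d set). ennreal (4 * b * \<theta>) * ennreal (sqrt (v j)))"
  proof (intro add_left_mono sum_mono mult_left_mono)
    fix j
    have "(\<integral>\<^sup>+x. ennreal \<bar>x $ j\<bar> * ennreal (F x) \<partial>lborel) = (\<integral>\<^sup>+t. ennreal \<bar>t\<bar> * ennreal (f j t) \<partial>lborel)"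
      unfolding F_def by (rule product_density_coordinate_nn_integral[OF d]) auto
    also have "\<dots> \<le> ennreal (sqrt (v j))"
      using density_abs_moment_le[OF d v] nn by (simp add: ennreal_mult)
    finally show "(\<integral>\<^sup>+x. ennreal \<bar>x $ j\<bar> * ennreal (F x) \<partial>lborel) \<le> ennreal (sqrt (v j))" .
  qed auto
  also have "\<dots> = ennreal (114 * \<theta> + (\<Sum>j\<in>(UNIV::'d set). 4 * b * \<theta> * sqrt (v j)))"
  proof -
    have "ennreal (4 * b * \<theta>) * ennreal (sqrt (v j)) = ennreal (4 * b * \<theta> * sqrt (v j))" for j
      using \<theta>0 b v(2)[of j] by (intro ennreal_mult[symmetric]) auto
    moreover have "0 \<le> 4 * b * \<theta> * sqrt (v j)" for j using \<theta>0 b v(2)[of j] by simp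
    ultimately show ?thesis using \<theta>0 by (simp add: ennreal_plus sum_nonneg)
  qed
  \<comment> \<open>\<open>338 = 114 + 4 * 56\<close>; the first term is absorbed because
    \<open>1 \<le> real CARD('d) * sqrt \<kappa>\<close>.\<close>
  also have "\<dots> \<le> ennreal (338 * real CARD('d) * sqrt \<kappa> * \<theta>)"
  proof (rule ennreal_leI)
    have "(\<Sum>j\<in>(UNIV::'d set). 4 * b * \<theta> * sqrt (v j)) \<le> (\<Sum>j\<in>(UNIV::'d set). 4 * \<theta> * (56 * sqrt \<kappa>))"
    proof (rule sum_mono)
      fix j show "4 * b * \<theta> * sqrt (v j) \<le> 4 * \<theta> * (56 * sqrt \<kappa>)"
        using mult_left_mono[OF bv[of j], of "4 * \<theta>"] \<theta>0 by (simp add: mult_ac)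
    qed
    then have 1: "(\<Sum>j\<in>(UNIV::'d set). 4 * b * \<theta> * sqrt (v j)) \<le> 224 * (real CARD('d) * sqrt \<kappa>) * \<theta>" by (simp add: mult_ac)
    have "1 * 1 \<le> real CARD('d) * sqrt \<kappa>"
      using \<kappa>1 by (intro mult_mono) (auto simp: Suc_le_eq)
    then have "114 * \<theta> * 1 \<le> 114 * \<theta> * (real CARD('d) * sqrt \<kappa>)" using \<theta>0 by (intro mult_left_mono) auto
    with 1 show "114 * \<theta> + (\<Sum>j\<in>(UNIV::'d set). 4 * b * \<theta> * sqrt (v j)) \<le> 338 * real CARD('d) * sqrt \<kappa> * \<theta>"
      by (simp add: algebra_simps)
  qed
  finally show ?thesis .
qed

lemma near_identity_row_bound:
  fixes R :: "real ^ 'd ^ 'd"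
  assumes R: "\<And>i j. \<bar>R $ i $ j - (if i = j then 1 else 0)\<bar> \<le> \<eta>"
  shows "\<bar>(R *v y) $ i - y $ i\<bar> \<le> real CARD('d) * \<eta> * norm y"
proof -
  have "(R *v y) $ i - y $ i = (\<Sum>j\<in>UNIV. R $ i $ j * y $ j) - (\<Sum>j\<in>UNIV. (if i = j then 1 else 0) * y $ j)"
    by (simp add: matrix_vector_mult_def mult_delta_left sum.delta)
  also have "\<dots> = (\<Sum>j\<in>UNIV. (R $ i $ j - (if i = j then 1 else 0)) * y $ j)"
    by (simp add: sum_subtractf left_diff_distrib)
  also have "\<bar>\<dots>\<bar> \<le> (\<Sum>j\<in>(UNIV::'d set). \<eta> * norm y)"
  proof (rule sum_abs[THEN order_trans], rule sum_mono)
    fix j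
    have "0 \<le> \<eta>" using R[of i j] by (meson abs_ge_zero order_trans)
    then show "\<bar>(R $ i $ j - (if i = j then 1 else 0)) * y $ j\<bar> \<le> \<eta> * norm y"
      unfolding abs_mult by (intro mult_mono R component_le_norm_cart) auto
  qed
  finally show ?thesis by simp
qed

text \<open>The rows of the identity are replaced by those of \<^term>\<open>R\<close> one at a time. Passing from the rows
  in \<^term>\<open>A\<close> to those in \<^term>\<open>insert k A\<close> composes with a map that changes the \<^term>\<open>k\<close>-th
  coordinate only, by a linear functional close to that coordinate.\<close>

lemma product_density_linear_perturbation:
  fixes f :: "'d::finite \<Rightarrow> real \<Rightarrow> real" and R :: "real ^ 'd ^ 'd"
  defines "F \<equiv> \<lambda>x::real ^ 'd. \<Prod>i\<in>UNIV. f i (x $ i)"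
  assumes d: "\<And>i. is_density (f i)" and lc: "\<And>i. log_concave_usc (f i)"
    and mean: "\<And>i. (LINT t|lborel. t * f i t) = 0"
    and v: "\<And>i. (\<integral>\<^sup>+t. ennreal (t\<^sup>2 * f i t) \<partial>lborel) = ennreal (v i)" "\<And>i. 0 < v i"
    and \<kappa>: "\<And>i j. v j \<le> \<kappa> * v i"
    and R: "\<And>i j. \<bar>R $ i $ j - (if i = j then 1 else 0)\<bar> \<le> \<eta>"
    and \<eta>: "4 * (real CARD('d))\<^sup>2 * \<eta> \<le> 1"
  shows "(\<integral>\<^sup>+x. ennreal \<bar>F (R *v x) - F x\<bar> \<partial>lborel)
    \<le> ennreal (676 * 2 ^ CARD('d) * real CARD('d) ^ 3 * sqrt \<kappa> * \<eta>)"
proof -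
  let ?d = "real CARD('d)"
  have dF: "is_density F" unfolding F_def by (rule is_density_product[OF d])
  then have [measurable]: "F \<in> borel_measurable borel" by (simp add: is_density_def)
  have \<eta>0: "0 \<le> \<eta>" using R[of undefined undefined] by (meson abs_ge_zero order_trans)
  have \<kappa>1: "1 \<le> \<kappa>" using \<kappa>[of undefined undefined] v(2)[of undefined] by simp
  have d1: "1 \<le> ?d" by (simp add: Suc_le_eq)
  \<comment> \<open>The functionals met below differ from a coordinate by at most
    \<open>?d * \<eta> * norm y\<close>, where \<open>y\<close> is the preimage of a basis vector
    and has norm at most 2.\<close>
  define \<theta> where "\<theta> = 2 * ?d * \<eta>"
  have "?d \<le> ?d\<^sup>2" using d1 by (simp add: power2_eq_square)
  then have "?d * \<eta> \<le> ?d\<^sup>2 * \<eta>" using \<eta>0 by (rule mult_right_mono)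
  then have \<theta>: "\<theta> \<le> 1 / 2" using \<eta> unfolding \<theta>_def by linarith
  define B where "B A y = (\<chi> i. if i \<in> A then (R *v y) $ i else y $ i)" for A and y :: "real ^ 'd"
  have Bi: "B A y $ i = (if i \<in> A then (R *v y) $ i else y $ i)" for A y i by (simp add: B_def)
  have lin: "linear (B A)" for A
    by (rule linearI) (auto simp: vec_eq_iff Bi matrix_vector_right_distrib matrix_vector_mult_scaleR)
  \<comment> \<open>The hypothesis on \<open>\<eta>\<close> keeps every intermediate map within a
    quarter of the identity, so it is invertible with inverse of norm at most 2.\<close>
  have Bn: "norm y \<le> 2 * norm (B A y)" for A y
  proof -
    have "norm (B A y - y) \<le> (\<Sum>i\<in>UNIV. \<bar>(B A y - y) $ i\<bar>)" by (rule norm_le_l1_cart)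
    also have "\<dots> \<le> (\<Sum>i\<in>(UNIV::'d set). ?d * \<eta> * norm y)"
      using near_identity_row_bound[OF R, of y] \<eta>0 by (intro sum_mono) (auto simp: Bi)
    also have "\<dots> = (?d\<^sup>2 * \<eta>) * norm y" by (simp add: power2_eq_square)
    also have "\<dots> \<le> (1 / 4) * norm y" using \<eta> by (intro mult_right_mono) auto
    finally have "norm (B A y - y) \<le> (1 / 4) * norm y" .
    moreover have "norm y \<le> norm (B A y) + norm (B A y - y)"
      by (metis add_diff_cancel_left' diff_add_cancel norm_minus_commute norm_triangle_sub)
    ultimately show ?thesis using norm_ge_zero[of "B A y"] by linarith
  qed
  have bij: "bij (B A)" for A
  proof -
    interpret linear "B A" by (rule lin)
    have "inj (B A)"
    proof (rule injI)
      fix x y assume "B A x = B A y"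
      then show "x = y" using Bn[of "x - y" A] by (simp add: diff)
    qed
    then show ?thesis using lin by (simp add: linear_injective_imp_surjective bij_def)
  qed
  have Bm[measurable]: "B A \<in> borel_measurable borel" for A
    by (intro borel_measurable_continuous_onI linear_continuous_on linear_conv_bounded_linear[THEN iffD1] lin)
  define C where "C = 338 * ?d * sqrt \<kappa> * \<theta>"
  have C0: "0 \<le> C" using \<eta>0 \<kappa>1 by (simp add: C_def \<theta>_def)
  have "(\<integral>\<^sup>+x. ennreal \<bar>F (B A x) - F x\<bar> \<partial>lborel) \<le> ennreal (real (card A) * (2 ^ CARD('d) * C))" for A
  proof (induction A rule: finite_induct[OF finite])
    case 1
    have "B {} x = x" for x by (simp add: B_def)
    then show ?case by simp
  next
    case (2 k A)
    define G where "G = inv (B A)"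
    have GB: "G (B A y) = y" "B A (G y) = y" for y
      using bij[of A] by (auto simp: G_def bij_is_inj bij_is_surj surj_f_inv_f)
    have linG: "linear G"
    proof (rule linearI)
      interpret linear "B A" by (rule lin)
      show "G (x + y) = G x + G y" for x y
        using GB(1)[of "G x + G y"] by (simp add: add GB)
      show "G (r *\<^sub>R x) = r *\<^sub>R G x" for r x
        using GB(1)[of "r *\<^sub>R G x"] by (simp add: scaleR GB)
    qed
    define c where "c j = (R *v G (axis j 1)) $ k" for j
    have Gsum: "G z = (\<Sum>j\<in>UNIV. z $ j *\<^sub>R G (axis j 1))" for z
    proof -
      interpret linear G by (rule linG)
      have "G z = G (\<Sum>j\<in>UNIV. z $ j *\<^sub>R axis j 1)"
        by (metis basis_expansion scalar_mult_eq_scaleR)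
      then show ?thesis by (simp add: sum scaleR)
    qed
    have \<ell>: "(R *v G z) $ k = (\<Sum>j\<in>UNIV. c j * z $ j)" for z
    proof -
      have "R *v G z = (\<Sum>j\<in>UNIV. z $ j *\<^sub>R (R *v G (axis j 1)))"
        using linear_sum[OF matrix_vector_mul_linear[of R], of "\<lambda>j. z $ j *\<^sub>R G (axis j 1)" UNIV] Gsum[of z]
        by (simp add: matrix_vector_mult_scaleR)
      then show ?thesis by (simp add: c_def mult.commute)
    qed
    have c: "\<bar>c j - (if j = k then 1 else 0)\<bar> \<le> \<theta>" for j
    proof -
      define y where "y = G (axis j 1)"
      have By: "B A y = axis j 1" by (simp add: y_def GB)
      \<comment> \<open>\<open>k\<close> is not in \<open>A\<close>, so the k-th row of
        \<open>B A\<close> is still that of the identity.\<close>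
      have "y $ k = B A y $ k" using 2 by (simp add: Bi)
      then have "y $ k = (if j = k then 1 else 0)" by (simp add: By axis_def)
      then have "\<bar>c j - (if j = k then 1 else 0)\<bar> \<le> ?d * \<eta> * norm y"
        using near_identity_row_bound[OF R, of y k] by (simp add: c_def y_def)
      also have "\<dots> \<le> ?d * \<eta> * 2" using Bn[of y A] \<eta>0 by (intro mult_left_mono) (auto simp: By norm_axis_1)
      finally show ?thesis by (simp add: \<theta>_def)
    qed
    define E where "E z = z + ((\<Sum>j\<in>UNIV. c j * z $ j) - axis k 1 \<bullet> z) *\<^sub>R axis k 1" for z :: "real ^ 'd"
    have [measurable]: "E \<in> borel_measurable borel" unfolding E_def by measurable
    have EB: "B (insert k A) y = E (B A y)" for y
    proof -
      have "E (B A y) = B A y + ((R *v y) $ k - axis k 1 \<bullet> B A y) *\<^sub>R axis k 1"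
        unfolding E_def \<ell>[symmetric] GB ..
      moreover have "axis k 1 \<bullet> B A y = y $ k" using 2 by (simp add: inner_axis' Bi)
      ultimately show ?thesis using 2 by (auto simp: vec_eq_iff Bi axis_def)
    qed
    have "(\<integral>\<^sup>+x. ennreal \<bar>F (B (insert k A) x) - F x\<bar> \<partial>lborel)
      \<le> (\<integral>\<^sup>+x. ennreal \<bar>F (E (B A x)) - F (B A x)\<bar> + ennreal \<bar>F (B A x) - F x\<bar> \<partial>lborel)"
      unfolding EB by (intro nn_integral_mono) (auto simp: ennreal_plus[symmetric] simp del: ennreal_plus intro!: ennreal_leI)
    also have "\<dots> = (\<integral>\<^sup>+x. ennreal \<bar>F (E (B A x)) - F (B A x)\<bar> \<partial>lborel) + (\<integral>\<^sup>+x. ennreal \<bar>F (B A x) - F x\<bar> \<partial>lborel)"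
      by (rule nn_integral_add) measurable
    also have "\<dots> \<le> ennreal (2 ^ CARD('d) * C) + ennreal (real (card A) * (2 ^ CARD('d) * C))"
    proof (rule add_mono)
      \<comment> \<open>Undoing \<open>B A\<close> by a change of variables costs at most
        \<open>2 ^ CARD('d)\<close> and leaves the one-row perturbation \<open>E\<close>.\<close>
      have "(\<integral>\<^sup>+x. ennreal \<bar>F (E (B A x)) - F (B A x)\<bar> \<partial>lborel)
        \<le> ennreal (2 ^ DIM(real ^ 'd)) * (\<integral>\<^sup>+z. ennreal \<bar>F (E z) - F z\<bar> \<partial>lborel)"
        using nn_integral_lborel_linear_le[OF lin Bn, of "\<lambda>z. ennreal \<bar>F (E z) - F z\<bar>"] by simp
      also have "\<dots> \<le> ennreal (2 ^ DIM(real ^ 'd)) * ennreal C"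
        unfolding C_def E_def F_def
        by (intro mult_left_mono product_density_row_perturbation[OF d lc mean v \<kappa> c \<theta>]) auto
      finally show "(\<integral>\<^sup>+x. ennreal \<bar>F (E (B A x)) - F (B A x)\<bar> \<partial>lborel) \<le> ennreal (2 ^ CARD('d) * C)"
        using C0 by (simp add: ennreal_mult)
    qed (rule 2)
    also have "\<dots> = ennreal (real (card (insert k A)) * (2 ^ CARD('d) * C))"
      using 2 C0 by (subst ennreal_plus[symmetric]) (auto simp: algebra_simps)
    finally show ?case .
  qed
  from this[of UNIV] have "(\<integral>\<^sup>+x. ennreal \<bar>F (R *v x) - F x\<bar> \<partial>lborel) \<le> ennreal (?d * (2 ^ CARD('d) * C))"
    by (simp add: B_def)
  \<comment> \<open>There are \<open>?d\<close> rows, each with a Jacobian factor, and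
    \<open>C = 338 * ?d * sqrt \<kappa> * (2 * ?d * \<eta>)\<close>.\<close>
  also have "?d * (2 ^ CARD('d) * C) = 676 * 2 ^ CARD('d) * ?d ^ 3 * sqrt \<kappa> * \<eta>"
    by (simp add: C_def \<theta>_def power3_eq_cube)
  finally show ?thesis .
qed

section \<open>Laws, marginals and independent components\<close>

lemma sets_law[simp, measurable_cong]: "sets (law p) = sets borel"
  and space_law[simp]: "space (law p) = UNIV"
  by (simp_all add: law_def)

lemma is_density_measurable_ennreal: "is_density p \<Longrightarrow> (\<lambda>x. ennreal (p x)) \<in> borel_measurable borel"
  by (rule measurable_compose[OF is_density_measurable measurable_ennreal])

lemma emeasure_law:
  "is_density p \<Longrightarrow> A \<in> sets borel \<Longrightarrow> emeasure (law p) A = (\<integral>\<^sup>+x. ennreal (p x) * indicator A x \<partial>lborel)"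
  by (simp add: law_def emeasure_density is_density_measurable_ennreal)

lemma prob_space_law: "is_density p \<Longrightarrow> prob_space (law p)"
  by (rule prob_spaceI) (simp add: emeasure_law is_density_nn_integral)

lemma nn_integral_law:
  "is_density p \<Longrightarrow> f \<in> borel_measurable borel \<Longrightarrow> (\<integral>\<^sup>+x. f x \<partial>law p) = (\<integral>\<^sup>+x. ennreal (p x) * f x \<partial>lborel)"
  by (simp add: law_def nn_integral_density is_density_measurable_ennreal)

lemma integral_law:
  fixes f :: "'a::euclidean_space \<Rightarrow> real"
  shows "is_density p \<Longrightarrow> f \<in> borel_measurable borel \<Longrightarrow> (LINT x|law p. f x) = (LINT x|lborel. p x * f x)"
  by (simp add: law_def integral_density is_density_measurable is_density_nonneg)

lemma law_cong_AE:
  assumes "is_density p" "is_density q" "AE x in lborel. p x = q x" shows "law p = law q"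
  unfolding law_def using assms by (intro density_cong) (auto simp: is_density_measurable_ennreal)

section \<open>Marginals along unit vectors\<close>

lemma nn_integral_std_normal_density: "(\<integral>\<^sup>+t. ennreal (std_normal_density t) \<partial>lborel) = 1"
  by (simp add: nn_integral_eq_integral normal_density_nonneg)

text \<open>Resampling along \<open>s\<close>, with a Gaussian as auxiliary density, turns the
  measure of the preimage of an exceptional null set \<open>A\<close> into an average of
  one-dimensional measures of \<open>A\<close>, all equal to 0.\<close>

lemma AE_lborel_inner:
  fixes s :: "'a::euclidean_space"
  assumes s: "norm s = 1" and P: "AE t in lborel. P t"
  shows "AE x in lborel. P (s \<bullet> x)"
proof -
  obtain A where A: "A \<in> null_sets lborel" "{t \<in> space lborel. \<not> P t} \<subseteq> A"
    using AE_E[OF P] by (metis null_setsI)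
  have Am[measurable]: "A \<in> sets borel" using A by auto
  then have A0: "(\<integral>\<^sup>+t. indicator A t \<partial>lborel) = 0" using A by (subst nn_integral_indicator) auto
  have ss: "s \<bullet> s = 1" using s by (simp add: dot_square_norm)
  have "(\<integral>\<^sup>+x. indicator A (s \<bullet> x) \<partial>(lborel :: 'a measure))
    = (\<integral>\<^sup>+x. ennreal (std_normal_density (s \<bullet> x)) * (\<integral>\<^sup>+t. indicator A (s \<bullet> (x + (t - s \<bullet> x) *\<^sub>R s)) \<partial>lborel) \<partial>(lborel :: 'a measure))"
    by (rule nn_integral_lborel_resample[OF _ _ s]) (auto simp: nn_integral_std_normal_density)
  also have "\<dots> = 0" by (simp add: inner_add_right ss A0)
  finally have "(\<integral>\<^sup>+x. indicator A (s \<bullet> x) \<partial>(lborel :: 'a measure)) = 0" .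
  then have "AE x in (lborel :: 'a measure). indicator A (s \<bullet> x) = (0::ennreal)"
    by (subst (asm) nn_integral_0_iff_AE) auto
  then show ?thesis
    by eventually_elim (use A(2) in \<open>auto simp: indicator_def split: if_splits\<close>)
qed

text \<open>Preimages of null sets under the projection are null, so its law has a Radon-Nikodym
  derivative. The derivative is finite almost everywhere, hence \<open>enn2real\<close>, which sends
  infinity to 0, alters it on a null set only.\<close>

lemma marginal_density_law:
  fixes p :: "'a::euclidean_space \<Rightarrow> real"
  assumes p: "is_density p" and s: "norm s = 1"
  shows is_density_marginal: "is_density (marginal_density p s)"
    and law_marginal: "law (marginal_density p s) = distr (law p) borel (\<lambda>x. s \<bullet> x)"
proof -
  interpret p: prob_space "law p" by (rule prob_space_law[OF p])
  let ?D = "distr (law p) borel (\<lambda>x. s \<bullet> x)"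
  interpret D: prob_space ?D by (rule p.prob_space_distr) measurable
  have [measurable]: "p \<in> borel_measurable borel" using p by (simp add: is_density_def)
  have ac: "absolutely_continuous lborel ?D"
  proof -
    have "A \<in> null_sets ?D" if A: "A \<in> null_sets lborel" for A
    proof -
      have [measurable]: "A \<in> sets borel" using A by auto
      have "AE t in lborel. t \<notin> A" using A by (rule AE_not_in)
      from AE_lborel_inner[OF s this] have "AE x in law p. s \<bullet> x \<notin> A"
        unfolding law_def by (subst AE_density) auto
      then have "AE t in ?D. t \<notin> A" by (subst AE_distr_iff) auto
      then show ?thesis by (simp add: AE_iff_null_sets)
    qed
    then show ?thesis by (auto simp: absolutely_continuous_def)
  qed
  have fin: "AE t in lborel. RN_deriv lborel ?D t \<noteq> \<infinity>"
    by (rule sigma_finite_measure.RN_deriv_finite[OF sigma_finite_lborel _ ac]) (auto intro: D.sigma_finite_measure_axioms)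
  have meas[measurable]: "marginal_density p s \<in> borel_measurable borel"
    unfolding marginal_density_def[abs_def] by (auto intro: borel_measurable_RN_deriv)
  have "density lborel (RN_deriv lborel ?D) = ?D"
    by (rule sigma_finite_measure.density_RN_deriv[OF sigma_finite_lborel ac]) simp
  moreover have "density lborel (\<lambda>t. ennreal (marginal_density p s t)) = density lborel (RN_deriv lborel ?D)"
  proof (rule density_cong)
    show "AE t in lborel. ennreal (marginal_density p s t) = RN_deriv lborel ?D t"
      using fin by eventually_elim (auto simp: marginal_density_def less_top)
  qed (use meas in auto)
  ultimately show eq: "law (marginal_density p s) = ?D" by (simp add: law_def)
  have "(\<integral>\<^sup>+t. ennreal (marginal_density p s t) \<partial>lborel) = emeasure (law (marginal_density p s)) UNIV"
    by (simp add: law_def emeasure_density)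
  also have "\<dots> = 1" using D.emeasure_space_1 by (simp add: eq)
  finally show "is_density (marginal_density p s)"
    using meas by (auto simp: is_density_def marginal_density_def)
qed

section \<open>Factorization of a density along an unmixing matrix\<close>

lemma borel_measure_eqI_box:
  fixes M N :: "'a::euclidean_space measure"
  assumes "sets M = sets borel" "sets N = sets borel" and fin: "emeasure M UNIV < \<infinity>"
    and eq: "\<And>l u. emeasure M (box l u) = emeasure N (box l u)"
  shows "M = N"
proof (rule measure_eqI_generator_eq)
  let ?E = "range (\<lambda>(a, b). box a b::'a set)"
  show "Int_stable ?E" by (auto simp: Int_stable_def box_Int_box)
  show "?E \<subseteq> Pow UNIV" "sets M = sigma_sets UNIV ?E" "sets N = sigma_sets UNIV ?E"
    using assms by (simp_all add: borel_eq_box)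
  let ?A = "\<lambda>n::nat. box (- (real n *\<^sub>R One)) (real n *\<^sub>R One) :: 'a set"
  show "range ?A \<subseteq> ?E" "(\<Union>i. ?A i) = UNIV" unfolding UN_box_eq_UNIV by auto
  show "emeasure M (?A i) \<noteq> \<infinity>" for i
    using emeasure_mono[of "?A i" UNIV M] fin assms(1) by (auto simp: top_unique less_top)
  show "emeasure M X = emeasure N X" if "X \<in> ?E" for X using that eq by auto
qed

lemma orthogonal_matrix_rows:
  fixes W :: "real ^ 'd ^ 'd"
  assumes "orthogonal_matrix W"
  shows orthogonal_matrix_norm_row: "norm (row i W) = 1"
    and orthogonal_matrix_row_inner: "row i W \<bullet> row j W = (if i = j then 1 else 0)"
    and orthogonal_matrix_transpose_mult: "transpose W *v (W *v x) = x"
    and orthogonal_matrix_isometry: "orthogonal_transformation ((*v) W)"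
    and orthogonal_matrix_transpose_isometry: "orthogonal_transformation ((*v) (transpose W))"
proof -
  have W: "W ** transpose W = mat 1" "transpose W ** W = mat 1"
    using assms by (auto simp: orthogonal_matrix_def)
  have "row i W \<bullet> row j W = (W ** transpose W) $ i $ j" for i j
    by (simp add: matrix_matrix_mult_def row_def transpose_def inner_vec_def)
  then show r: "row i W \<bullet> row j W = (if i = j then 1 else 0)" for i j by (simp add: W mat_def)
  show "norm (row i W) = 1" using r[of i i] by (simp add: norm_eq_sqrt_inner)
  show "transpose W *v (W *v x) = x"
    by (simp only: matrix_vector_mul_assoc W matrix_vector_mul_lid)
  show "orthogonal_transformation ((*v) W)" using assms by (simp add: orthogonal_transformation_matrix matrix_vector_mul_linear)
  show "orthogonal_transformation ((*v) (transpose W))"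
    using assms by (simp add: orthogonal_transformation_matrix matrix_vector_mul_linear orthogonal_matrix_transpose
        del: transpose_matrix_vector)
qed

lemma matrix_vector_mult_row: "(W *v x) $ i = row i W \<bullet> x"
  by (simp add: matrix_vector_mult_def row_def inner_vec_def)

text \<open>The image of the law of \<open>p\<close> under \<open>W\<close> has density
  \<open>p\<close> composed with \<open>transpose W\<close>, by isometry invariance. Independence
  factors its value on a box, and so does the product form of the indicator of a box for the product
  of the marginals. Equality of the two laws identifies the densities almost everywhere
  only.\<close>

lemma unmixing_product_AE:
  fixes p :: "real ^ 'd \<Rightarrow> real"
  assumes p: "is_density p" and W: "unmixing p W"
  shows "AE y in lborel. p (transpose W *v y) = (\<Prod>i\<in>UNIV. marginal_density p (row i W) (y $ i))"
proof -
  have oW: "orthogonal_matrix W" and ind: "prob_space.indep_vars (law p) (\<lambda>_. borel) (\<lambda>i x. (W *v x) $ i) UNIV"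
    using W by (auto simp: unmixing_def)
  interpret p: prob_space "law p" by (rule prob_space_law[OF p])
  have [measurable]: "p \<in> borel_measurable borel" using p by (simp add: is_density_def)
  define g where "g i = marginal_density p (row i W)" for i
  have dg: "is_density (g i)" for i
    unfolding g_def by (rule is_density_marginal[OF p orthogonal_matrix_norm_row[OF oW]])
  have lg: "law (g i) = distr (law p) borel (\<lambda>x. row i W \<bullet> x)" for i
    unfolding g_def by (rule law_marginal[OF p orthogonal_matrix_norm_row[OF oW]])
  have [measurable]: "g i \<in> borel_measurable borel" for i using dg by (simp add: is_density_def)
  define G where "G y = (\<Prod>i\<in>UNIV. g i (y $ i))" for y :: "real ^ 'd"
  have dG: "is_density G" unfolding G_def[abs_def] by (rule is_density_product[OF dg])
  then have [measurable]: "G \<in> borel_measurable borel" by (simp add: is_density_def)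
  have [measurable]: "(\<lambda>x. (W *v x) $ i) \<in> borel_measurable borel" for i
    unfolding matrix_vector_mult_row by measurable
  define q where "q y = p (transpose W *v y)" for y
  have mt[measurable]: "(\<lambda>y::real ^ 'd. A *v y) \<in> borel_measurable borel" for A :: "real ^ 'd ^ 'd"
    by (intro borel_measurable_continuous_onI linear_continuous_on linear_conv_bounded_linear[THEN iffD1] matrix_vector_mul_linear)
  have [measurable]: "q \<in> borel_measurable borel" unfolding q_def[abs_def] by measurable
  have dq: "is_density q"
    using nn_integral_lborel_isometry[OF orthogonal_matrix_transpose_isometry[OF oW], of "\<lambda>x. ennreal (p x)"] p
    by (auto simp: is_density_def q_def)
  interpret q: prob_space "law q" by (rule prob_space_law[OF dq])
  have "law q = law G"
  proof (rule borel_measure_eqI_box)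
    fix l u :: "real ^ 'd"
    have bx: "indicator (box l u) y = (\<Prod>i\<in>UNIV. indicator {l $ i<..<u $ i} (y $ i) :: ennreal)" for y
      by (auto simp: indicator_def mem_box_cart)
    have "emeasure (law q) (box l u) = (\<integral>\<^sup>+y. ennreal (p (transpose W *v y)) * indicator (box l u) y \<partial>lborel)"
      by (simp add: emeasure_law[OF dq] q_def)
    also have "\<dots> = (\<integral>\<^sup>+x. ennreal (p (transpose W *v (W *v x))) * indicator (box l u) (W *v x) \<partial>lborel)"
      by (rule nn_integral_lborel_isometry[symmetric, OF orthogonal_matrix_isometry[OF oW]]) measurable
    also have "\<dots> = emeasure (law p) (\<Inter>i\<in>UNIV. (\<lambda>x. (W *v x) $ i) -` {l $ i<..<u $ i} \<inter> space (law p))"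
      by (subst emeasure_law[OF p], measurable)
        (auto intro!: nn_integral_cong simp: orthogonal_matrix_transpose_mult[OF oW] indicator_def mem_box_cart
          simp del: transpose_matrix_vector)
    also have "\<dots> = (\<Prod>i\<in>UNIV. emeasure (law p) ((\<lambda>x. (W *v x) $ i) -` {l $ i<..<u $ i} \<inter> space (law p)))"
      unfolding p.emeasure_eq_measure
      by (subst p.indep_varsD[OF ind]) (auto simp: prod_ennreal)
    also have "\<dots> = (\<Prod>i\<in>UNIV. emeasure (law (g i)) {l $ i<..<u $ i})"
      by (intro prod.cong) (auto simp: lg emeasure_distr matrix_vector_mult_row)
    also have "\<dots> = (\<Prod>i\<in>UNIV. \<integral>\<^sup>+t. ennreal (g i t) * indicator {l $ i<..<u $ i} t \<partial>lborel)"
      by (simp add: emeasure_law[OF dg])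
    also have "\<dots> = (\<integral>\<^sup>+y. (\<Prod>i\<in>UNIV. ennreal (g i (y $ i)) * indicator {l $ i<..<u $ i} (y $ i)) \<partial>lborel)"
      by (rule nn_integral_lborel_vec_prod[symmetric]) measurable
    also have "\<dots> = emeasure (law G) (box l u)"
      by (subst emeasure_law[OF dG])
        (auto intro!: nn_integral_cong simp: G_def bx prod.distrib prod_ennreal is_density_nonneg[OF dg])
    finally show "emeasure (law q) (box l u) = emeasure (law G) (box l u)" .
  qed (use q.emeasure_space_1 in auto)
  then have "AE y in lborel. ennreal (q y) = ennreal (G y)"
    unfolding law_def by (intro sigma_finite_measure.density_unique[OF sigma_finite_lborel]) auto
  then show ?thesis
    unfolding q_def G_def g_def[symmetric]
    by eventually_elim (use p is_density_nonneg[OF dg] in \<open>auto simp: is_density_def prod_nonneg\<close>)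
qed

text \<open>A marginal density is fixed only up to null sets, whereas the univariate bounds ask for
  log-concavity at every point. On a suitable line in the direction of a row of \<open>W\<close>,
  \<open>p\<close> is almost everywhere the marginal times a positive constant, the product of the
  other factors. Dividing by it gives a version of the marginal that inherits log-concavity from
  \<open>p\<close>.\<close>

lemma unmixing_log_concave_factors:
  fixes p :: "real ^ 'd \<Rightarrow> real"
  assumes p: "is_density p" and lc: "log_concave_usc p" and W: "unmixing p W"
  obtains f where "\<And>i. is_density (f i)" "\<And>i. log_concave_usc (f i)"
    "\<And>i. law (f i) = distr (law p) borel (\<lambda>x. row i W \<bullet> x)"
    "AE y in lborel. p (transpose W *v y) = (\<Prod>i\<in>UNIV. f i (y $ i))"
proof -
  have oW: "orthogonal_matrix W" using W by (auto simp: unmixing_def)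
  have [measurable]: "p \<in> borel_measurable borel" using p by (simp add: is_density_def)
  define g where "g i = marginal_density p (row i W)" for i
  have dg: "is_density (g i)" for i
    unfolding g_def by (rule is_density_marginal[OF p orthogonal_matrix_norm_row[OF oW]])
  have lg: "law (g i) = distr (law p) borel (\<lambda>x. row i W \<bullet> x)" for i
    unfolding g_def by (rule law_marginal[OF p orthogonal_matrix_norm_row[OF oW]])
  have [measurable]: "g i \<in> borel_measurable borel" for i using dg by (simp add: is_density_def)
  have gn: "0 \<le> g i t" for i t using dg by (simp add: is_density_def)
  define G where "G y = (\<Prod>i\<in>UNIV. g i (y $ i))" for y :: "real ^ 'd"
  have dG: "is_density G" unfolding G_def[abs_def] by (rule is_density_product[OF dg])
  then have [measurable]: "G \<in> borel_measurable borel" by (simp add: is_density_def)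
  have mt[measurable]: "(\<lambda>y::real ^ 'd. A *v y) \<in> borel_measurable borel" for A :: "real ^ 'd ^ 'd"
    by (intro borel_measurable_continuous_onI linear_continuous_on linear_conv_bounded_linear[THEN iffD1] matrix_vector_mul_linear)
  define N where "N = {y. p (transpose W *v y) \<noteq> G y}"
  have [measurable]: "N \<in> sets borel" unfolding N_def by measurable
  have AEN: "AE y in lborel. y \<notin> N"
    using unmixing_product_AE[OF p W] unfolding N_def G_def g_def by auto
  have "\<exists>f. is_density f \<and> log_concave_usc f \<and> (AE t in lborel. f t = g k t)" for k
  proof -
    let ?u = "\<lambda>x t. x + (t - axis k 1 \<bullet> x) *\<^sub>R axis k (1::real)"
    \<comment> \<open>The factorization fails on a null set only; resampling along
      \<open>axis k 1\<close> shows that it holds almost everywhere on almost every line in that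
      direction.\<close>
    have "(\<integral>\<^sup>+y. indicator N y \<partial>lborel) = 0"
      using AEN by (subst nn_integral_0_iff_AE) (auto elim!: eventually_mono)
    moreover have "(\<integral>\<^sup>+y. indicator N y \<partial>lborel)
      = (\<integral>\<^sup>+x. ennreal (std_normal_density (axis k 1 \<bullet> x)) * (\<integral>\<^sup>+t. indicator N (?u x t) \<partial>lborel) \<partial>lborel)"
      by (rule nn_integral_lborel_resample) (auto simp: nn_integral_std_normal_density norm_axis_1)
    ultimately have "(\<integral>\<^sup>+x. ennreal (std_normal_density (axis k 1 \<bullet> x)) * (\<integral>\<^sup>+t. indicator N (?u x t) \<partial>lborel) \<partial>lborel) = 0"
      by simp
    then have "AE x in lborel. ennreal (std_normal_density (axis k 1 \<bullet> x)) * (\<integral>\<^sup>+t. indicator N (?u x t) \<partial>lborel) = 0"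
      by (rule nn_integral_0_iff_AE[THEN iffD1, rotated]) measurable
    then have AE1: "AE x in lborel. (\<integral>\<^sup>+t. indicator N (?u x t) \<partial>lborel) = 0"
    proof eventually_elim
      case (elim x)
      have "ennreal (std_normal_density (axis k 1 \<bullet> x)) \<noteq> 0" using normal_density_pos[of 1 0 "axis k 1 \<bullet> x"] by simp
      then show ?case using elim by (metis mult_eq_0_iff)
    qed
    \<comment> \<open>\<open>G\<close> has mass 1, so it does not vanish almost everywhere, and some
      good line passes through a point where it is nonzero. There the constant \<open>c\<close> is
      positive.\<close>
    have "\<exists>x. (\<integral>\<^sup>+t. indicator N (?u x t) \<partial>lborel) = 0 \<and> G x \<noteq> 0"
    proof (rule ccontr)
      assume "\<not> ?thesis"
      then have "AE x in lborel. ennreal (G x) = 0" using AE1 by (auto elim!: eventually_mono)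
      then have "(\<integral>\<^sup>+x. ennreal (G x) \<partial>lborel) = 0" by (subst nn_integral_0_iff_AE) auto
      then show False using dG by (simp add: is_density_def)
    qed
    then obtain x where x: "(\<integral>\<^sup>+t. indicator N (?u x t) \<partial>lborel) = 0" "G x \<noteq> 0" by blast
    define c where "c = (\<Prod>i\<in>UNIV - {k}. g i (x $ i))"
    have "G x = g k (x $ k) * c" unfolding G_def c_def by (rule prod.remove) auto
    then have c: "0 < c" using x(2) gn by (auto simp: c_def less_le intro!: prod_nonneg)
    define f where "f t = (1 / c) * p (transpose W *v (x - (axis k 1 \<bullet> x) *\<^sub>R axis k 1) + t *\<^sub>R (transpose W *v axis k 1))" for t
    have fu: "f t = p (transpose W *v ?u x t) / c" for t
      by (simp add: f_def matrix_vector_right_distrib matrix_vector_mult_diff_distrib matrix_vector_mult_scaleR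
          algebra_simps)
    have "AE t in lborel. ?u x t \<notin> N"
      using x(1) by (subst (asm) nn_integral_0_iff_AE) (auto elim!: eventually_mono simp: indicator_def split: if_splits)
    then have ae: "AE t in lborel. f t = g k t"
    proof eventually_elim
      case (elim t)
      then have "p (transpose W *v ?u x t) = G (?u x t)" by (simp add: N_def)
      also have "\<dots> = g k t * c" unfolding G_def c_def by (rule prod_update_coordinate)
      finally show ?case using c by (simp add: fu)
    qed
    have lf: "log_concave_usc f" unfolding f_def[abs_def] using c by (intro log_concave_usc_line[OF lc]) auto
    have fm[measurable]: "f \<in> borel_measurable borel" unfolding f_def[abs_def] by measurable
    have "(\<integral>\<^sup>+t. ennreal (f t) \<partial>lborel) = (\<integral>\<^sup>+t. ennreal (g k t) \<partial>lborel)"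
      using ae by (intro nn_integral_cong_AE) auto
    then have "is_density f" using dg[of k] lf fm by (simp add: is_density_def log_concave_usc_def)
    then show ?thesis using lf ae by blast
  qed
  then obtain f where f: "\<And>i. is_density (f i)" "\<And>i. log_concave_usc (f i)" "\<And>i. AE t in lborel. f i t = g i t"
    by metis
  have "AE y in lborel. \<forall>i. f i ((y :: real ^ 'd) $ i) = g i (y $ i)"
  proof (rule AE_all_countable[THEN iffD2], rule allI)
    fix i :: 'd
    from AE_lborel_inner[OF norm_axis_1 f(3)[of i], of i]
    show "AE y in lborel. f i ((y :: real ^ 'd) $ i) = g i (y $ i)" by (simp add: inner_axis' norm_axis_1)
  qed
  with AEN have "AE y in lborel. p (transpose W *v y) = (\<Prod>i\<in>UNIV. f i (y $ i))"
    by eventually_elim (auto simp: N_def G_def)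
  moreover have "law (f i) = distr (law p) borel (\<lambda>x. row i W \<bullet> x)" for i
    using law_cong_AE[OF f(1) dg f(3), of i] lg by simp
  ultimately show ?thesis using that f by blast
qed

section \<open>Moments of the components and spectrum of the covariance\<close>

lemma unmixing_factor_mean:
  fixes p :: "real ^ 'd \<Rightarrow> real"
  assumes p: "is_density p" and z: "zero_mean p" and d: "is_density f"
    and law: "law f = distr (law p) borel (\<lambda>x. w \<bullet> x)"
  shows "(LINT t|lborel. t * f t) = 0"
proof -
  have "(LINT t|lborel. t * f t) = (LINT t|law f. t)" by (simp add: integral_law[OF d] mult.commute)
  also have "\<dots> = (LINT x|law p. w \<bullet> x)" unfolding law by (rule integral_distr) auto
  also have "\<dots> = w \<bullet> (LINT x|law p. x)" using z by (intro integral_inner_right) (auto simp: zero_mean_def)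
  also have "\<dots> = 0" using z by (simp add: zero_mean_def mean_def)
  finally show ?thesis .
qed

text \<open>Otherwise \<open>f\<close> would vanish almost everywhere off 0, and a single point is a
  null set.\<close>

lemma density_second_moment_pos:
  fixes f :: "real \<Rightarrow> real"
  assumes d: "is_density f"
  shows "(\<integral>\<^sup>+t. ennreal (t\<^sup>2 * f t) \<partial>lborel) \<noteq> 0"
proof
  have [measurable]: "f \<in> borel_measurable borel" using d by (simp add: is_density_def)
  assume "(\<integral>\<^sup>+t. ennreal (t\<^sup>2 * f t) \<partial>lborel) = 0"
  then have "AE t in lborel. ennreal (t\<^sup>2 * f t) = 0" by (subst (asm) nn_integral_0_iff_AE) auto
  with AE_lborel_singleton[of 0] have "AE t in lborel. ennreal (f t) = 0"
  proof eventually_elim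
    case (elim t)
    then have "t\<^sup>2 * f t \<le> 0" "0 < t\<^sup>2" by (simp_all add: ennreal_eq_0_iff)
    then show ?case by (auto simp: ennreal_eq_0_iff mult_le_0_iff)
  qed
  then have "(\<integral>\<^sup>+t. ennreal (f t) \<partial>lborel) = 0" by (subst nn_integral_0_iff_AE) auto
  then show False using d by (simp add: is_density_def)
qed

text \<open>In the orthonormal basis of the rows of \<open>W\<close> the covariance is diagonal with
  entries \<open>v k\<close>, because independent components of mean 0 are uncorrelated. An
  eigenvector is not orthogonal to all rows, and pairing the eigenvalue equation with such a row
  identifies the eigenvalue.\<close>

lemma unmixing_eigenvalues_covariance:
  fixes p :: "real ^ 'd \<Rightarrow> real"
  assumes p: "is_density p" and z: "zero_mean p" and W: "unmixing p W"
    and v: "\<And>i. (\<integral>\<^sup>+x. ennreal ((row i W \<bullet> x)\<^sup>2) \<partial>law p) = ennreal (v i)" "\<And>i. 0 < v i"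
  shows "eigenvalues (covariance p) = range v"
proof -
  have oW: "orthogonal_matrix W" and ind: "prob_space.indep_vars (law p) (\<lambda>_. borel) (\<lambda>i x. (W *v x) $ i) UNIV"
    using W by (auto simp: unmixing_def)
  interpret p: prob_space "law p" by (rule prob_space_law[OF p])
  define Y where "Y k x = row k W \<bullet> x" for k x
  have [measurable]: "Y k \<in> borel_measurable borel" for k unfolding Y_def by measurable
  have iY: "integrable (law p) (Y k)" for k
    using z unfolding Y_def by (intro integrable_inner_right) (auto simp: zero_mean_def)
  have eY: "(LINT x|law p. Y k x) = 0" for k
  proof -
    have "(LINT x|law p. Y k x) = row k W \<bullet> (LINT x|law p. x)"
      unfolding Y_def using z by (intro integral_inner_right) (auto simp: zero_mean_def)
    then show ?thesis using z by (simp add: zero_mean_def mean_def)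
  qed
  have iY2: "integrable (law p) (\<lambda>x. (Y k x)\<^sup>2)" for k
    using v(1)[of k] unfolding Y_def by (intro integrableI_nonneg) auto
  have eY2: "(LINT x|law p. (Y k x)\<^sup>2) = v k" for k
    using v(1)[of k] v(2)[of k] unfolding Y_def by (simp add: integral_eq_nn_integral)
  have YY: "integrable (law p) (\<lambda>x. Y k x * Y l x) \<and> (LINT x|law p. Y k x * Y l x) = (if k = l then v k else 0)" for k l
  proof (cases "k = l")
    case True
    then show ?thesis using iY2[of l] eY2[of l] by (simp add: power2_eq_square)
  next
    case False
    have ind2: "p.indep_vars (\<lambda>_. borel) Y {k, l}"
      using p.indep_vars_subset[OF ind, of "{k, l}"] by (simp add: Y_def[abs_def] matrix_vector_mult_row)
    have "(LINT x|law p. (\<Prod>i\<in>{k, l}. Y i x)) = (\<Prod>i\<in>{k, l}. LINT x|law p. Y i x)"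
      by (rule p.indep_vars_lebesgue_integral[OF _ ind2]) (auto simp: iY)
    moreover have "integrable (law p) (\<lambda>x. \<Prod>i\<in>{k, l}. Y i x)"
      by (rule p.indep_vars_integrable[OF _ ind2]) (auto simp: iY)
    ultimately show ?thesis using False by (simp add: eY)
  qed
  have comp: "x $ i = (\<Sum>k\<in>UNIV. W $ k $ i * Y k x)" for x i
  proof -
    have "x $ i = (transpose W *v (W *v x)) $ i" by (simp only: orthogonal_matrix_transpose_mult[OF oW])
    also have "\<dots> = (\<Sum>k\<in>UNIV. transpose W $ i $ k * (W *v x) $ k)" unfolding matrix_vector_mult_def by simp
    finally show ?thesis by (simp add: transpose_def Y_def matrix_vector_mult_row)
  qed
  have cov: "covariance p $ i $ j = (\<Sum>k\<in>UNIV. W $ k $ i * W $ k $ j * v k)" for i j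
  proof -
    have "covariance p $ i $ j = (LINT x|law p. x $ i * x $ j)"
      using z by (simp add: covariance_def zero_mean_def)
    also have "\<dots> = (LINT x|law p. (\<Sum>k\<in>UNIV. (\<Sum>l\<in>UNIV. (W $ k $ i * W $ l $ j) * (Y k x * Y l x))))"
      by (intro Bochner_Integration.integral_cong refl, subst (1 2) comp) (simp add: sum_product mult_ac)
    also have "\<dots> = (\<Sum>k\<in>UNIV. \<Sum>l\<in>UNIV. (W $ k $ i * W $ l $ j) * (if k = l then v k else 0))"
      using YY by (simp add: integral_sum)
    finally show ?thesis by (simp add: if_distrib sum.delta cong: if_cong)
  qed
  have covm: "covariance p *v u = (\<Sum>k\<in>UNIV. (v k * (row k W \<bullet> u)) *\<^sub>R row k W)" for u
  proof -
    have "(covariance p *v u) $ i = (\<Sum>k\<in>UNIV. (v k * (row k W \<bullet> u)) *\<^sub>R row k W) $ i" for i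
    proof -
      have "(covariance p *v u) $ i = (\<Sum>j\<in>UNIV. \<Sum>k\<in>UNIV. W $ k $ i * W $ k $ j * v k * u $ j)"
        by (simp add: matrix_vector_mult_def cov sum_distrib_right)
      also have "\<dots> = (\<Sum>k\<in>UNIV. \<Sum>j\<in>UNIV. W $ k $ i * W $ k $ j * v k * u $ j)" by (rule sum.swap)
      also have "\<dots> = (\<Sum>k\<in>UNIV. v k * (row k W \<bullet> u) * W $ k $ i)"
        by (simp add: row_def inner_vec_def sum_distrib_left sum_distrib_right mult_ac)
      finally show ?thesis by (simp add: row_def)
    qed
    then show ?thesis by (simp add: vec_eq_iff)
  qed
  have covr: "row k W \<bullet> (covariance p *v u) = v k * (row k W \<bullet> u)" for k u
    unfolding covm by (simp add: inner_sum_right orthogonal_matrix_row_inner[OF oW] if_distrib sum.delta cong: if_cong)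
  show ?thesis
  proof (intro equalityI subsetI)
    fix l assume "l \<in> eigenvalues (covariance p)"
    then obtain u where u: "u \<noteq> 0" "covariance p *v u = l *\<^sub>R u" by (auto simp: eigenvalues_def)
    have "\<exists>k. row k W \<bullet> u \<noteq> 0"
    proof (rule ccontr)
      assume "\<not> ?thesis"
      then have "W *v u = 0" by (simp add: vec_eq_iff matrix_vector_mult_row)
      then have "transpose W *v (W *v u) = 0" by (simp only: matrix_vector_mult_0_right)
      then show False using u by (simp only: orthogonal_matrix_transpose_mult[OF oW])
    qed
    then obtain k where k: "row k W \<bullet> u \<noteq> 0" by blast
    have "l * (row k W \<bullet> u) = v k * (row k W \<bullet> u)" using covr[of k u] u by simp
    then show "l \<in> range v" using k by auto
  next
    fix l assume "l \<in> range v"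
    then obtain k where k: "l = v k" by blast
    have "covariance p *v row k W = v k *\<^sub>R row k W"
    proof -
      have "covariance p *v row k W = (\<Sum>j\<in>UNIV. if j = k then v k *\<^sub>R row k W else 0)"
        unfolding covm by (intro sum.cong) (auto simp: orthogonal_matrix_row_inner[OF oW])
      then show ?thesis by simp
    qed
    moreover have "row k W \<noteq> 0" using orthogonal_matrix_norm_row[OF oW, of k] by force
    ultimately show "l \<in> eigenvalues (covariance p)" unfolding eigenvalues_def k by blast
  qed
qed

text \<open>The \<open>v i\<close> are the eigenvalues of the covariance, so the ratio of two of
  them is at most that of the largest to the smallest. Finiteness of the second moments comes from
  log-concavity, since \<open>zero_mean\<close> gives first moments only.\<close>

lemma unmixing_factor_moments:
  fixes p :: "real ^ 'd \<Rightarrow> real"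
  assumes p: "is_density p" and z: "zero_mean p" and W: "unmixing p W"
    and d: "\<And>i. is_density (f i)" and lc: "\<And>i. log_concave_usc (f i)"
    and law: "\<And>i. law (f i) = distr (law p) borel (\<lambda>x. row i W \<bullet> x)"
  obtains v where "\<And>i. (\<integral>\<^sup>+t. ennreal (t\<^sup>2 * f i t) \<partial>lborel) = ennreal (v i)" "\<And>i. 0 < v i"
    "\<And>i j. v j \<le> cond (covariance p) * v i"
proof -
  define v where "v i = enn2real (\<integral>\<^sup>+t. ennreal (t\<^sup>2 * f i t) \<partial>lborel)" for i
  have fin: "(\<integral>\<^sup>+t. ennreal (t\<^sup>2 * f i t) \<partial>lborel) \<noteq> \<top>" for i
  proof -
    obtain m where "(\<integral>\<^sup>+t. ennreal (t\<^sup>2 * f i t) \<partial>lborel) \<le> ennreal (3136 / (f i m)\<^sup>2)"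
      using log_concave_usc_centered[OF lc d unmixing_factor_mean[OF p z d law]] by blast
    then show ?thesis by (auto simp: top_unique)
  qed
  have v: "(\<integral>\<^sup>+t. ennreal (t\<^sup>2 * f i t) \<partial>lborel) = ennreal (v i)" for i
    using fin[of i] by (simp add: v_def less_top)
  have vpos: "0 < v i" for i
    using v[of i] density_second_moment_pos[OF d, of i] by (auto simp: not_less ennreal_neg intro: ccontr)
  have "(\<integral>\<^sup>+x. ennreal ((row i W \<bullet> x)\<^sup>2) \<partial>law p) = ennreal (v i)" for i
  proof -
    have "(\<integral>\<^sup>+x. ennreal ((row i W \<bullet> x)\<^sup>2) \<partial>law p) = (\<integral>\<^sup>+t. ennreal (t\<^sup>2) \<partial>law (f i))"
      unfolding law by (subst nn_integral_distr) auto
    also have "\<dots> = (\<integral>\<^sup>+t. ennreal (t\<^sup>2 * f i t) \<partial>lborel)"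
      using is_density_nonneg[OF d] by (subst nn_integral_law[OF d]) (auto simp: ennreal_mult[symmetric] mult.commute)
    finally show ?thesis by (simp add: v)
  qed
  then have ev: "eigenvalues (covariance p) = range v"
    by (rule unmixing_eigenvalues_covariance[OF p z W _ vpos])
  have "v j \<le> cond (covariance p) * v i" for i j
  proof -
    have fr: "finite (range v)" by simp
    have "Min (range v) \<in> range v" by (intro Min_in) auto
    then have m0: "0 < Min (range v)" using vpos by auto
    then have m1: "Min (range v) \<noteq> 0" by linarith
    have "0 < v j" by (rule vpos)
    also have M: "v j \<le> Max (range v)" by (intro Max_ge) auto
    finally have M0: "0 < Max (range v)" .
    have "Max (range v) = cond (covariance p) * Min (range v)" using m1 by (simp add: cond_def ev)
    also have "\<dots> \<le> cond (covariance p) * v i"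
      using divide_nonneg_nonneg[OF less_imp_le[OF M0] less_imp_le[OF m0]] by (intro mult_left_mono) (auto simp: cond_def ev)
    finally show ?thesis using M by simp
  qed
  then show ?thesis using that v vpos by blast
qed

section \<open>Hellinger distance\<close>

text \<open>All claims come from integrating
  \<open>(sqrt q - sqrt p)^2 + 2 * sqrt (p * q) = p + q\<close>, whose right side has mass 2. The
  integral of \<open>sqrt (p * q)\<close> is the Hellinger affinity, which is multiplicative over
  products.\<close>

lemma hellinger_sq_affinity:
  fixes p q :: "'a::euclidean_space \<Rightarrow> real"
  assumes p: "is_density p" and q: "is_density q"
  shows hellinger_sq_nn_integral: "(\<integral>\<^sup>+x. ennreal ((sqrt (q x) - sqrt (p x))\<^sup>2) \<partial>lborel) = ennreal (2 * hellinger_sq p q)"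
    and nn_integral_sqrt_mult: "(\<integral>\<^sup>+x. ennreal (sqrt (p x * q x)) \<partial>lborel) = ennreal (1 - hellinger_sq p q)"
    and hellinger_sq_nonneg: "0 \<le> hellinger_sq p q"
    and hellinger_sq_le_1: "hellinger_sq p q \<le> 1"
    and integrable_hellinger: "integrable lborel (\<lambda>x. (sqrt (q x) - sqrt (p x))\<^sup>2)"
proof -
  have [measurable]: "p \<in> borel_measurable borel" "q \<in> borel_measurable borel" using p q by (auto simp: is_density_def)
  have nn: "0 \<le> p x" "0 \<le> q x" for x using p q by (auto simp: is_density_def)
  let ?H = "\<integral>\<^sup>+x. ennreal ((sqrt (q x) - sqrt (p x))\<^sup>2) \<partial>lborel"
  let ?A = "\<integral>\<^sup>+x. ennreal (sqrt (p x * q x)) \<partial>lborel"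
  have "?H + 2 * ?A = (\<integral>\<^sup>+x. ennreal ((sqrt (q x) - sqrt (p x))\<^sup>2) + 2 * ennreal (sqrt (p x * q x)) \<partial>lborel)"
    by (simp add: nn_integral_add nn_integral_cmult)
  also have "\<dots> = (\<integral>\<^sup>+x. ennreal (p x) + ennreal (q x) \<partial>lborel)"
  proof (rule nn_integral_cong)
    fix x
    have "ennreal ((sqrt (q x) - sqrt (p x))\<^sup>2) + 2 * ennreal (sqrt (p x * q x))
      = ennreal ((sqrt (q x) - sqrt (p x))\<^sup>2 + 2 * sqrt (p x * q x))"
      using nn by (simp add: ennreal_mult)
    also have "(sqrt (q x) - sqrt (p x))\<^sup>2 + 2 * sqrt (p x * q x) = p x + q x"
      using nn by (simp add: power2_diff real_sqrt_mult)
    finally show "ennreal ((sqrt (q x) - sqrt (p x))\<^sup>2) + 2 * ennreal (sqrt (p x * q x)) = ennreal (p x) + ennreal (q x)"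
      using nn by simp
  qed
  also have "\<dots> = 2" using p q by (simp add: nn_integral_add is_density_def)
  finally have sum: "?H + 2 * ?A = 2" .
  have "?H + 2 * ?A < \<top>" unfolding sum by simp
  then have "?H \<noteq> \<top>" "?A \<noteq> \<top>" by (auto simp: ennreal_mult_less_top less_top)
  moreover define h a where "h = enn2real ?H" and "a = enn2real ?A"
  ultimately have h: "?H = ennreal h" "0 \<le> h" and a: "?A = ennreal a" "0 \<le> a"
    by (simp_all add: less_top)
  have "ennreal (h + 2 * a) = ennreal 2"
    using sum h a by (simp add: ennreal_mult)
  then have ha: "h + 2 * a = 2" using h a by (subst (asm) ennreal_inj) auto
  have hs: "hellinger_sq p q = h / 2"
    using h by (simp add: hellinger_sq_def integral_eq_nn_integral)
  show "?H = ennreal (2 * hellinger_sq p q)" using h by (simp add: hs)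
  have "a = 1 - h / 2" using ha by simp
  then show "?A = ennreal (1 - hellinger_sq p q)" using a by (simp add: hs)
  show "0 \<le> hellinger_sq p q" "hellinger_sq p q \<le> 1" using h a ha by (auto simp: hs)
  show "integrable lborel (\<lambda>x. (sqrt (q x) - sqrt (p x))\<^sup>2)"
    using h by (intro integrableI_nonneg) auto
qed

text \<open>\<open>|sqrt p - sqrt q|\<close> is at most \<open>sqrt p + sqrt q\<close>, and the
  product of the two is \<open>|p - q|\<close>.\<close>

lemma hellinger_sq_le_L1:
  fixes p q :: "'a::euclidean_space \<Rightarrow> real"
  assumes p: "is_density p" and q: "is_density q" and L: "(\<integral>\<^sup>+x. ennreal \<bar>p x - q x\<bar> \<partial>lborel) \<le> ennreal L" and "0 \<le> L"
  shows "hellinger_sq p q \<le> L / 2"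
proof -
  have nn: "0 \<le> p x" "0 \<le> q x" for x using p q by (auto simp: is_density_def)
  have "ennreal (2 * hellinger_sq p q) = (\<integral>\<^sup>+x. ennreal ((sqrt (q x) - sqrt (p x))\<^sup>2) \<partial>lborel)"
    by (simp add: hellinger_sq_nn_integral[OF p q])
  also have "\<dots> \<le> (\<integral>\<^sup>+x. ennreal \<bar>p x - q x\<bar> \<partial>lborel)"
  proof (intro nn_integral_mono ennreal_leI)
    fix x
    have "(sqrt (q x) - sqrt (p x))\<^sup>2 = \<bar>sqrt (p x) - sqrt (q x)\<bar> * \<bar>sqrt (p x) - sqrt (q x)\<bar>"
      by (simp add: power2_eq_square abs_mult[symmetric] algebra_simps)
    also have "\<dots> \<le> \<bar>sqrt (p x) - sqrt (q x)\<bar> * \<bar>sqrt (p x) + sqrt (q x)\<bar>"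
      using nn[of x] by (intro mult_left_mono) (auto simp: abs_le_iff)
    also have "\<dots> = \<bar>p x - q x\<bar>"
    proof -
      have "(sqrt (p x) - sqrt (q x)) * (sqrt (p x) + sqrt (q x)) = p x - q x"
        using nn[of x] by (simp add: algebra_simps)
      then show ?thesis by (simp only: abs_mult[symmetric])
    qed
    finally show "(sqrt (q x) - sqrt (p x))\<^sup>2 \<le> \<bar>p x - q x\<bar>" .
  qed
  finally have "ennreal (2 * hellinger_sq p q) \<le> ennreal L" using L by (rule order_trans)
  then show ?thesis using \<open>0 \<le> L\<close> by simp
qed

text \<open>Up to a constant this is the squared L2 distance of the square roots; squaring the
  triangle inequality costs the factor 2.\<close>

lemma hellinger_sq_triangle:
  fixes p q r :: "'a::euclidean_space \<Rightarrow> real"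
  assumes p: "is_density p" and q: "is_density q" and r: "is_density r"
  shows "hellinger_sq p r \<le> 2 * hellinger_sq p q + 2 * hellinger_sq q r"
proof -
  have sq: "(c - a)\<^sup>2 \<le> 2 * (b - a)\<^sup>2 + 2 * (c - b)\<^sup>2" for a b c :: real
  proof -
    have "0 \<le> ((b - a) - (c - b))\<^sup>2" by simp
    then show ?thesis by (simp add: power2_eq_square algebra_simps)
  qed
  have "(LINT x|lborel. (sqrt (r x) - sqrt (p x))\<^sup>2)
    \<le> (LINT x|lborel. 2 * (sqrt (q x) - sqrt (p x))\<^sup>2 + 2 * (sqrt (r x) - sqrt (q x))\<^sup>2)"
  proof (rule integral_mono)
    fix x
    show "(sqrt (r x) - sqrt (p x))\<^sup>2 \<le> 2 * (sqrt (q x) - sqrt (p x))\<^sup>2 + 2 * (sqrt (r x) - sqrt (q x))\<^sup>2"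
      by (rule sq)
  qed (auto intro!: integrable_hellinger p q r)
  also have "\<dots> = 2 * (LINT x|lborel. (sqrt (q x) - sqrt (p x))\<^sup>2) + 2 * (LINT x|lborel. (sqrt (r x) - sqrt (q x))\<^sup>2)"
    using integrable_hellinger[OF p q] integrable_hellinger[OF q r] by simp
  finally show ?thesis by (simp add: hellinger_sq_def)
qed

section \<open>Densities that factor along orthonormal rows\<close>

lemma nn_integral_row_product:
  fixes V :: "real ^ 'd ^ 'd" and a :: "'d \<Rightarrow> real \<Rightarrow> ennreal"
  assumes V: "orthogonal_matrix V" and [measurable]: "\<And>i. a i \<in> borel_measurable borel"
  shows "(\<integral>\<^sup>+x. (\<Prod>i\<in>UNIV. a i (row i V \<bullet> x)) \<partial>lborel) = (\<Prod>i\<in>UNIV. \<integral>\<^sup>+t. a i t \<partial>lborel)"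
proof -
  have "(\<integral>\<^sup>+x. (\<Prod>i\<in>UNIV. a i (row i V \<bullet> x)) \<partial>lborel) = (\<integral>\<^sup>+x. (\<Prod>i\<in>UNIV. a i ((V *v x) $ i)) \<partial>lborel)"
    by (simp only: matrix_vector_mult_row)
  also have "\<dots> = (\<integral>\<^sup>+y. (\<Prod>i\<in>UNIV. a i (y $ i)) \<partial>lborel)"
    by (rule nn_integral_lborel_isometry[OF orthogonal_matrix_isometry[OF V]]) measurable
  also have "\<dots> = (\<Prod>i\<in>UNIV. \<integral>\<^sup>+t. a i t \<partial>lborel)" by (rule nn_integral_lborel_vec_prod) measurable
  finally show ?thesis .
qed

lemma is_density_row_product:
  fixes V :: "real ^ 'd ^ 'd"
  assumes V: "orthogonal_matrix V" and a: "\<And>i. is_density (a i)"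
  shows "is_density (\<lambda>x. \<Prod>i\<in>UNIV. a i (row i V \<bullet> x))"
proof -
  have [measurable]: "a i \<in> borel_measurable borel" for i using a by (simp add: is_density_def)
  have "(\<integral>\<^sup>+x. ennreal (\<Prod>i\<in>UNIV. a i (row i V \<bullet> x)) \<partial>lborel) = (\<integral>\<^sup>+x. (\<Prod>i\<in>UNIV. ennreal (a i (row i V \<bullet> x))) \<partial>lborel)"
    by (simp add: prod_ennreal is_density_nonneg[OF a])
  also have "\<dots> = 1"
    by (subst nn_integral_row_product[OF V, of "\<lambda>i t. ennreal (a i t)"]) (auto simp: is_density_nn_integral[OF a])
  finally show ?thesis
    using is_density_nonneg[OF a] by (auto simp: is_density_def prod_nonneg)
qed

text \<open>Affinities multiply over the rows, so one minus the joint error is the product of one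
  minus each univariate error. With these errors in [0, 1], that product is at least 1 minus their
  sum.\<close>

lemma hellinger_sq_row_product:
  fixes V :: "real ^ 'd ^ 'd"
  assumes V: "orthogonal_matrix V" and a: "\<And>i. is_density (a i)" and b: "\<And>i. is_density (b i)"
  shows "hellinger_sq (\<lambda>x. \<Prod>i\<in>UNIV. a i (row i V \<bullet> x)) (\<lambda>x. \<Prod>i\<in>UNIV. b i (row i V \<bullet> x))
    \<le> (\<Sum>i\<in>UNIV. hellinger_sq (a i) (b i))"
proof -
  let ?P = "\<lambda>x. \<Prod>i\<in>UNIV. a i (row i V \<bullet> x)" and ?Q = "\<lambda>x. \<Prod>i\<in>UNIV. b i (row i V \<bullet> x)"
  have [measurable]: "a i \<in> borel_measurable borel" "b i \<in> borel_measurable borel" for i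
    using a b by (simp_all add: is_density_def)
  have P: "is_density ?P" and Q: "is_density ?Q" using is_density_row_product V a b by auto
  have sq: "sqrt (\<Prod>i\<in>A. f i) = (\<Prod>i\<in>A. sqrt (f i))" for A :: "'d set" and f
    by (induction A rule: infinite_finite_induct) (auto simp: real_sqrt_mult)
  have "ennreal (1 - hellinger_sq ?P ?Q) = (\<integral>\<^sup>+x. ennreal (sqrt (?P x * ?Q x)) \<partial>lborel)"
    by (simp add: nn_integral_sqrt_mult[OF P Q])
  also have "\<dots> = (\<integral>\<^sup>+x. (\<Prod>i\<in>UNIV. ennreal (sqrt (a i (row i V \<bullet> x) * b i (row i V \<bullet> x)))) \<partial>lborel)"
    by (simp add: prod_ennreal is_density_nonneg[OF a] is_density_nonneg[OF b] prod.distrib[symmetric] sq)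
  also have "\<dots> = (\<Prod>i\<in>UNIV. ennreal (1 - hellinger_sq (a i) (b i)))"
    by (subst nn_integral_row_product[OF V, of "\<lambda>i t. ennreal (sqrt (a i t * b i t))"])
      (auto simp: nn_integral_sqrt_mult[OF a b])
  also have "\<dots> = ennreal (\<Prod>i\<in>UNIV. 1 - hellinger_sq (a i) (b i))"
    by (rule prod_ennreal) (simp add: hellinger_sq_le_1[OF a b])
  finally have "1 - hellinger_sq ?P ?Q = (\<Prod>i\<in>UNIV. 1 - hellinger_sq (a i) (b i))"
    by (subst (asm) ennreal_inj) (auto simp: hellinger_sq_le_1[OF P Q] hellinger_sq_le_1[OF a b] intro!: prod_nonneg)
  moreover have "1 - (\<Sum>i\<in>UNIV. hellinger_sq (a i) (b i)) \<le> (\<Prod>i\<in>UNIV. 1 - hellinger_sq (a i) (b i))"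
    by (rule Weierstrass_prod_ineq) (simp add: hellinger_sq_nonneg[OF a b] hellinger_sq_le_1[OF a b])
  ultimately show ?thesis by simp
qed

text \<open>On the set where \<open>b \<le> a\<close> the integral of \<open>a - b\<close> is a
  difference of two probabilities, hence the integral of \<open>p - q\<close> over the preimage, and
  absolute values only increase it. The complement is treated with the roles exchanged; the two
  preimages are disjoint.\<close>

lemma L1_pushforward_le:
  fixes a b :: "'b::euclidean_space \<Rightarrow> real" and p q :: "'a::euclidean_space \<Rightarrow> real"
  assumes a: "is_density a" and b: "is_density b" and p: "is_density p" and q: "is_density q"
    and [measurable]: "s \<in> borel_measurable borel"
    and la: "law a = distr (law p) borel s" and lb: "law b = distr (law q) borel s"
  shows "(\<integral>\<^sup>+t. ennreal \<bar>a t - b t\<bar> \<partial>lborel) \<le> (\<integral>\<^sup>+x. ennreal \<bar>p x - q x\<bar> \<partial>lborel)"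
proof -
  have [measurable]: "a \<in> borel_measurable borel" "b \<in> borel_measurable borel"
    "p \<in> borel_measurable borel" "q \<in> borel_measurable borel" using a b p q by (simp_all add: is_density_def)
  \<comment> \<open>Stated for arbitrary densities so that it also applies with \<open>a\<close>,
    \<open>b\<close> and \<open>p\<close>, \<open>q\<close> exchanged.\<close>
  have *: "(\<integral>\<^sup>+t. ennreal \<bar>a t - b t\<bar> * indicator A t \<partial>lborel) \<le> (\<integral>\<^sup>+x. ennreal \<bar>p x - q x\<bar> * indicator A (s x) \<partial>lborel)"
    if [measurable]: "A \<in> sets borel" and A: "\<And>t. t \<in> A \<Longrightarrow> b t \<le> a t"
      and a: "is_density a" and b: "is_density b" and p: "is_density p" and q: "is_density q"
      and la: "law a = distr (law p) borel s" and lb: "law b = distr (law q) borel s" for A a b p q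
  proof -
    have [measurable]: "a \<in> borel_measurable borel" "b \<in> borel_measurable borel"
      "p \<in> borel_measurable borel" "q \<in> borel_measurable borel" using a b p q by (simp_all add: is_density_def)
    have ea: "emeasure (law a) A = (\<integral>\<^sup>+x. ennreal (p x) * indicator A (s x) \<partial>lborel)"
      unfolding la by (subst emeasure_distr, measurable, subst emeasure_law[OF p], measurable)
        (auto intro!: nn_integral_cong simp: indicator_def)
    have eb: "emeasure (law b) A = (\<integral>\<^sup>+x. ennreal (q x) * indicator A (s x) \<partial>lborel)"
      unfolding lb by (subst emeasure_distr, measurable, subst emeasure_law[OF q], measurable)
        (auto intro!: nn_integral_cong simp: indicator_def)
    interpret b: prob_space "law b" by (rule prob_space_law[OF b])
    have fin: "emeasure (law b) A \<noteq> \<top>" by simp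
    have "(\<integral>\<^sup>+t. ennreal \<bar>a t - b t\<bar> * indicator A t \<partial>lborel) + emeasure (law b) A
      = (\<integral>\<^sup>+t. ennreal \<bar>a t - b t\<bar> * indicator A t + ennreal (b t) * indicator A t \<partial>lborel)"
      by (simp add: nn_integral_add emeasure_law[OF b])
    also have "\<dots> = (\<integral>\<^sup>+t. ennreal (a t) * indicator A t \<partial>lborel)"
      using A is_density_nonneg[OF b]
      by (intro nn_integral_cong) (auto simp: indicator_def ennreal_plus[symmetric] simp del: ennreal_plus)
    also have "\<dots> = emeasure (law a) A" by (simp add: emeasure_law[OF a])
    also have "\<dots> \<le> (\<integral>\<^sup>+x. ennreal \<bar>p x - q x\<bar> * indicator A (s x) + ennreal (q x) * indicator A (s x) \<partial>lborel)"
      unfolding ea using is_density_nonneg[OF q]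
      by (intro nn_integral_mono) (auto simp: indicator_def ennreal_plus[symmetric] simp del: ennreal_plus intro!: ennreal_leI)
    also have "\<dots> = (\<integral>\<^sup>+x. ennreal \<bar>p x - q x\<bar> * indicator A (s x) \<partial>lborel) + emeasure (law b) A"
      unfolding eb by (rule nn_integral_add) measurable
    finally show ?thesis using fin by (simp add: ennreal_add_left_cancel_le add.commute)
  qed
  define A where "A = {t. b t \<le> a t}"
  have [measurable]: "A \<in> sets borel" unfolding A_def by measurable
  have "(\<integral>\<^sup>+t. ennreal \<bar>a t - b t\<bar> \<partial>lborel)
    = (\<integral>\<^sup>+t. ennreal \<bar>a t - b t\<bar> * indicator A t + ennreal \<bar>b t - a t\<bar> * indicator (- A) t \<partial>lborel)"
    by (intro nn_integral_cong) (auto simp: indicator_def)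
  also have "\<dots> = (\<integral>\<^sup>+t. ennreal \<bar>a t - b t\<bar> * indicator A t \<partial>lborel) + (\<integral>\<^sup>+t. ennreal \<bar>b t - a t\<bar> * indicator (- A) t \<partial>lborel)"
    by (rule nn_integral_add) measurable
  also have "\<dots> \<le> (\<integral>\<^sup>+x. ennreal \<bar>p x - q x\<bar> * indicator A (s x) \<partial>lborel) + (\<integral>\<^sup>+x. ennreal \<bar>q x - p x\<bar> * indicator (- A) (s x) \<partial>lborel)"
    using a b p q la lb by (intro add_mono *) (auto simp: A_def)
  also have "\<dots> = (\<integral>\<^sup>+x. ennreal \<bar>p x - q x\<bar> * indicator A (s x) + ennreal \<bar>q x - p x\<bar> * indicator (- A) (s x) \<partial>lborel)"
    by (rule nn_integral_add[symmetric]) measurable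
  also have "\<dots> = (\<integral>\<^sup>+x. ennreal \<bar>p x - q x\<bar> \<partial>lborel)"
    by (intro nn_integral_cong) (auto simp: indicator_def)
  finally show ?thesis .
qed

lemma L1_densities_le_2:
  fixes p q :: "'a::euclidean_space \<Rightarrow> real"
  assumes p: "is_density p" and q: "is_density q"
  shows "(\<integral>\<^sup>+x. ennreal \<bar>p x - q x\<bar> \<partial>lborel) \<le> ennreal 2"
proof -
  have [measurable]: "p \<in> borel_measurable borel" "q \<in> borel_measurable borel" using p q by (simp_all add: is_density_def)
  have "(\<integral>\<^sup>+x. ennreal \<bar>p x - q x\<bar> \<partial>lborel) \<le> (\<integral>\<^sup>+x. ennreal (p x) + ennreal (q x) \<partial>lborel)"
    using is_density_nonneg[OF p] is_density_nonneg[OF q]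
    by (intro nn_integral_mono) (auto simp: ennreal_plus[symmetric] abs_le_iff add_increasing2 add_increasing
        simp del: ennreal_plus intro!: ennreal_leI)
  also have "\<dots> = ennreal 2" using p q by (simp add: nn_integral_add is_density_def)
  finally show ?thesis .
qed

text \<open>With \<^term>\<open>V\<close> the estimate of \<^term>\<open>W\<close>, the density \<open>q\<close> below has the components of \<^term>\<open>p\<close>
  placed along the rows of \<^term>\<open>V\<close>. Its distance from \<^term>\<open>p\<close> also controls the marginals of
  \<^term>\<open>p\<close> along the rows of \<^term>\<open>V\<close>, since those of \<open>q\<close> are the components of \<^term>\<open>p\<close>.\<close>

lemma unmixing_estimate_hellinger_sq:
  fixes p :: "real ^ 'd \<Rightarrow> real" and V W :: "real ^ 'd ^ 'd"
  assumes p: "is_density p" and z: "zero_mean p" and lc: "log_concave p" and W: "unmixing p W"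
    and V: "orthogonal_matrix V"
    and \<delta>: "sqrt (1 / real CARD('d) * (\<Sum>i\<in>UNIV. (norm (row i V - row i W))\<^sup>2)) \<le> \<delta>"
  shows "1 \<le> cond (covariance p)"
    and "hellinger_sq (\<lambda>x. \<Prod>i\<in>UNIV. marginal_density p (row i V) (row i V \<bullet> x)) p
      \<le> (real CARD('d) + 1) * (676 * 2 ^ CARD('d) * real CARD('d) ^ 3 + 8 * (real CARD('d))\<^sup>2) * real CARD('d)
         * sqrt (cond (covariance p)) * \<delta>"
proof -
  let ?d = "real CARD('d)"
  let ?\<kappa> = "cond (covariance p)"
  have d1: "1 \<le> ?d" by (simp add: Suc_le_eq)
  have oW: "orthogonal_matrix W" using W by (simp add: unmixing_def)
  have [measurable]: "p \<in> borel_measurable borel" using p by (simp add: is_density_def)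
  have mt[measurable]: "(\<lambda>y::real ^ 'd. A *v y) \<in> borel_measurable borel" for A :: "real ^ 'd ^ 'd"
    by (intro borel_measurable_continuous_onI linear_continuous_on linear_conv_bounded_linear[THEN iffD1] matrix_vector_mul_linear)
  obtain f where f: "\<And>i. is_density (f i)" "\<And>i. log_concave_usc (f i)"
      "\<And>i. law (f i) = distr (law p) borel (\<lambda>x. row i W \<bullet> x)"
      and AE: "AE y in lborel. p (transpose W *v y) = (\<Prod>i\<in>UNIV. f i (y $ i))"
    using unmixing_log_concave_factors[OF p log_concave_imp_log_concave_usc[OF lc] W] by blast
  obtain v where v: "\<And>i. (\<integral>\<^sup>+t. ennreal (t\<^sup>2 * f i t) \<partial>lborel) = ennreal (v i)" "\<And>i. 0 < v i"
      "\<And>i j. v j \<le> ?\<kappa> * v i"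
    using unmixing_factor_moments[OF p z W f] by blast
  show \<kappa>1: "1 \<le> ?\<kappa>" using v(3)[of undefined undefined] v(2)[of undefined] by simp
  define F where "F y = (\<Prod>i\<in>UNIV. f i (y $ i))" for y :: "real ^ 'd"
  have dF: "is_density F" unfolding F_def[abs_def] by (rule is_density_product[OF f(1)])
  then have [measurable]: "F \<in> borel_measurable borel" by (simp add: is_density_def)
  define q where "q x = (\<Prod>i\<in>UNIV. f i (row i V \<bullet> x))" for x
  have qF: "q x = F (V *v x)" for x by (simp add: q_def F_def matrix_vector_mult_row)
  have dq: "is_density q" unfolding q_def[abs_def] by (rule is_density_row_product[OF V f(1)])
  then have [measurable]: "q \<in> borel_measurable borel" by (simp add: is_density_def)
  \<comment> \<open>An entry of \<open>R\<close> minus the identity is the inner product of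
    \<open>row i V - row i W\<close> with a unit vector, so it is at most
    \<open>sqrt ?d * \<delta>\<close>, rounded up to \<open>?d * \<delta>\<close>.\<close>
  define \<eta> where "\<eta> = ?d * \<delta>"
  define R where "R = V ** transpose W"
  have R: "\<bar>R $ i $ j - (if i = j then 1 else 0)\<bar> \<le> \<eta>" for i j
  proof -
    have "R $ i $ j = row i V \<bullet> row j W"
      by (simp add: R_def matrix_matrix_mult_def row_def transpose_def inner_vec_def)
    then have "R $ i $ j - (if i = j then 1 else 0) = (row i V - row i W) \<bullet> row j W"
      by (simp add: inner_diff_left orthogonal_matrix_row_inner[OF oW])
    also have "\<bar>\<dots>\<bar> \<le> norm (row i V - row i W) * norm (row j W)" by (rule Cauchy_Schwarz_ineq2)
    also have "\<dots> = norm (row i V - row i W)" by (simp add: orthogonal_matrix_norm_row[OF oW])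
    also have "\<dots> \<le> ?d * sqrt (1 / ?d * (\<Sum>i\<in>UNIV. (norm (row i V - row i W))\<^sup>2))"
    proof -
      have "(norm (row i V - row i W))\<^sup>2 \<le> (\<Sum>i\<in>UNIV. (norm (row i V - row i W))\<^sup>2)"
        by (rule member_le_sum) auto
      also have "\<dots> \<le> ?d\<^sup>2 * (1 / ?d * (\<Sum>i\<in>UNIV. (norm (row i V - row i W))\<^sup>2))"
        using d1 mult_right_mono[OF d1, of "\<Sum>i\<in>UNIV. (norm (row i V - row i W))\<^sup>2"]
        by (simp add: power2_eq_square sum_nonneg)
      finally have "sqrt ((norm (row i V - row i W))\<^sup>2) \<le> sqrt (?d\<^sup>2 * (1 / ?d * (\<Sum>i\<in>UNIV. (norm (row i V - row i W))\<^sup>2)))"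
        by (rule real_sqrt_le_mono)
      then show ?thesis by (subst (asm) real_sqrt_mult) simp
    qed
    also have "\<dots> \<le> ?d * \<delta>" using \<delta> by (intro mult_left_mono) auto
    finally show ?thesis by (simp add: \<eta>_def)
  qed
  have \<eta>0: "0 \<le> \<eta>" using R[of undefined undefined] by (meson abs_ge_zero order_trans)
  have sk: "1 \<le> sqrt ?\<kappa>" using \<kappa>1 by simp
  \<comment> \<open>The summand \<open>8 * ?d^2\<close> serves the case where \<open>\<eta>\<close>
    is too large for the perturbation bound: if \<open>4 * ?d^2 * \<eta> > 1\<close>, it lifts
    \<open>L\<close> above 2, the trivial bound on the L1 distance.\<close>
  define L where "L = (676 * 2 ^ CARD('d) * ?d ^ 3 + 8 * ?d\<^sup>2) * sqrt ?\<kappa> * \<eta>"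
  have L0: "0 \<le> L" using \<eta>0 \<kappa>1 by (simp add: L_def)
  have L: "(\<integral>\<^sup>+x. ennreal \<bar>q x - p x\<bar> \<partial>lborel) \<le> ennreal L"
  proof (cases "4 * ?d\<^sup>2 * \<eta> \<le> 1")
    case True
    have "(\<integral>\<^sup>+x. ennreal \<bar>q x - p x\<bar> \<partial>lborel) = (\<integral>\<^sup>+y. ennreal \<bar>q (transpose W *v y) - p (transpose W *v y)\<bar> \<partial>lborel)"
      by (rule nn_integral_lborel_isometry[symmetric, OF orthogonal_matrix_transpose_isometry[OF oW]]) measurable
    also have "\<dots> = (\<integral>\<^sup>+y. ennreal \<bar>F (R *v y) - F y\<bar> \<partial>lborel)"
    proof (rule nn_integral_cong_AE)
      show "AE y in lborel. ennreal \<bar>q (transpose W *v y) - p (transpose W *v y)\<bar> = ennreal \<bar>F (R *v y) - F y\<bar>"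
        using AE
      proof eventually_elim
        case (elim y)
        have "q (transpose W *v y) = F (R *v y)" by (simp only: qF R_def matrix_vector_mul_assoc)
        with elim show ?case by (simp only: F_def)
      qed
    qed
    also have "\<dots> \<le> ennreal (676 * 2 ^ CARD('d) * ?d ^ 3 * sqrt ?\<kappa> * \<eta>)"
      unfolding F_def
      by (rule product_density_linear_perturbation[OF f(1,2) unmixing_factor_mean[OF p z f(1) f(3)] v R True])
    also have "\<dots> \<le> ennreal L" unfolding L_def using \<eta>0 \<kappa>1 by (intro ennreal_leI) (simp add: algebra_simps)
    finally show ?thesis .
  next
    case False
    have "(\<integral>\<^sup>+x. ennreal \<bar>q x - p x\<bar> \<partial>lborel) \<le> ennreal 2" by (rule L1_densities_le_2[OF dq p])
    also have "\<dots> \<le> ennreal L"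
    proof (rule ennreal_leI)
      have "8 * ?d\<^sup>2 * \<eta> * 1 \<le> 8 * ?d\<^sup>2 * \<eta> * sqrt ?\<kappa>" using sk \<eta>0 by (intro mult_left_mono) auto
      moreover have "0 \<le> 676 * 2 ^ CARD('d) * ?d ^ 3 * sqrt ?\<kappa> * \<eta>" using \<eta>0 \<kappa>1 by simp
      ultimately show "2 \<le> L" using False by (simp add: L_def algebra_simps)
    qed
    finally show ?thesis .
  qed
  let ?m = "\<lambda>i. marginal_density p (row i V)"
  let ?P = "\<lambda>x. \<Prod>i\<in>UNIV. ?m i (row i V \<bullet> x)"
  have nV: "norm (row i V) = 1" for i by (rule orthogonal_matrix_norm_row[OF V])
  have dm: "is_density (?m i)" for i by (rule is_density_marginal[OF p nV])
  have dP: "is_density ?P" by (rule is_density_row_product[OF V dm])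
  have lq: "law (f i) = distr (law q) borel (\<lambda>x. row i V \<bullet> x)" for i
  proof (rule measure_eqI)
    fix A assume "A \<in> sets (law (f i))"
    then have [measurable]: "A \<in> sets borel" by simp
    have "emeasure (distr (law q) borel (\<lambda>x. row i V \<bullet> x)) A = (\<integral>\<^sup>+x. indicator A ((V *v x) $ i) * ennreal (F (V *v x)) \<partial>lborel)"
      by (subst emeasure_distr, measurable, subst emeasure_law[OF dq], measurable)
        (auto intro!: nn_integral_cong simp: indicator_def qF matrix_vector_mult_row)
    also have "\<dots> = (\<integral>\<^sup>+y. indicator A (y $ i) * ennreal (F y) \<partial>lborel)"
      by (rule nn_integral_lborel_isometry[OF orthogonal_matrix_isometry[OF V], of "\<lambda>y. indicator A (y $ i) * ennreal (F y)"]) measurable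
    also have "\<dots> = (\<integral>\<^sup>+t. indicator A t * ennreal (f i t) \<partial>lborel)"
      unfolding F_def by (rule product_density_coordinate_nn_integral[OF f(1)]) measurable
    also have "\<dots> = emeasure (law (f i)) A" by (simp add: emeasure_law[OF f(1)] mult.commute)
    finally show "emeasure (law (f i)) A = emeasure (distr (law q) borel (\<lambda>x. row i V \<bullet> x)) A" ..
  qed simp
  have L': "(\<integral>\<^sup>+x. ennreal \<bar>p x - q x\<bar> \<partial>lborel) \<le> ennreal L"
    using L by (simp add: abs_minus_commute)
  have "hellinger_sq (?m i) (f i) \<le> L / 2" for i
    by (rule hellinger_sq_le_L1[OF dm f(1) _ L0], rule order_trans[OF L1_pushforward_le L'])
      (use dm f(1) p dq lq law_marginal[OF p nV] in auto)
  then have "(\<Sum>i\<in>(UNIV::'d set). hellinger_sq (?m i) (f i)) \<le> (\<Sum>i\<in>(UNIV::'d set). L / 2)" by (rule sum_mono)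
  then have 1: "hellinger_sq ?P q \<le> ?d * (L / 2)"
    unfolding q_def[abs_def] using hellinger_sq_row_product[OF V, of ?m f, OF dm f(1)] by simp
  have 2: "hellinger_sq q p \<le> L / 2" by (rule hellinger_sq_le_L1[OF dq p L L0])
  \<comment> \<open>The triangle inequality doubles the two errors \<open>?d * L / 2\<close> and
    \<open>L / 2\<close>.\<close>
  have "hellinger_sq ?P p \<le> (?d + 1) * L"
    using hellinger_sq_triangle[OF dP dq p] 1 2 by (simp add: algebra_simps)
  then show "hellinger_sq ?P p
      \<le> (?d + 1) * (676 * 2 ^ CARD('d) * ?d ^ 3 + 8 * ?d\<^sup>2) * ?d * sqrt ?\<kappa> * \<delta>"
    by (simp add: L_def \<eta>_def mult_ac)
qed

section \<open>Sample complexities\<close>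

text \<open>The infimum of the empty set is \<open>\<infinity>\<close>, above every
  \<open>enat N\<close>, so the set is nonempty; in a well-order its infimum is then
  attained.\<close>

lemma Inf_enat_image_leD:
  assumes "Inf (enat ` A) \<le> enat N" shows "\<exists>n\<in>A. n \<le> N"
proof -
  have "A \<noteq> {}" using assms by (auto simp: top_enat_def)
  then obtain k where "k \<in> A" by blast
  then have "enat k \<in> enat ` A" by (rule imageI)
  then have "Inf (enat ` A) \<in> enat ` A" by (rule wellorder_InfI)
  then show ?thesis using assms by auto
qed

lemma N_star_leD:
  assumes "N_star E \<epsilon> \<gamma> f \<le> enat N"
  shows "0 < N" and "1 - \<gamma> \<le> \<P>(z in \<Pi>\<^sub>M k\<in>{..<N}. law f. hellinger_sq (E N z) f \<le> \<epsilon>)"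
  using Inf_enat_image_leD[OF assms[unfolded N_star_def]] by auto

lemma M_star_leD:
  fixes U :: "nat \<Rightarrow> (nat \<Rightarrow> real ^ 'd) \<Rightarrow> real ^ 'd ^ 'd"
  assumes "M_star U \<epsilon> \<gamma> p \<le> enat M"
  shows "0 < M" and "1 - \<gamma> \<le> \<P>(y in \<Pi>\<^sub>M k\<in>{..<M}. law p. \<exists>W. unmixing p W \<and>
    sqrt (1 / real CARD('d) * (\<Sum>i\<in>UNIV. (norm (row i (U M y) - row i W))\<^sup>2)) \<le> \<epsilon>)"
  using Inf_enat_image_leD[OF assms[unfolded M_star_def]] by auto

text \<open>Transfers a sample complexity stated for the marginal to the projections of samples of
  \<open>p\<close>: a map applied to every coordinate of a product measure pushes each factor
  forward.\<close>

lemma distr_PiM_projection: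
  fixes p :: "'a::euclidean_space \<Rightarrow> real"
  assumes p: "is_density p" and w: "norm w = 1"
  shows "distr (\<Pi>\<^sub>M k\<in>{..<N}. law p) (\<Pi>\<^sub>M k\<in>{..<N}. borel) (\<lambda>X. \<lambda>n\<in>{..<N}. w \<bullet> X n)
    = (\<Pi>\<^sub>M k\<in>{..<N::nat}. law (marginal_density p w))"
proof -
  interpret p: prob_space "law p" by (rule prob_space_law[OF p])
  let ?D = "distr (law p) borel (\<lambda>x. w \<bullet> x)"
  have "distr (\<Pi>\<^sub>M k\<in>{..<N}. law p) (\<Pi>\<^sub>M k\<in>{..<N}. borel) (compose {..<N} (\<lambda>x. w \<bullet> x))
    = distr (\<Pi>\<^sub>M k\<in>{..<N}. law p) (\<Pi>\<^sub>M k\<in>{..<N}. ?D) (compose {..<N} (\<lambda>x. w \<bullet> x))"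
    by (intro distr_cong refl sets_PiM_cong) auto
  also have "\<dots> = (\<Pi>\<^sub>M k\<in>{..<N}. distr (law p) ?D (\<lambda>x. w \<bullet> x))"
    by (rule distr_PiM_finite_prob_space') (auto intro: p.prob_space_axioms p.prob_space_distr)
  also have "distr (law p) ?D (\<lambda>x. w \<bullet> x) = ?D" by (intro distr_cong refl) auto
  finally have "distr (\<Pi>\<^sub>M k\<in>{..<N}. law p) (\<Pi>\<^sub>M k\<in>{..<N}. borel) (compose {..<N} (\<lambda>x. w \<bullet> x))
    = (\<Pi>\<^sub>M k\<in>{..<N}. ?D)" .
  moreover have "compose {..<N} (\<lambda>x. w \<bullet> x) = (\<lambda>X. \<lambda>n\<in>{..<N}. w \<bullet> X n)" by (simp add: compose_def fun_eq_iff)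
  ultimately show ?thesis by (simp only: law_marginal[OF p w])
qed

text \<open>A union bound over the rows of a fixed matrix, each row failing with probability at most
  \<open>\<gamma> / real CARD('d)\<close>.\<close>

lemma proposed_estimator_slice_prob:
  fixes p :: "real ^ 'd \<Rightarrow> real" and V :: "real ^ 'd ^ 'd"
  assumes p: "is_density p" and V: "orthogonal_matrix V" and E: "univariate_density_estimator E"
    and N: "0 < N" and \<gamma>: "\<gamma> < 1"
    and prob: "\<And>i. 1 - \<gamma> / real CARD('d) \<le>
      \<P>(z in \<Pi>\<^sub>M k\<in>{..<N}. law (marginal_density p (row i V)). hellinger_sq (E N z) (marginal_density p (row i V)) \<le> e)"
  obtains B where "B \<in> sets (\<Pi>\<^sub>M n\<in>{..<N}. law p)" "1 - \<gamma> \<le> measure (\<Pi>\<^sub>M n\<in>{..<N}. law p) B"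
    "\<And>X i. X \<in> B \<Longrightarrow> hellinger_sq (E N (\<lambda>n\<in>{..<N}. row i V \<bullet> X n)) (marginal_density p (row i V)) \<le> e"
proof -
  let ?PX = "\<Pi>\<^sub>M n\<in>{..<N}. law p"
  let ?m = "\<lambda>i. marginal_density p (row i V)"
  let ?Z = "\<lambda>i. \<Pi>\<^sub>M k\<in>{..<N}. law (?m i)"
  let ?\<pi> = "\<lambda>i X. \<lambda>n\<in>{..<N}. row i V \<bullet> X n"
  have d1: "1 \<le> real CARD('d)" by (simp add: Suc_le_eq)
  have nV: "norm (row i V) = 1" for i by (rule orthogonal_matrix_norm_row[OF V])
  interpret PX: prob_space ?PX by (intro prob_space_PiM prob_space_law[OF p])
  have sZ: "sets (?Z i) = sets (\<Pi>\<^sub>M k\<in>{..<N}. borel)" for i by (intro sets_PiM_cong) auto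
  have \<pi>m: "?\<pi> i \<in> measurable ?PX (\<Pi>\<^sub>M k\<in>{..<N}. borel)" for i by measurable
  define T where "T i = {z \<in> space (?Z i). hellinger_sq (E N z) (?m i) \<le> e}" for i
  have "\<gamma> < real CARD('d)" using \<gamma> d1 by linarith
  then have "\<gamma> / real CARD('d) < 1" by (simp add: divide_less_eq)
  \<comment> \<open>\<open>measure\<close> is 0 by default outside the sigma-algebra, so a positive
    probability proves \<open>T i\<close> measurable.\<close>
  then have "0 < measure (?Z i) (T i)" for i using prob[of i] unfolding T_def by linarith
  then have T: "T i \<in> sets (\<Pi>\<^sub>M k\<in>{..<N}. borel)" for i
    by (metis measure_notin_sets less_irrefl sZ)
  define B where "B i = ?\<pi> i -` T i \<inter> space ?PX" for i
  have B: "B i \<in> sets ?PX" for i unfolding B_def by (rule measurable_sets[OF \<pi>m T])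
  have PB: "1 - \<gamma> / real CARD('d) \<le> measure ?PX (B i)" for i
  proof -
    have "measure ?PX (B i) = measure (distr ?PX (\<Pi>\<^sub>M k\<in>{..<N}. borel) (?\<pi> i)) (T i)"
      unfolding B_def by (rule measure_distr[symmetric, OF \<pi>m T])
    also have "\<dots> = measure (?Z i) (T i)" by (simp only: distr_PiM_projection[OF p nV])
    finally show ?thesis using prob[of i] by (simp add: T_def)
  qed
  let ?C = "space ?PX - (\<Union>i. space ?PX - B i)"
  have "PX.prob (\<Union>i. space ?PX - B i) \<le> (\<Sum>i\<in>UNIV. PX.prob (space ?PX - B i))"
    by (rule PX.finite_measure_subadditive_finite) (auto intro: B)
  also have "\<dots> \<le> (\<Sum>i\<in>(UNIV::'d set). \<gamma> / real CARD('d))"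
  proof (rule sum_mono)
    fix i show "PX.prob (space ?PX - B i) \<le> \<gamma> / real CARD('d)"
      using PB[of i] by (simp add: PX.prob_compl[OF B])
  qed
  also have "\<dots> = \<gamma>" by simp
  finally have "1 - \<gamma> \<le> PX.prob ?C"
    using B by (subst PX.prob_compl) (auto intro!: sets.finite_UN)
  moreover have "?C \<in> sets ?PX" using B by (auto intro!: sets.Diff sets.finite_UN)
  moreover have "hellinger_sq (E N (?\<pi> i X)) (?m i) \<le> e" if "X \<in> ?C" for X i
  proof -
    have "X \<in> B i" using that by auto
    then show ?thesis by (simp add: B_def T_def)
  qed
  ultimately show ?thesis using that by blast
qed

theorem theorem3p7:
  "\<exists>K>0. \<forall>(p :: real ^ 'd \<Rightarrow> real)
      (U :: nat \<Rightarrow> (nat \<Rightarrow> real ^ 'd) \<Rightarrow> real ^ 'd ^ 'd)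
      (E :: nat \<Rightarrow> (nat \<Rightarrow> real) \<Rightarrow> real \<Rightarrow> real)
      (\<epsilon> :: real) (\<gamma> :: real) (N :: nat) (M :: nat).
     is_density p \<longrightarrow> zero_mean p \<longrightarrow> log_concave p \<longrightarrow>
     orthogonal_independent_components p \<longrightarrow>
     unmixing_matrix_estimator U \<longrightarrow> univariate_density_estimator E \<longrightarrow>
     0 < \<epsilon> \<longrightarrow> 0 < \<gamma> \<longrightarrow> \<gamma> < 1 \<longrightarrow>
     enat N \<ge> (SUP s\<in>sphere 0 1.
        N_star E (\<epsilon> / (4 * real CARD('d))) (\<gamma> / (2 * real CARD('d))) (marginal_density p s)) \<longrightarrow>
     enat M \<ge> M_star U ((K * cond (covariance p)) powr (- 1 / 2) * \<epsilon>\<^sup>2) (\<gamma> / 2) p \<longrightarrow>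
     \<P>(\<omega> in (\<Pi>\<^sub>M n\<in>{..<N}. law p) \<Otimes>\<^sub>M (\<Pi>\<^sub>M m\<in>{..<M}. law p).
        hellinger_sq (proposed_estimator U E N M (fst \<omega>) (snd \<omega>)) p \<le> \<epsilon>) \<ge> 1 - \<gamma>"
proof -
  define D where "D = real CARD('d)"
  define C where "C = (D + 1) * (676 * 2 ^ CARD('d) * D ^ 3 + 8 * D\<^sup>2) * D"
  have D1: "1 \<le> D" by (simp add: D_def Suc_le_eq)
  have "0 < (676 * 2 ^ CARD('d) * D ^ 3 + 8 * D\<^sup>2)" using D1 by (intro add_pos_pos) auto
  then have C0: "0 < C" using D1 by (auto simp: C_def)
  \<comment> \<open>Chosen so that \<open>K powr (- 1 / 2) = 1 / (4 * C)\<close>; the allowed matrix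
    error then turns the linear Hellinger bound into \<open>\<epsilon>^2 / 4\<close>.\<close>
  define K where "K = (4 * C)\<^sup>2"
  have K0: "0 < K" using C0 by (simp add: K_def)
  have "1 - \<gamma> \<le> \<P>(\<omega> in (\<Pi>\<^sub>M n\<in>{..<N}. law p) \<Otimes>\<^sub>M (\<Pi>\<^sub>M m\<in>{..<M}. law p).
        hellinger_sq (proposed_estimator U E N M (fst \<omega>) (snd \<omega>)) p \<le> \<epsilon>)"
    if p: "is_density p" and z: "zero_mean p" and lc: "log_concave p" and oic: "orthogonal_independent_components p"
      and U: "unmixing_matrix_estimator U" and E: "univariate_density_estimator E"
      and \<epsilon>: "0 < \<epsilon>" and \<gamma>: "0 < \<gamma>" "\<gamma> < 1"
      and N: "(SUP s\<in>sphere 0 1. N_star E (\<epsilon> / (4 * real CARD('d))) (\<gamma> / (2 * real CARD('d))) (marginal_density p s)) \<le> enat N"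
      and M: "M_star U ((K * cond (covariance p)) powr (- 1 / 2) * \<epsilon>\<^sup>2) (\<gamma> / 2) p \<le> enat M"
    for p :: "real ^ 'd \<Rightarrow> real" and U E \<epsilon> \<gamma> N M
  proof -
    let ?m = "\<lambda>s. marginal_density p s"
    let ?PX = "\<Pi>\<^sub>M n\<in>{..<N}. law p" and ?PY = "\<Pi>\<^sub>M m\<in>{..<M}. law p"
    let ?\<delta> = "(K * cond (covariance p)) powr (- 1 / 2) * \<epsilon>\<^sup>2"
    let ?est = "\<lambda>X y. proposed_estimator U E N M X y"
    have Ns: "N_star E (\<epsilon> / (4 * D)) (\<gamma> / (2 * D)) (?m s) \<le> enat N" if "norm s = 1" for s
      using that by (intro order_trans[OF SUP_upper N[folded D_def]]) (simp add: dist_norm)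
    have Nprob: "1 - (\<gamma> / 2) / D \<le> \<P>(z in \<Pi>\<^sub>M k\<in>{..<N}. law (?m s). hellinger_sq (E N z) (?m s) \<le> \<epsilon> / (4 * D))"
      if "norm s = 1" for s
      using N_star_leD(2)[OF Ns[OF that]] by (simp add: mult.commute)
    have N0: "0 < N" by (rule N_star_leD(1)[OF Ns[of "axis undefined 1"]]) (simp add: norm_axis_1)
    have M0: "0 < M" by (rule M_star_leD(1)[OF M])
    interpret PX: prob_space ?PX by (intro prob_space_PiM prob_space_law[OF p])
    interpret PY: prob_space ?PY by (intro prob_space_PiM prob_space_law[OF p])
    interpret P: pair_prob_space ?PX ?PY ..
    have oU: "orthogonal_matrix (U M y)" if "y \<in> space ?PY" for y
      using U M0 that by (auto simp: unmixing_matrix_estimator_def space_PiM)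
    have dE: "is_density (E N (\<lambda>n\<in>{..<N}. w \<bullet> X n))" for w and X :: "nat \<Rightarrow> real ^ 'd"
      using E N0 by (auto simp: univariate_density_estimator_def space_PiM)
    have est: "hellinger_sq (?est X y) p \<le> \<epsilon>"
      if y: "y \<in> space ?PY" and W: "unmixing p W"
        and \<delta>: "sqrt (1 / real CARD('d) * (\<Sum>i\<in>UNIV. (norm (row i (U M y) - row i W))\<^sup>2)) \<le> ?\<delta>"
        and h: "\<And>i. hellinger_sq (E N (\<lambda>n\<in>{..<N}. row i (U M y) \<bullet> X n)) (?m (row i (U M y))) \<le> \<epsilon> / (4 * D)"
      for X y W
    proof -
      let ?V = "U M y"
      let ?e = "\<lambda>i. E N (\<lambda>n\<in>{..<N}. row i ?V \<bullet> X n)"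
      let ?Q = "\<lambda>x. \<Prod>i\<in>UNIV. ?m (row i ?V) (row i ?V \<bullet> x)"
      have dm: "is_density (?m (row i ?V))" for i
        by (rule is_density_marginal[OF p orthogonal_matrix_norm_row[OF oU[OF y]]])
      have eq: "?est X y = (\<lambda>x. \<Prod>i\<in>UNIV. ?e i (row i ?V \<bullet> x))"
        by (simp add: proposed_estimator_def[abs_def] Let_def)
      have de: "is_density (?est X y)" unfolding eq by (rule is_density_row_product[OF oU[OF y] dE])
      have dQ: "is_density ?Q" by (rule is_density_row_product[OF oU[OF y] dm])
      show ?thesis
      \<comment> \<open>For \<open>\<epsilon> > 1\<close> the bound 1 on the squared Hellinger
        distance suffices; otherwise \<open>\<epsilon>^2 \<le> \<epsilon>\<close> is
        available.\<close>
      proof (cases "\<epsilon> \<le> 1")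
        case False
        then show ?thesis using hellinger_sq_le_1[OF de p] by simp
      next
        case True
        note core = unmixing_estimate_hellinger_sq[OF p z lc W oU[OF y] \<delta>]
        have \<kappa>: "0 < cond (covariance p)" using core(1) by simp
        have "hellinger_sq (?est X y) ?Q \<le> (\<Sum>i\<in>UNIV. hellinger_sq (?e i) (?m (row i ?V)))"
          unfolding eq by (rule hellinger_sq_row_product[OF oU[OF y] dE dm])
        also have "\<dots> \<le> (\<Sum>i\<in>(UNIV::'d set). \<epsilon> / (4 * D))" by (intro sum_mono h)
        also have "\<dots> = \<epsilon> / 4" using D1 by (simp add: D_def)
        finally have 1: "hellinger_sq (?est X y) ?Q \<le> \<epsilon> / 4" .
        have half: "t powr (- 1 / 2) = 1 / sqrt t" if "0 < t" for t :: real
          using powr_minus_divide[of t "1 / 2"] powr_half_sqrt[of t] that by simp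
        have "K powr (- 1 / 2) = 1 / sqrt K" by (rule half[OF K0])
        also have "sqrt K = 4 * C" unfolding K_def using C0 by (subst real_sqrt_abs) simp
        finally have Kp: "K powr (- 1 / 2) = 1 / (4 * C)" .
        have \<kappa>p: "cond (covariance p) powr (- 1 / 2) = 1 / sqrt (cond (covariance p))"
          by (rule half[OF \<kappa>])
        have "hellinger_sq ?Q p \<le> C * sqrt (cond (covariance p)) * ?\<delta>"
          using core(2) by (simp only: C_def D_def)
        also have "\<dots> = \<epsilon>\<^sup>2 / 4"
        proof -
          have "(K * cond (covariance p)) powr (- 1 / 2) = 1 / (4 * C) * (1 / sqrt (cond (covariance p)))"
            unfolding Kp[symmetric] \<kappa>p[symmetric] by (rule powr_mult)
          then show ?thesis using C0 \<kappa> by simp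
        qed
        also have "\<dots> \<le> \<epsilon> / 4" using True \<epsilon> by (simp add: power2_eq_square)
        finally show ?thesis using hellinger_sq_triangle[OF de dQ p] 1 by simp
      qed
    qed
    have sX: "sets ?PX = sets (\<Pi>\<^sub>M k\<in>{..<N}. borel)" and sY: "sets ?PY = sets (\<Pi>\<^sub>M k\<in>{..<M}. borel)"
      by (auto intro!: sets_PiM_cong)
    have [measurable]: "U M \<in> borel_measurable ?PY"
      using U M0 by (simp add: unmixing_matrix_estimator_def measurable_cong_sets[OF sY refl])
    have rowm[measurable]: "(\<lambda>W :: real ^ 'd ^ 'd. row i W) \<in> borel_measurable borel" for i
    proof -
      have "(\<lambda>W :: real ^ 'd ^ 'd. row i W) = (\<lambda>W. W $ i)" by (simp add: row_def vec_eq_iff fun_eq_iff)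
      then show ?thesis by (simp add: borel_measurable_continuous_onI continuous_on_component)
    qed
    have Em: "(\<lambda>a. E N (g a) (h a)) \<in> borel_measurable A"
      if "g \<in> measurable A (\<Pi>\<^sub>M k\<in>{..<N}. borel)" "h \<in> borel_measurable A" for g h and A :: "'x measure"
    proof -
      have "(\<lambda>(z, t). E N z t) \<in> borel_measurable ((\<Pi>\<^sub>M k\<in>{..<N}. borel) \<Otimes>\<^sub>M borel)"
        using E N0 by (simp add: univariate_density_estimator_def)
      from measurable_compose[OF measurable_Pair[OF that] this] show ?thesis by simp
    qed
    have [measurable]: "p \<in> borel_measurable borel" using p by (simp add: is_density_def)
    have estm: "(\<lambda>(\<omega>, x). ?est (fst \<omega>) (snd \<omega>) x) \<in> borel_measurable ((?PX \<Otimes>\<^sub>M ?PY) \<Otimes>\<^sub>M lborel)"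
      unfolding proposed_estimator_def Let_def case_prod_beta
      by (intro borel_measurable_prod Em measurable_restrict) measurable
    \<comment> \<open>The success event is measurable because the estimate is jointly measurable in
      the samples and the point; this allows its probability to be computed by sections.\<close>
    have Sm: "{\<omega> \<in> space (?PX \<Otimes>\<^sub>M ?PY). hellinger_sq (?est (fst \<omega>) (snd \<omega>)) p \<le> \<epsilon>} \<in> sets (?PX \<Otimes>\<^sub>M ?PY)"
    proof -
      have "(\<lambda>(\<omega>, x). (sqrt (p x) - sqrt (?est (fst \<omega>) (snd \<omega>) x))\<^sup>2) \<in> borel_measurable ((?PX \<Otimes>\<^sub>M ?PY) \<Otimes>\<^sub>M lborel)"
        using estm unfolding case_prod_beta by measurable
      then have "(\<lambda>\<omega>. LINT x|lborel. (sqrt (p x) - sqrt (?est (fst \<omega>) (snd \<omega>) x))\<^sup>2) \<in> borel_measurable (?PX \<Otimes>\<^sub>M ?PY)"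
        by (rule lborel.borel_measurable_lebesgue_integral)
      then show ?thesis unfolding hellinger_sq_def by measurable
    qed
    define S where "S = {\<omega> \<in> space (?PX \<Otimes>\<^sub>M ?PY). hellinger_sq (?est (fst \<omega>) (snd \<omega>)) p \<le> \<epsilon>}"
    define G where "G = {y \<in> space ?PY. \<exists>W. unmixing p W \<and>
      sqrt (1 / real CARD('d) * (\<Sum>i\<in>UNIV. (norm (row i (U M y) - row i W))\<^sup>2)) \<le> ?\<delta>}"
    have PG: "1 - \<gamma> / 2 \<le> measure ?PY G" unfolding G_def by (rule M_star_leD(2)[OF M])
    then have "0 < measure ?PY G" using \<gamma> by linarith
    \<comment> \<open>Positive measure again forces membership in the sigma-algebra, which settles
      the existential quantifier over \<open>W\<close> in \<open>G\<close>.\<close>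
    then have Gm: "G \<in> sets ?PY" by (metis measure_notin_sets less_irrefl)
    \<comment> \<open>For fixed \<open>y\<close> the projection directions are fixed, so the
      univariate guarantees apply to the samples \<open>X\<close>.\<close>
    have slice: "ennreal (1 - \<gamma> / 2) \<le> emeasure ?PX ((\<lambda>x. (x, y)) -` S)" if "y \<in> G" for y
    proof -
      from that obtain W where y: "y \<in> space ?PY" and W: "unmixing p W"
          "sqrt (1 / real CARD('d) * (\<Sum>i\<in>UNIV. (norm (row i (U M y) - row i W))\<^sup>2)) \<le> ?\<delta>"
        by (auto simp: G_def)
      obtain B where B: "B \<in> sets ?PX" "1 - \<gamma> / 2 \<le> measure ?PX B"
          "\<And>X i. X \<in> B \<Longrightarrow> hellinger_sq (E N (\<lambda>n\<in>{..<N}. row i (U M y) \<bullet> X n)) (?m (row i (U M y))) \<le> \<epsilon> / (4 * D)"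
        using proposed_estimator_slice_prob[OF p oU[OF y] E N0, of "\<gamma> / 2" "\<epsilon> / (4 * D)"]
          Nprob[OF orthogonal_matrix_norm_row[OF oU[OF y]]] \<gamma> unfolding D_def by auto
      have "B \<subseteq> (\<lambda>x. (x, y)) -` S"
      proof
        fix X assume X: "X \<in> B"
        have "hellinger_sq (?est X y) p \<le> \<epsilon>" by (rule est[OF y W B(3)[OF X]])
        then show "X \<in> (\<lambda>x. (x, y)) -` S"
          using X sets.sets_into_space[OF B(1)] y by (auto simp: S_def space_pair_measure)
      qed
      moreover have "(\<lambda>x. (x, y)) -` S \<in> sets ?PX" using Sm unfolding S_def[symmetric] by (rule sets_Pair2)
      ultimately have "emeasure ?PX B \<le> emeasure ?PX ((\<lambda>x. (x, y)) -` S)" by (rule emeasure_mono)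
      then show ?thesis using B(2) by (simp add: PX.emeasure_eq_measure)
    qed
    \<comment> \<open>Integrating the section bound over \<open>G\<close> gives
      \<open>(1 - \<gamma> / 2)^2\<close>, which exceeds \<open>1 - \<gamma>\<close> by
      \<open>\<gamma>^2 / 4\<close>.\<close>
    have "ennreal ((1 - \<gamma> / 2) * (1 - \<gamma> / 2)) \<le> ennreal (1 - \<gamma> / 2) * emeasure ?PY G"
      using PG \<gamma> by (simp add: PY.emeasure_eq_measure ennreal_mult[symmetric] mult_left_mono)
    also have "\<dots> = (\<integral>\<^sup>+y. ennreal (1 - \<gamma> / 2) * indicator G y \<partial>?PY)"
      using Gm by (simp add: nn_integral_cmult_indicator)
    also have "\<dots> \<le> (\<integral>\<^sup>+y. emeasure ?PX ((\<lambda>x. (x, y)) -` S) \<partial>?PY)"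
      using slice by (intro nn_integral_mono) (auto simp: indicator_def)
    also have "\<dots> = emeasure (?PX \<Otimes>\<^sub>M ?PY) S"
      using Sm unfolding S_def[symmetric] by (rule P.emeasure_pair_measure_alt2[symmetric])
    finally have "(1 - \<gamma> / 2) * (1 - \<gamma> / 2) \<le> measure (?PX \<Otimes>\<^sub>M ?PY) S"
      by (simp add: P.emeasure_eq_measure)
    moreover have "1 - \<gamma> \<le> (1 - \<gamma> / 2) * (1 - \<gamma> / 2)" by (simp add: algebra_simps)
    ultimately show ?thesis by (simp add: S_def)
  qed
  then show ?thesis using K0 by blast
qed

end
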